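(* Let $T>0$, $I=[-T,T]$, $|I|=2T\ge 1$, $N\ge 1$, and let $G\colon\mathbb{R}^N\to[0,\infty)$ be a continuously differentiable G-function satisfying the $\Delta_2$ and $\nabla_2$ conditions at infinity. Let $F\colon I\times\mathbb{R}^N\times\mathbb{R}^N\to\mathbb{R}$ be of class $C^1$ and $V\in C^1(I\times\mathbb{R}^N,\mathbb{R})$. Assume the following. Assumptions on $F$ (in (F6), $\rho$ is the constant from (V3) below): (F1) $F(t,x,\cdot)$ is convex for all $(t,x)\in I\times\mathbb{R}^N$. (F2) There exist $a\in C(\mathbb{R}_+,\mathbb{R}_+)$ and $\beta\in L^1(I,\mathbb{R}_+)$ such that for all $(t,x,v)\in I\times\mathbb{R}^N\times\mathbb{R}^N$: $|F(t,x,v)|\le a(|x|)(\beta(t)+G(v))$, $|F_x(t,x,v)|\le a(|x|)(\beta(t)+G(v))$, and $G^\ast(F_v(t,x,v))\le a(|x|)\big(\beta(t)+G^\ast(\nabla G(v))\big)$. (F3) There exists $\theta_F>0$ such that $\langle F_x(t,x,v),x\rangle+\langle F_v(t,x,v),v\rangle\le\theta_F F(t,x,v)$ for all $(t,x,v)\in I\times\mathbb{R}^N\times\mathbb{R}^N$. (F4) There exists $\Lambda>0$ such that $F(t,x,v)\ge\Lambda G(v)$ for all $(t,x,v)\in I\times\mathbb{R}^N\times\mathbb{R}^N$. (F5) $F(t,x,0)=0$ and $F_v(t,x,0)=0$ for all $(t,x)\in I\times\mathbb{R}^N$. (F6) There exist $\zeta_F>1$ and $\lambda_0\in(0,1)$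 such that $F(t,\lambda x,\lambda v)\le\lambda^{\zeta_F}F(t,x,v)$ for all $\lambda\in(0,\lambda_0)$, $t\in I$, $v\in\mathbb{R}^N$ and all $x\in\mathbb{R}^N$ with $G\left(\frac{x}{2|I|}\right)\le\frac{\rho}{2}$. Assumptions on $V$: (V1) $V(t,x)=K(t,x)-W(t,x)$ for $x\in\mathbb{R}^N$, $t\in I$, where $K,W\colon I\times\mathbb{R}^N\to\mathbb{R}$. (V2) There exist $M>0$, $\varepsilon_V>0$, $\theta_V>\theta_F$ and $1<p_K\le\theta_V-\varepsilon_V$ such that for $|x|>M$, $t\in I$: $\langle V_x(t,x),x\rangle\le(\theta_V-\varepsilon_V)K(t,x)-\theta_V W(t,x)$ and $W(t,x)>K(t,x)>|x|^{p_K}$. (V3) There exist $\rho>0$, $b>1$ and $g\in L^1(I,\mathbb{R})$ such that $V(t,x)\ge b\,G(x)-g(t)$ for all $t\in I$ and all $x\in\mathbb{R}^N$ with $G\left(\frac{x}{2|I|}\right)\le\frac{\rho}{2}$. (V4) $\int_I V(t,0)\,dt=0$. (V5) There exist $\zeta_K,\zeta_W>1$ with $\zeta_W<\min\{\zeta_F,\zeta_K\}$ and $\lambda_0\in(0,1)$ such that for all $t\in I$ and all $x\in\mathbb{R}^N$ with $G\left(\frac{x}{2|I|}\right)\le\frac{\rho}{2}$: $W(t,x)>0$ if $x\ne0$, and $V(t,\lambda x)\le\lambda^{\zeta_K}K(t,x)-\lambda^{\zeta_W}W(t,x)$ for all $\lambda\in(0,\lambda_0)$. Assume moreover that there is no forcing,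 $f\equiv0$, and that (with $\Lambda$ from (F4) and $\rho,b,g$ from (V3)) (f) $\int_I \big(G^\ast(f(t))+g(t)\big)\,dt=\int_I g(t)\,dt<\min\{\Lambda,b-1\}\,\rho$. Let $\mathcal{L}(t,x,v)=F(t,x,v)+V(t,x)$. Then the problem $$\frac{d}{dt}\mathcal{L}_v(t,u(t),\dot u(t))=\mathcal{L}_x(t,u(t),\dot u(t))\ \text{ for a.e. } t\in I,\qquad u(-T)=u(T),$$ has at least two nontrivial periodic solutions.
   Context: $\langle\cdot,\cdot\rangle$ and $|\cdot|$ are the Euclidean inner product and norm on $\mathbb{R}^N$; $\mathbb{R}_+=[0,\infty)$; subscripts $x,v$ denote gradients in these variables. A G-function is a function $G\colon\mathbb{R}^N\to[0,\infty)$ that is convex, even, with $G(0)=0$ and $G(x)/|x|\to\infty$ as $|x|\to\infty$. $\Delta_2$ at infinity: there are $C>0$, $R>0$ with $G(2x)\le C\,G(x)$ for $|x|\ge R$. $\nabla_2$ at infinity: there are $C>1$, $R>0$ with $G(x)\le\frac{1}{2C}G(Cx)$ for $|x|\ge R$. The Fenchel conjugate is $G^\ast(y)=\sup_{x\in\mathbb{R}^N}\{\langle x,y\rangle-G(x)\}$ (so $G^\ast(0)=0$). The Orlicz space is $\mathbf{L}^G=\mathbf{L}^G(I,\mathbb{R}^N)=\{u\colon I\to\mathbb{R}^N \text{ measurable}:\int_I G(u)\,dt<\infty\}$ with the Luxemburg norm $\|u\|_{\mathbf{L}^G}=\inf\{\lambda>0:\int_I G(u/\lambda)\,dt\le1\}$.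 The anisotropic Orlicz-Sobolev space is $\mathbf{W}^1\mathbf{L}^G=\{u\in\mathbf{L}^G:\dot u\in\mathbf{L}^G\}$ with norm $\|u\|_{\mathbf{L}^G}+\|\dot u\|_{\mathbf{L}^G}$ (its elements are absolutely continuous), and $\mathbf{W}^1_T\mathbf{L}^G=\{u\in\mathbf{W}^1\mathbf{L}^G:u(-T)=u(T)\}$. A periodic solution of the problem is a function $u\in\mathbf{W}^1_T\mathbf{L}^G$ satisfying the equation for a.e. $t\in I$ (where $t\mapsto\mathcal{L}_v(t,u(t),\dot u(t))$, defined a.e., is understood to have an absolutely continuous representative). Nontrivial means $u\not\equiv0$. *)

theory Defs
  imports "HOL-Analysis.Analysis"
begin

section \<open>Differentiability\<close>

definition gradient :: "('a::real_inner \<Rightarrow> real) \<Rightarrow> 'a \<Rightarrow> 'a" where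
  "gradient f x = (THE D. GDERIV f x :> D)"

text \<open>
  On a set that is not open, such as a compact interval times a vector space, the derivative is
  taken within the set, so it is one-sided at the end points of the interval.
\<close>

definition C1_on :: "'a::real_normed_vector set \<Rightarrow> ('a \<Rightarrow> 'b::real_normed_vector) \<Rightarrow> bool" where
  "C1_on S f \<longleftrightarrow>
     (\<exists>f'. (\<forall>x\<in>S. (f has_derivative blinfun_apply (f' x)) (at x within S)) \<and> continuous_on S f')"

text \<open>
  The epsilon-delta notion of absolute continuity of a function on a real interval. The set
  \<open>d\<close> is a finite family of nonempty compact intervals with pairwise disjoint interiors,
  so that \<open>Inf k\<close> and \<open>Sup k\<close> are the end points of \<open>k\<close>.
\<close>

definition abs_continuous_on :: "real set \<Rightarrow> (real \<Rightarrow> 'a::real_normed_vector) \<Rightarrow> bool" where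
  "abs_continuous_on S f \<longleftrightarrow>
     (\<forall>\<epsilon>>0. \<exists>\<delta>>0. \<forall>d. d division_of \<Union>d \<and> \<Union>d \<subseteq> S \<and> (\<Sum>k\<in>d. Sup k - Inf k) < \<delta>
        \<longrightarrow> (\<Sum>k\<in>d. norm (f (Sup k) - f (Inf k))) < \<epsilon>)"


section \<open>G-functions\<close>

definition G_function :: "('a::euclidean_space \<Rightarrow> real) \<Rightarrow> bool" where
  "G_function G \<longleftrightarrow>
     (\<forall>x. 0 \<le> G x) \<and> convex_on UNIV G \<and> (\<forall>x. G (- x) = G x) \<and> G 0 = 0 \<and>
     filterlim (\<lambda>x. G x / norm x) at_top at_infinity"

definition Delta2_at_infinity :: "('a::euclidean_space \<Rightarrow> real) \<Rightarrow> bool" where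
  "Delta2_at_infinity G \<longleftrightarrow>
     (\<exists>C>0. \<exists>R>0. \<forall>x. R \<le> norm x \<longrightarrow> G (2 *\<^sub>R x) \<le> C * G x)"

definition Nabla2_at_infinity :: "('a::euclidean_space \<Rightarrow> real) \<Rightarrow> bool" where
  "Nabla2_at_infinity G \<longleftrightarrow>
     (\<exists>C>1. \<exists>R>0. \<forall>x. R \<le> norm x \<longrightarrow> G x \<le> 1 / (2 * C) * G (C *\<^sub>R x))"

text \<open>
  For a G-function the supremum is over a set that is bounded above, by superlinear growth, so
  the real-valued supremum is the true one.
\<close>

definition fenchel_conjugate :: "('a::euclidean_space \<Rightarrow> real) \<Rightarrow> 'a \<Rightarrow> real" where
  "fenchel_conjugate G y = (SUP x. inner x y - G x)"


section \<open>Orlicz and Orlicz-Sobolev spaces\<close>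

text \<open>
  The spaces are sets of functions \<open>real \<Rightarrow> 'a\<close>, of which only the values on the
  interval matter; the elements of the Sobolev space are given by their absolutely continuous
  representatives. An absolutely continuous function is differentiable almost everywhere, and
  the value of \<open>vector_derivative\<close> at the remaining points is irrelevant.
\<close>

definition Orlicz :: "real set \<Rightarrow> ('a::euclidean_space \<Rightarrow> real) \<Rightarrow> (real \<Rightarrow> 'a) set" where
  "Orlicz I G =
     {u. u \<in> borel_measurable (lebesgue_on I) \<and> integrable (lebesgue_on I) (\<lambda>t. G (u t))}"

definition deriv_on :: "real set \<Rightarrow> (real \<Rightarrow> 'a::real_normed_vector) \<Rightarrow> real \<Rightarrow> 'a" where
  "deriv_on I u t = vector_derivative u (at t within I)"

definition Orlicz_Sobolev :: "real set \<Rightarrow> ('a::euclidean_space \<Rightarrow> real) \<Rightarrow> (real \<Rightarrow> 'a) set" where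
  "Orlicz_Sobolev I G =
     {u. abs_continuous_on I u \<and> u \<in> Orlicz I G \<and> deriv_on I u \<in> Orlicz I G}"

definition Orlicz_Sobolev_periodic ::
    "real \<Rightarrow> ('a::euclidean_space \<Rightarrow> real) \<Rightarrow> (real \<Rightarrow> 'a) set" where
  "Orlicz_Sobolev_periodic T G = {u \<in> Orlicz_Sobolev {-T..T} G. u (- T) = u T}"


section \<open>Periodic solutions of the Euler-Lagrange equation\<close>

text \<open>
  The function \<open>p\<close> is the absolutely continuous representative of
  \<open>t \<mapsto> L\<^sub>v(t, u(t), u'(t))\<close>.
\<close>

definition periodic_solution ::
    "real \<Rightarrow> ('a::euclidean_space \<Rightarrow> real) \<Rightarrow> (real \<Rightarrow> 'a \<Rightarrow> 'a \<Rightarrow> real) \<Rightarrow> (real \<Rightarrow> 'a) \<Rightarrow> bool" where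
  "periodic_solution T G L u \<longleftrightarrow>
     u \<in> Orlicz_Sobolev_periodic T G \<and>
     (\<exists>p. abs_continuous_on {-T..T} p \<and>
        (AE t in lebesgue_on {-T..T}.
           p t = gradient (\<lambda>v. L t (u t) v) (deriv_on {-T..T} u t)) \<and>
        (AE t in lebesgue_on {-T..T}.
           (p has_vector_derivative gradient (\<lambda>x. L t x (deriv_on {-T..T} u t)) (u t))
             (at t within {-T..T})))"

end

theory Submission
  imports Defs "HOL-Complex_Analysis.Great_Picard"
begin

text \<open>
  The two solutions are limits of critical points of discretized actions. The interval is cut into
  \<open>n\<close> cells of length \<open>h = 2T/n\<close>, a sample time \<open>\<tau> i\<close> is picked in each cell, and for an
  \<open>n\<close>-periodic sequence \<open>x\<close> with difference quotients \<open>v i = (x (i+1) - x i)/h\<close> the action is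
  \<open>J x = (\<Sum>i<n. h (F (\<tau> i) (x i) (v i) + V (\<tau> i) (x i)))\<close>, a \<open>C\<^sup>1\<close> function of finitely many vectors.

  Geometry. Let \<open>E x = (\<Sum>i<n. h (G (x i) + G (v i)))\<close>. If \<open>E x = \<rho>\<close>, then Jensen's inequality puts
  every \<open>x i\<close> into the region where \<open>V \<ge> b G - g\<close>, hence \<open>J x \<ge> min \<Lambda> b \<cdot> \<rho> - (\<Sum>i<n. h g (\<tau> i))\<close>,
  which exceeds a positive number independent of \<open>n\<close> when the sample times are chosen well. As
  \<open>F\<close> vanishes at velocity zero, constant sequences only feel \<open>V\<close>: some small constant has
  \<open>E < \<rho>\<close> and \<open>J \<le> - 2T\<eta> < 0\<close>, and a large constant has \<open>E > \<rho>\<close> and \<open>J < 0\<close>. So \<open>J\<close> has a critical point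
  at a negative level, a minimum inside the sphere (\<open>constrained_minimum\<close>), and a second one at a
  positive level, of mountain pass type (\<open>mountain_pass\<close>); all levels are bounded away from 0
  uniformly in \<open>n\<close>.

  Bounds. At a critical point the hypotheses of Ambrosetti-Rabinowitz type bound \<open>\<Sum>i<n. h G (v i)\<close> and \<open>sup |x i|\<close>
  (\<open>AR_inequality\<close>). By the discrete Euler-Lagrange equation the momenta
  \<open>p i = F\<^sub>v (\<tau> i) (x i) (v i)\<close> have increments \<open>h (F\<^sub>x + V\<^sub>x)\<close>, whose sum is controlled by the growth of
  \<open>F\<^sub>x\<close>. Hence the momenta are bounded, and \<open>\<Lambda> G (v i) \<le> F \<le> \<langle>p i, v i\<rangle>\<close> with the superlinearity of \<open>G\<close>
  bounds the velocities uniformly. From here on everything happens in a fixed compact set, and all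
  curves are Lipschitz.

  Limit. By Arzela-Ascoli the polygons through \<open>x\<close> and \<open>p\<close> converge uniformly to Lipschitz
  curves \<open>u\<close> and \<open>p\<close> along a subsequence. Where both are differentiable, which is almost everywhere,
  \<open>u'\<close> is a limit of convex combinations of nearby \<open>v i\<close>, each of which almost minimizes
  \<open>F t (u t) w - \<langle>p t, w\<rangle>\<close> over \<open>w\<close>; by convexity \<open>u'\<close> is a minimizer, i.e. \<open>p t = F\<^sub>v t (u t) u'\<close>. Since
  \<open>F t x\<close> may be affine on segments the \<open>v i\<close> themselves need not converge, but the averages of
  \<open>F\<^sub>x t (u t) (v i)\<close> still converge to \<open>F\<^sub>x t (u t) u'\<close>. The reason is that the convexity defect
  \<open>y \<mapsto> (\<Sum>i. c i F t y (v i)) - F t y (\<Sum>i. c i v i)\<close> is nonnegative everywhere and almost zero at \<open>y = u t\<close>,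
  so its gradient there is almost zero (\<open>face_gradient\<close>).

  Separation. If two sequences are uniformly close and the first one has momenta of bounded
  variation, then convexity and summation by parts show that the action of the second is not much
  smaller (\<open>action_lower_semicontinuity\<close>). Applied to the two families and to the zero sequence,
  whose levels are negative, positive and zero, this shows that the two limits differ from zero and
  from each other.
\<close>


section \<open>Lipschitz curves are differentiable almost everywhere\<close>

text \<open>
  By Vitali's theorem, balls on which \<open>\<mu> \<le> \<nu>\<close> can be chosen pairwise disjoint, inside a given
  neighbourhood of \<open>E\<close>, and covering \<open>E\<close> up to a null set; summing over them compares \<open>\<mu> E\<close> with the
  \<open>\<nu>\<close>-measure of the neighbourhood.
\<close>

lemma measure_le_by_Vitali:
  fixes \<mu> \<nu> :: "real measure" and E :: "real set"
  assumes sets: "sets \<mu> = sets borel" "sets \<nu> = sets borel" and E: "E \<in> sets borel"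
    and null: "\<And>A. A \<in> sets borel \<Longrightarrow> negligible A \<Longrightarrow> emeasure \<mu> A = 0"
    and outer: "\<And>e. e > 0 \<Longrightarrow> \<exists>U. open U \<and> E \<subseteq> U \<and> emeasure \<nu> U \<le> emeasure \<nu> E + ennreal e"
    and cover: "\<And>x d. x \<in> E \<Longrightarrow> d > 0 \<Longrightarrow> \<exists>c r. x \<in> ball c r \<and> r < d \<and>
                  emeasure \<mu> (cball c r) \<le> emeasure \<nu> (cball c r)"
  shows "emeasure \<mu> E \<le> emeasure \<nu> E"
proof (rule ennreal_le_epsilon)
  fix e :: real assume "e > 0"
  obtain U where U: "open U" "E \<subseteq> U" "emeasure \<nu> U \<le> emeasure \<nu> E + ennreal e"
    using outer[OF \<open>e > 0\<close>] by blast
  define K where "K = {(c, r). r > 0 \<and> cball c r \<subseteq> U \<and> emeasure \<mu> (cball c r) \<le> emeasure \<nu> (cball c r)}"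
  have cov: "\<exists>i. i \<in> K \<and> x \<in> cball (fst i) (snd i) \<and> snd i < d" if x: "x \<in> E" and d: "d > 0" for x d
  proof -
    obtain \<delta> where \<delta>: "\<delta> > 0" "ball x \<delta> \<subseteq> U" using U x openE by blast
    obtain c r where cr: "x \<in> ball c r" "r < min d (\<delta>/2)"
      "emeasure \<mu> (cball c r) \<le> emeasure \<nu> (cball c r)"
      using cover[OF x, of "min d (\<delta>/2)"] d \<delta> by auto
    have "cball c r \<subseteq> ball x \<delta>"
    proof
      fix y assume "y \<in> cball c r"
      hence "dist x y < r + r" using cr(1) dist_triangle[of x y c] by (simp add: dist_commute)
      thus "y \<in> ball x \<delta>" using cr(2) by simp
    qed
    moreover have "r > 0" using cr(1) by (metis zero_le_dist mem_ball order_le_less_trans)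
    ultimately have "(c, r) \<in> K" using \<delta> cr by (auto simp: K_def)
    thus ?thesis using cr by (intro exI[of _ "(c,r)"]) auto
  qed
  obtain C where C: "countable C" "C \<subseteq> K"
    and disj: "pairwise (\<lambda>i j. disjnt (cball (fst i) (snd i)) (cball (fst j) (snd j))) C"
    and neg: "negligible (E - (\<Union>i\<in>C. cball (fst i) (snd i)))"
    by (rule Vitali_covering_theorem_cballs[of K snd E fst])
      (use cov in \<open>auto simp: K_def case_prod_unfold\<close>)
  let ?B = "\<lambda>i. cball (fst i) (snd i)"
  have dfam: "disjoint_family_on ?B C"
    using disj by (auto simp: disjoint_family_on_def pairwise_def disjnt_def)
  have UB: "(\<Union>i\<in>C. ?B i) \<in> sets borel" using C(1) by (intro sets.countable_UN'') auto
  have "emeasure \<mu> E \<le> emeasure \<mu> ((E - (\<Union>i\<in>C. ?B i)) \<union> (\<Union>i\<in>C. ?B i))"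
    using sets E UB by (intro emeasure_mono) auto
  also have "\<dots> \<le> emeasure \<mu> (E - (\<Union>i\<in>C. ?B i)) + emeasure \<mu> (\<Union>i\<in>C. ?B i)"
    using sets E UB by (intro emeasure_subadditive) auto
  also have "emeasure \<mu> (E - (\<Union>i\<in>C. ?B i)) = 0" using null neg E UB by blast
  also have "emeasure \<mu> (\<Union>i\<in>C. ?B i) = (\<integral>\<^sup>+i. emeasure \<mu> (?B i) \<partial>count_space C)"
    using sets C(1) dfam by (intro emeasure_UN_countable) auto
  also have "\<dots> \<le> (\<integral>\<^sup>+i. emeasure \<nu> (?B i) \<partial>count_space C)"
    using C(2) by (intro nn_integral_mono) (auto simp: K_def)
  also have "\<dots> = emeasure \<nu> (\<Union>i\<in>C. ?B i)"
    using sets C(1) dfam by (intro emeasure_UN_countable[symmetric]) auto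
  also have "\<dots> \<le> emeasure \<nu> U"
    using sets U C(2) by (intro emeasure_mono) (force simp: K_def)+
  finally show "emeasure \<mu> E \<le> emeasure \<nu> E + ennreal e" using U(3) by (simp add: order_trans)
qed

text \<open>
  Let \<open>\<nu> A\<close> be the length of \<open>f ` A\<close>, so that the \<open>\<nu>\<close>-measure of an interval is the increment of \<open>f\<close>. If
  \<open>r < s\<close> and every point of \<open>E\<close> lies in arbitrarily short intervals of slope above \<open>s\<close> and in
  arbitrarily short intervals of slope below \<open>r\<close>, then the Vitali comparison gives
  \<open>s |E| \<le> \<nu> E \<le> r |E|\<close>, so \<open>|E| = 0\<close>. Countably many such sets, for rational \<open>r\<close> and \<open>s\<close>, cover the points
  without derivative.
\<close>

lemma bi_Lipschitz_differentiable_ae: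
  fixes f :: "real \<Rightarrow> real"
  assumes lo: "\<And>x y. x \<le> y \<Longrightarrow> y - x \<le> f y - f x"
    and up: "\<And>x y. x \<le> y \<Longrightarrow> f y - f x \<le> K * (y - x)"
  shows "negligible {x. \<not> f differentiable (at x)}"
proof -
  have K1: "K \<ge> 1" using lo[of 0 1] up[of 0 1] by simp
  have lip: "\<bar>f y - f x\<bar> \<le> K * \<bar>y - x\<bar>" for x y
    using lo[of x y] up[of x y] lo[of y x] up[of y x] by (cases "x \<le> y") auto
  have smono: "x < y \<longleftrightarrow> f x < f y" for x y
    using lo[of x y] lo[of y x] by (cases "x < y") auto
  have mono: "x \<le> y \<longleftrightarrow> f x \<le> f y" for x y using smono[of y x] by auto
  have contf: "continuous_on UNIV f"
  proof (rule lipschitz_on_continuous_on[of K])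
    show "K-lipschitz_on UNIV f"
      using lip K1 by (auto simp: lipschitz_on_def dist_real_def abs_minus_commute)
  qed
  have "\<exists>x. f x = y" for y
  proof -
    have "f (- (\<bar>y\<bar> + \<bar>f 0\<bar>)) \<le> y" using lo[of "- (\<bar>y\<bar> + \<bar>f 0\<bar>)" 0] by linarith
    moreover have "y \<le> f (\<bar>y\<bar> + \<bar>f 0\<bar>)" using lo[of 0 "\<bar>y\<bar> + \<bar>f 0\<bar>"] by linarith
    ultimately show ?thesis
      using IVT'[of f "- (\<bar>y\<bar> + \<bar>f 0\<bar>)" y "\<bar>y\<bar> + \<bar>f 0\<bar>"] continuous_on_subset[OF contf] by auto
  qed
  then have surj: "surj f" by (metis surjI)
  have inj: "inj f" by (metis injI mono order_antisym order_refl)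
  define g where "g = inv f"
  have fg: "f (g y) = y" for y by (simp add: g_def surj surj_f_inv_f)
  have gf: "g (f x) = x" for x by (simp add: g_def inj inv_f_f)
  have gvim: "g -` A = f ` A" for A using fg gf by (auto simp: image_iff) metis
  have "continuous_on UNIV g"
  proof (rule lipschitz_on_continuous_on[of 1])
    have "\<bar>g x - g y\<bar> \<le> \<bar>x - y\<bar>" for x y
      using lo[of "g x" "g y"] lo[of "g y" "g x"] by (cases "g x \<le> g y") (auto simp: fg)
    thus "1-lipschitz_on UNIV g" by (auto simp: lipschitz_on_def dist_real_def)
  qed
  then have gm: "g \<in> borel_measurable lborel" by (simp add: borel_measurable_continuous_onI)
  define \<nu> where "\<nu> = distr lborel borel g"
  have sets\<nu>: "sets \<nu> = sets borel" by (simp add: \<nu>_def)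
  have em\<nu>: "emeasure \<nu> A = emeasure lborel (f ` A)" if "A \<in> sets borel" for A
    using that gm by (simp add: \<nu>_def emeasure_distr gvim)
  have fball: "f ` cball c r = {f (c - r)..f (c + r)}" if "r \<ge> 0" for c r
  proof -
    have "f ` {c - r..c + r} = {f (c - r)..f (c + r)}"
    proof
      show "f ` {c - r..c + r} \<subseteq> {f (c - r)..f (c + r)}" using mono by auto
      show "{f (c - r)..f (c + r)} \<subseteq> f ` {c - r..c + r}"
      proof
        fix y assume "y \<in> {f (c - r)..f (c + r)}"
        hence "g y \<in> {c - r..c + r}" using mono[of "c - r" "g y"] mono[of "g y" "c + r"] by (auto simp: fg)
        thus "y \<in> f ` {c - r..c + r}" by (metis fg imageI)
      qed
    qed
    thus ?thesis by (simp add: cball_eq_atLeastAtMost)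
  qed
  have ball\<nu>: "emeasure \<nu> (cball c r) = ennreal (f (c + r) - f (c - r))" if "r \<ge> 0" for c r
    using that mono[of "c - r" "c + r"] by (simp add: em\<nu> fball)
  have ballL: "emeasure lborel (cball c r) = ennreal (2 * r)" if "r \<ge> 0" for c r :: real
    using that by (simp add: cball_eq_atLeastAtMost)
  \<comment> \<open>points that lie in arbitrarily short intervals of slope above, respectively below, \<open>s\<close>\<close>
  define D where "D s = {x. \<forall>d>0. \<exists>c r. x \<in> ball c r \<and> r < d \<and> f (c + r) - f (c - r) > s * (2 * r)}" for s
  define D' where "D' s = {x. \<forall>d>0. \<exists>c r. x \<in> ball c r \<and> r < d \<and> f (c + r) - f (c - r) < s * (2 * r)}" for s
  have borel_lim: "{x. \<forall>d>0. \<exists>c r. x \<in> ball c r \<and> r < d \<and> P c r} \<in> sets borel" for P :: "real \<Rightarrow> real \<Rightarrow> bool"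
  proof -
    have "{x. \<forall>d>0. \<exists>c r. x \<in> ball c r \<and> r < d \<and> P c r} =
      (\<Inter>n::nat. \<Union>(c, r)\<in>{(c, r). r < 1 / real (Suc n) \<and> P c r}. ball c r)" (is "?L = ?R")
    proof
      show "?L \<subseteq> ?R"
      proof (intro subsetI INT_I)
        fix x and n :: nat assume "x \<in> ?L"
        moreover have "1 / real (Suc n) > 0" by simp
        ultimately obtain c r where "x \<in> ball c r" "r < 1 / real (Suc n)" "P c r" by blast
        thus "x \<in> (\<Union>(c, r)\<in>{(c, r). r < 1 / real (Suc n) \<and> P c r}. ball c r)" by blast
      qed
      show "?R \<subseteq> ?L"
      proof
        fix x assume x: "x \<in> ?R"
        show "x \<in> ?L"
        proof (clarify)
          fix d :: real assume "d > 0"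
          then obtain n where n: "1 / real (Suc n) < d" using nat_approx_posE by blast
          have "x \<in> (\<Union>(c, r)\<in>{(c, r). r < 1 / real (Suc n) \<and> P c r}. ball c r)" using x by blast
          then obtain c r where "r < 1 / real (Suc n)" "P c r" "x \<in> ball c r" by blast
          thus "\<exists>c r. x \<in> ball c r \<and> r < d \<and> P c r" using n by (meson less_trans)
        qed
      qed
    qed
    also have "\<dots> \<in> sets borel" by (intro sets.countable_INT'' borel_open open_UN) auto
    finally show ?thesis .
  qed
  have null: "emeasure lborel (D s \<inter> D' r \<inter> {- real k..real k}) = 0" if rs: "0 < r" "r < s" for r s k
  proof -
    define E where "E = D s \<inter> D' r \<inter> {- real k..real k}"
    have E: "E \<in> sets borel" unfolding E_def D_def D'_def using borel_lim by (intro sets.Int) auto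
    have fE: "f ` E \<in> sets borel"
      using measurable_sets[OF gm, of E] E by (simp add: gvim)
    have 1: "emeasure (density lborel (\<lambda>_. ennreal s)) E \<le> emeasure \<nu> E"
    proof (rule measure_le_by_Vitali[OF _ sets\<nu> E])
      fix A :: "real set" assume "A \<in> sets borel" "negligible A"
      thus "emeasure (density lborel (\<lambda>_. ennreal s)) A = 0"
        by (simp add: emeasure_density_const negligible_iff_emeasure0)
    next
      fix e :: real assume "e > 0"
      then obtain O' where Op: "open O'" "f ` E \<subseteq> O'" "emeasure lborel (O' - f ` E) < ennreal e"
        using outer_regular_lborel[OF fE] by blast
      have oU: "open (f -` O')" using Op(1) contf open_vimage by blast
      have "emeasure \<nu> (f -` O') = emeasure lborel O'"
        using oU surj by (simp add: em\<nu> surj_image_vimage_eq)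
      also have "\<dots> = emeasure lborel (f ` E \<union> (O' - f ` E))" using Op(2) by (simp add: Un_absorb1)
      also have "\<dots> \<le> emeasure lborel (f ` E) + emeasure lborel (O' - f ` E)"
        using fE Op(1) by (intro emeasure_subadditive) auto
      also have "\<dots> \<le> emeasure \<nu> E + ennreal e"
        using Op(3) E by (simp add: em\<nu> add_left_mono less_imp_le)
      finally show "\<exists>U. open U \<and> E \<subseteq> U \<and> emeasure \<nu> U \<le> emeasure \<nu> E + ennreal e"
        using oU Op(2) by (intro exI[of _ "f -` O'"]) auto
    next
      fix x d :: real assume "x \<in> E" "d > 0"
      then obtain c \<rho> where c: "x \<in> ball c \<rho>" "\<rho> < d" "f (c + \<rho>) - f (c - \<rho>) > s * (2 * \<rho>)"
        by (auto simp: E_def D_def)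
      have "\<rho> \<ge> 0" using c(1) by (metis zero_le_dist mem_ball order_le_less_trans less_imp_le)
      hence "emeasure (density lborel (\<lambda>_. ennreal s)) (cball c \<rho>) \<le> emeasure \<nu> (cball c \<rho>)"
        using c(3) rs by (simp add: emeasure_density_const ballL ball\<nu> ennreal_leI flip: ennreal_mult)
      thus "\<exists>c r. x \<in> ball c r \<and> r < d \<and>
                  emeasure (density lborel (\<lambda>_. ennreal s)) (cball c r) \<le> emeasure \<nu> (cball c r)"
        using c by blast
    qed simp
    have 2: "emeasure \<nu> E \<le> emeasure (density lborel (\<lambda>_. ennreal r)) E"
    proof (rule measure_le_by_Vitali[OF sets\<nu> _ E])
      fix A :: "real set" assume A: "A \<in> sets borel" "negligible A"
      have "negligible (f ` A)"
      proof (rule negligible_locally_Lipschitz_image[OF _ A(2)])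
        fix x assume "x \<in> A"
        show "\<exists>T B. open T \<and> x \<in> T \<and> (\<forall>y\<in>A \<inter> T. norm (f y - f x) \<le> B * norm (y - x))"
          using lip by (intro exI[of _ UNIV] exI[of _ K]) auto
      qed simp
      moreover have "f ` A \<in> sets borel" using measurable_sets[OF gm, of A] A by (simp add: gvim)
      ultimately show "emeasure \<nu> A = 0" using A by (simp add: em\<nu> negligible_iff_emeasure0)
    next
      fix e :: real assume e: "e > 0"
      then obtain O' where Op: "open O'" "E \<subseteq> O'" "emeasure lborel (O' - E) < ennreal (e / r)"
        using outer_regular_lborel[OF E, of "e / r"] rs by auto
      have "emeasure lborel O' = emeasure lborel (E \<union> (O' - E))" using Op(2) by (simp add: Un_absorb1)
      also have "\<dots> \<le> emeasure lborel E + emeasure lborel (O' - E)"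
        using E Op(1) by (intro emeasure_subadditive) auto
      also have "\<dots> \<le> emeasure lborel E + ennreal (e / r)" using Op(3) by (simp add: add_left_mono less_imp_le)
      finally have "ennreal r * emeasure lborel O' \<le> ennreal r * (emeasure lborel E + ennreal (e / r))"
        by (rule mult_left_mono) simp
      also have "\<dots> = ennreal r * emeasure lborel E + ennreal e"
        using rs e by (simp add: distrib_left flip: ennreal_mult)
      finally show "\<exists>U. open U \<and> E \<subseteq> U \<and> emeasure (density lborel (\<lambda>_. ennreal r)) U
          \<le> emeasure (density lborel (\<lambda>_. ennreal r)) E + ennreal e"
        using Op E by (intro exI[of _ O']) (auto simp: emeasure_density_const)
    next
      fix x d :: real assume "x \<in> E" "d > 0"
      then obtain c \<rho> where c: "x \<in> ball c \<rho>" "\<rho> < d" "f (c + \<rho>) - f (c - \<rho>) < r * (2 * \<rho>)"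
        by (auto simp: E_def D'_def)
      have "\<rho> \<ge> 0" using c(1) by (metis zero_le_dist mem_ball order_le_less_trans less_imp_le)
      hence "emeasure \<nu> (cball c \<rho>) \<le> emeasure (density lborel (\<lambda>_. ennreal r)) (cball c \<rho>)"
        using c(3) rs by (simp add: emeasure_density_const ballL ball\<nu> flip: ennreal_mult)
      thus "\<exists>c \<rho>. x \<in> ball c \<rho> \<and> \<rho> < d \<and>
                  emeasure \<nu> (cball c \<rho>) \<le> emeasure (density lborel (\<lambda>_. ennreal r)) (cball c \<rho>)"
        using c by blast
    qed simp
    have "emeasure lborel E \<le> emeasure lborel {- real k..real k}"
      by (rule emeasure_mono) (auto simp: E_def)
    then have fin: "emeasure lborel E < \<infinity>" by (simp add: order_le_less_trans)
    then obtain w where w: "emeasure lborel E = ennreal w" "w \<ge> 0"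
      by (cases "emeasure lborel E") auto
    have "ennreal s * ennreal w \<le> ennreal r * ennreal w"
      using order_trans[OF 1 2] E w by (simp add: emeasure_density_const)
    then have "s * w \<le> r * w" using rs w by (simp flip: ennreal_mult)
    then have "w = 0" using rs w by (metis mult_le_cancel_right not_less order_less_le)
    thus ?thesis using w unfolding E_def by simp
  qed
  have neg: "negligible (D s \<inter> D' r \<inter> {- real k..real k})" if "0 < r" "r < s" for r s k
  proof -
    have "D s \<inter> D' r \<inter> {- real k..real k} \<in> sets borel"
      unfolding D_def D'_def using borel_lim by (intro sets.Int) auto
    thus ?thesis using null[OF that] by (simp add: negligible_iff_emeasure0)
  qed
  let ?Z = "\<Union>(k::nat, r, s)\<in>UNIV \<times> {(r, s). r \<in> \<rat> \<and> s \<in> \<rat> \<and> 0 < r \<and> r < s}. D s \<inter> D' r \<inter> {- real k..real k}"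
  have "countable ((UNIV::nat set) \<times> {(r::real, s). r \<in> \<rat> \<and> s \<in> \<rat> \<and> 0 < r \<and> r < s})"
    by (intro countable_SIGMA countable_subset[of _ "\<rat> \<times> \<rat>"]) (auto simp: countable_rat)
  then have "negligible ?Z"
    using neg by (intro negligible_countable_Union countable_image) auto
  moreover have "{x. \<not> f differentiable (at x)} \<subseteq> ?Z"
  proof (clarify, rule ccontr)
    fix x assume nd: "\<not> f differentiable (at x)" and nz: "x \<notin> ?Z"
    obtain k :: nat where k: "\<bar>x\<bar> \<le> real k" using real_arch_simple by blast
    have sep: "x \<notin> D s \<or> x \<notin> D' r" if "r \<in> \<rat>" "s \<in> \<rat>" "0 < r" "r < s" for r s
      using nz that k by (force simp: abs_le_iff)
    \<comment> \<open>the upper derivate at \<open>x\<close>, which \<open>sep\<close> identifies with the lower one\<close>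
    define q where "q = Sup {s. x \<in> D s}"
    have D1: "s \<le> K" if H: "x \<in> D s" for s
    proof -
      obtain c r where c: "x \<in> ball c r" "f (c + r) - f (c - r) > s * (2 * r)"
        using H[unfolded D_def mem_Collect_eq, rule_format, of 1] by auto
      have "r > 0" using c(1) by (metis zero_le_dist mem_ball order_le_less_trans)
      thus ?thesis using c(2) up[of "c - r" "c + r"] by (smt (verit) mult_le_cancel_right)
    qed
    have D0: "x \<in> D s" if "s < 1" for s
      unfolding D_def
    proof (clarify)
      fix d :: real assume d: "d > 0"
      have "s * (2 * (d/2)) < d" using that d by simp
      moreover have "f (x + d/2) - f (x - d/2) \<ge> d" using d lo[of "x - d/2" "x + d/2"] by simp
      ultimately have "s * (2 * (d/2)) < f (x + d/2) - f (x - d/2)" by linarith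
      then have "x \<in> ball x (d/2) \<and> d/2 < d \<and> s * (2 * (d/2)) < f (x + d/2) - f (x - d/2)"
        using d by simp
      thus "\<exists>c r. x \<in> ball c r \<and> r < d \<and> s * (2 * r) < f (c + r) - f (c - r)" by blast
    qed
    have bdd: "bdd_above {s. x \<in> D s}" using D1 by (auto simp: bdd_above_def)
    have D_down: "x \<in> D s'" if H: "x \<in> D s" "s' \<le> s" for s s'
      unfolding D_def
    proof (clarify)
      fix d :: real assume "d > 0"
      then obtain c r where c: "x \<in> ball c r" "r < d" "f (c + r) - f (c - r) > s * (2 * r)"
        using H(1) unfolding D_def by blast
      have "r > 0" using c(1) by (metis zero_le_dist mem_ball order_le_less_trans)
      hence "s' * (2 * r) \<le> s * (2 * r)" using H(2) by simp
      thus "\<exists>c r. x \<in> ball c r \<and> r < d \<and> s' * (2 * r) < f (c + r) - f (c - r)" using c by force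
    qed
    have l1: "q \<ge> 1"
    proof (rule ccontr)
      assume "\<not> q \<ge> 1"
      then obtain s where "q < s" "s < 1" using dense[of q 1] by auto
      thus False using cSup_upper[OF _ bdd, of s] D0 by (simp add: q_def)
    qed
    have upper: "\<exists>d>0. \<forall>c r. x \<in> ball c r \<and> r < d \<longrightarrow> f (c + r) - f (c - r) \<le> (q + \<epsilon>) * (2 * r)"
      if "\<epsilon> > 0" for \<epsilon>
    proof -
      have "x \<notin> D (q + \<epsilon>)" using cSup_upper[OF _ bdd, of "q + \<epsilon>"] that by (auto simp: q_def)
      thus ?thesis unfolding D_def mem_Collect_eq not_all not_imp by (metis not_less)
    qed
    have lower: "\<exists>d>0. \<forall>c r. x \<in> ball c r \<and> r < d \<longrightarrow> f (c + r) - f (c - r) \<ge> (q - \<epsilon>) * (2 * r)"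
      if eps: "\<epsilon> > 0" for \<epsilon>
    proof -
      obtain s where s: "s \<in> \<rat>" "max (q - \<epsilon>) 0 < s" "s < q"
        using Rats_dense_in_real[of "max (q - \<epsilon>) 0" q] l1 eps by auto
      obtain r where r: "r \<in> \<rat>" "max (q - \<epsilon>) 0 < r" "r < s"
        using Rats_dense_in_real[of "max (q - \<epsilon>) 0" s] s by auto
      obtain s' where s': "x \<in> D s'" "s < s'"
        using less_cSupE[of s "{s. x \<in> D s}"] s(3) D0[of 0] by (auto simp: q_def)
      have "x \<in> D s" using D_down[OF s'(1)] s' by simp
      hence "x \<notin> D' r" using sep[of r s] r s by auto
      then obtain d where d: "d > 0" "\<And>c \<rho>. x \<in> ball c \<rho> \<Longrightarrow> \<rho> < d \<Longrightarrow> f (c + \<rho>) - f (c - \<rho>) \<ge> r * (2 * \<rho>)"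
        unfolding D'_def mem_Collect_eq not_all not_imp by (metis not_less)
      have "f (c + \<rho>) - f (c - \<rho>) \<ge> (q - \<epsilon>) * (2 * \<rho>)" if "x \<in> ball c \<rho>" "\<rho> < d" for c \<rho>
      proof -
        have "\<rho> > 0" using that(1) by (metis zero_le_dist mem_ball order_le_less_trans)
        hence "(q - \<epsilon>) * (2 * \<rho>) \<le> r * (2 * \<rho>)" using r by (intro mult_right_mono) auto
        thus ?thesis using d(2)[OF that] by simp
      qed
      thus ?thesis using d(1) by blast
    qed
    have slope: "\<exists>d>0. \<forall>y z. y \<le> x \<and> x \<le> z \<and> z - y < d \<longrightarrow> \<bar>f z - f y - q * (z - y)\<bar> \<le> \<epsilon> * (z - y)"
      if \<epsilon>: "\<epsilon> > 0" for \<epsilon>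
    proof -
      obtain d1 where d1: "d1 > 0" "\<And>c r. x \<in> ball c r \<Longrightarrow> r < d1 \<Longrightarrow> f (c + r) - f (c - r) \<le> (q + \<epsilon>) * (2 * r)"
        using upper[OF \<epsilon>] by blast
      obtain d2 where d2: "d2 > 0" "\<And>c r. x \<in> ball c r \<Longrightarrow> r < d2 \<Longrightarrow> f (c + r) - f (c - r) \<ge> (q - \<epsilon>) * (2 * r)"
        using lower[OF \<epsilon>] by blast
      have strict: "\<bar>f z - f y - q * (z - y)\<bar> \<le> \<epsilon> * (z - y)" if "y < x" "x < z" "z - y < min d1 d2" for y z
      proof -
        have *: "x \<in> ball ((y + z)/2) ((z - y)/2)" using that by (simp add: dist_real_def abs_if field_simps)
        have **: "(y + z)/2 + (z - y)/2 = z" "(y + z)/2 - (z - y)/2 = y" "2 * ((z - y)/2) = z - y" by (auto simp: field_simps)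
        have "(z - y)/2 < d1" "(z - y)/2 < d2" using that by (auto simp: field_simps)
        then have "f z - f y \<le> (q + \<epsilon>) * (z - y)" "f z - f y \<ge> (q - \<epsilon>) * (z - y)"
          using d1(2)[OF *] d2(2)[OF *] unfolding ** by blast+
        thus ?thesis by (simp add: abs_le_iff algebra_simps)
      qed
      \<comment> \<open>\<open>x\<close> may be an end point here: widen the interval by \<open>t\<close> on both sides and let \<open>t\<close> tend to 0\<close>
      have "\<bar>f z - f y - q * (z - y)\<bar> \<le> \<epsilon> * (z - y)" if yz: "y \<le> x" "x \<le> z" "z - y < min d1 d2" for y z
      proof -
        let ?h = "\<lambda>t. \<epsilon> * ((z + t) - (y - t)) - \<bar>f (z + t) - f (y - t) - q * ((z + t) - (y - t))\<bar>"
        have cf: "continuous_on UNIV (\<lambda>t. f (z + t))" "continuous_on UNIV (\<lambda>t. f (y - t))"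
          by (auto intro!: continuous_on_compose2[OF contf] continuous_intros)
        have "continuous_on UNIV ?h" by (intro continuous_intros cf)
        then have "isCont ?h 0" by (simp add: continuous_on_eq_continuous_at)
        then have "(?h \<longlongrightarrow> ?h 0) (at_right 0)" by (simp add: isCont_def filterlim_at_split)
        moreover have "eventually (\<lambda>t. ?h t \<ge> 0) (at_right 0)"
          unfolding eventually_at_right_field
        proof (intro exI[of _ "(min d1 d2 - (z - y))/2"] conjI allI impI)
          show "0 < (min d1 d2 - (z - y))/2" using yz(3) by simp
          fix t assume t: "t > 0" "t < (min d1 d2 - (z - y))/2"
          have "2 * t < min d1 d2 - (z - y)" using t(2) by (simp del: min_less_iff_conj)
          then have "(z + t) - (y - t) < min d1 d2" by (simp del: min_less_iff_conj)
          then show "?h t \<ge> 0" using strict[of "y - t" "z + t"] yz t by simp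
        qed
        ultimately have "?h 0 \<ge> 0" by (rule tendsto_lowerbound) simp
        thus ?thesis by simp
      qed
      thus ?thesis using d1 d2 by (intro exI[of _ "min d1 d2"]) auto
    qed
    have "(f has_field_derivative q) (at x)"
      unfolding DERIV_def LIM_eq
    proof (intro allI impI)
      fix \<epsilon> :: real assume "\<epsilon> > 0"
      then obtain d where d: "d > 0" and dd: "\<And>y z. y \<le> x \<Longrightarrow> x \<le> z \<Longrightarrow> z - y < d \<Longrightarrow> \<bar>f z - f y - q * (z - y)\<bar> \<le> \<epsilon>/2 * (z - y)"
        using slope[of "\<epsilon>/2"] by auto
      have "\<bar>(f (x + h) - f x) / h - q\<bar> < \<epsilon>" if h: "h \<noteq> 0" "\<bar>h\<bar> < d" for h
      proof -
        have "\<bar>f (x + h) - f x - q * h\<bar> \<le> \<epsilon>/2 * \<bar>h\<bar>"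
        proof (cases "h > 0")
          case True thus ?thesis using dd[of x "x + h"] h by simp
        next
          case False
          have "\<bar>f (x + h) - f x - q * h\<bar> = \<bar>f x - f (x + h) - q * (x - (x + h))\<bar>"
            using abs_minus_commute[of "f (x + h) - f x" "q * h"] by (simp add: algebra_simps)
          thus ?thesis using dd[of "x + h" x] h False by simp
        qed
        also have "\<dots> < \<epsilon> * \<bar>h\<bar>" using h \<open>\<epsilon> > 0\<close> by simp
        finally have "\<bar>f (x + h) - f x - q * h\<bar> < \<epsilon> * \<bar>h\<bar>" .
        moreover have "((f (x + h) - f x) / h - q) * h = f (x + h) - f x - q * h" using h by (simp add: field_simps)
        ultimately have "\<bar>((f (x + h) - f x) / h - q) * h\<bar> < \<epsilon> * \<bar>h\<bar>" by simp
        thus ?thesis using h by (simp add: abs_mult)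
      qed
      thus "\<exists>s>0. \<forall>xa. xa \<noteq> 0 \<and> norm (xa - 0) < s \<longrightarrow> norm ((f (x + xa) - f x) / xa - q) < \<epsilon>"
        using d by (intro exI[of _ d]) auto
    qed
    thus False using nd real_differentiable_def by blast
  qed
  ultimately show ?thesis using negligible_subset by blast
qed

text \<open>
  Adding \<open>(L + 1) x\<close> to a component makes it increasing and bi-Lipschitz.
\<close>

lemma Lipschitz_differentiable_ae:
  fixes f :: "real \<Rightarrow> 'a::euclidean_space"
  assumes lip: "\<And>x y. norm (f y - f x) \<le> L * \<bar>y - x\<bar>"
  shows "negligible {x. \<not> f differentiable (at x)}"
proof -
  have real: "negligible {x. \<not> (\<lambda>x. f x \<bullet> b) differentiable (at x)}" if b: "b \<in> Basis" for b
  proof -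
    have lipb: "\<bar>f y \<bullet> b - f x \<bullet> b\<bar> \<le> L * \<bar>y - x\<bar>" for x y
      using Basis_le_norm[OF b, of "f y - f x"] lip[of y x] by (simp add: inner_diff_left)
    let ?g = "\<lambda>x. f x \<bullet> b + (L + 1) * x"
    have "negligible {x. \<not> ?g differentiable (at x)}"
    proof (rule bi_Lipschitz_differentiable_ae[of _ "2 * L + 1"])
      fix x y :: real assume "x \<le> y"
      thus "y - x \<le> ?g y - ?g x" "?g y - ?g x \<le> (2 * L + 1) * (y - x)"
        using lipb[of y x] by (auto simp: abs_le_iff algebra_simps)
    qed
    moreover have "(\<lambda>x. f x \<bullet> b) differentiable (at x)" if "?g differentiable (at x)" for x
    proof -
      have "(\<lambda>x. ?g x - (L + 1) * x) differentiable (at x)"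
        by (rule differentiable_diff[OF that]) (auto intro!: derivative_intros)
      thus ?thesis by simp
    qed
    ultimately show ?thesis by (elim negligible_subset) auto
  qed
  have "{x. \<not> f differentiable (at x)} \<subseteq> (\<Union>b\<in>Basis. {x. \<not> (\<lambda>x. f x \<bullet> b) differentiable (at x)})"
    using differentiable_componentwise_within[of f _ UNIV] by auto
  thus ?thesis using real by (elim negligible_subset[rotated]) (auto intro!: negligible_Union)
qed

section \<open>Critical points of functionals of periodic sequences\<close>

text \<open>
  Periodic sequences serve as the spaces of \<open>n\<close>-tuples of vectors, for all \<open>n\<close> within one type. The topology is that of
  pointwise convergence.
\<close>

definition periodic_seqs :: "nat \<Rightarrow> (nat \<Rightarrow> 'b) set" where
  "periodic_seqs n = {x. \<forall>i. x (i + n) = x i}"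

definition period_inner :: "nat \<Rightarrow> (nat \<Rightarrow> 'b::real_inner) \<Rightarrow> (nat \<Rightarrow> 'b) \<Rightarrow> real" where
  "period_inner n x y = (\<Sum>i<n. x i \<bullet> y i)"

definition periodic_box :: "nat \<Rightarrow> real \<Rightarrow> (nat \<Rightarrow> 'b::real_normed_vector) set" where
  "periodic_box n r = {x \<in> periodic_seqs n. \<forall>i. norm (x i) \<le> r}"

lemma periodic_seqs_mod:
  assumes "x \<in> periodic_seqs n"
  shows "x (i mod n) = x i"
proof -
  have "x (i mod n + k * n) = x (i mod n)" for k
  proof (induction k)
    case (Suc k)
    have e: "i mod n + Suc k * n = (i mod n + k * n) + n" unfolding mult_Suc by linarith
    have "x (i mod n + Suc k * n) = x ((i mod n + k * n) + n)" by (simp only: e)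
    also have "\<dots> = x (i mod n + k * n)" using assms unfolding periodic_seqs_def by blast
    finally show ?case using Suc by simp
  qed simp
  from this[of "i div n"] show ?thesis by (simp only: mod_div_mult_eq)
qed

lemma periodic_seqs_all_iff:
  assumes "x \<in> periodic_seqs n" "n > 0"
  shows "(\<forall>i. P (x i)) \<longleftrightarrow> (\<forall>i<n. P (x i))"
  by (metis assms mod_less_divisor periodic_seqs_mod)

lemma sum_periodic_shift:
  fixes f :: "nat \<Rightarrow> 'a::ab_group_add"
  assumes "f \<in> periodic_seqs n"
  shows "(\<Sum>i<n. f (Suc i)) = (\<Sum>i<n. f i)"
proof -
  have "(\<Sum>i<n. f (Suc i) - f i) = f (0 + n) - f 0" by (simp add: sum_lessThan_telescope)
  also have "f (0 + n) = f 0" using assms unfolding periodic_seqs_def by blast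
  finally show ?thesis by (simp add: sum_subtractf)
qed

text \<open>
  Tychonoff's theorem in the role of the Heine-Borel theorem.
\<close>

lemma compact_periodic_box: "compact (periodic_box n r :: (nat \<Rightarrow> 'b::euclidean_space) set)"
proof -
  have "compactin (product_topology (\<lambda>_. euclidean) UNIV) (PiE UNIV (\<lambda>_::nat. cball (0::'b) r))"
    by (subst compactin_PiE) auto
  then have "compact (PiE UNIV (\<lambda>_::nat. cball (0::'b) r))" by (simp add: euclidean_product_topology)
  moreover have "closed (\<Inter>i. {x::nat \<Rightarrow> 'b. x (i + n) = x i})"
    by (intro closed_INT ballI closed_Collect_eq) auto
  moreover have "periodic_box n r = PiE UNIV (\<lambda>_. cball 0 r) \<inter> (\<Inter>i. {x::nat \<Rightarrow> 'b. x (i + n) = x i})"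
    unfolding periodic_box_def periodic_seqs_def by (intro set_eqI) (simp add: PiE_iff conj_commute)
  ultimately show ?thesis using compact_Int_closed by simp
qed

lemma periodic_box_subset: "periodic_box n r \<subseteq> periodic_seqs n" by (auto simp: periodic_box_def)

lemma compact_imp_subset_periodic_box:
  fixes S :: "(nat \<Rightarrow> 'b::euclidean_space) set"
  assumes "compact S" "S \<subseteq> periodic_seqs n" "n > 0"
  obtains r where "S \<subseteq> periodic_box n r"
proof -
  have "\<exists>r. \<forall>x\<in>S. norm (x i) \<le> r" for i
  proof -
    have "continuous_on S (\<lambda>x. x i)"
      by (rule continuous_on_subset[OF continuous_on_product_coordinates]) simp
    then have "compact ((\<lambda>x. x i) ` S)" using assms(1) compact_continuous_image by blast
    then show ?thesis by (metis bounded_iff compact_imp_bounded imageI)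
  qed
  then obtain R where R: "\<And>i x. x \<in> S \<Longrightarrow> norm (x i) \<le> R i" by metis
  have "S \<subseteq> periodic_box n (Max (R ` {..<n}))"
  proof
    fix x assume x: "x \<in> S"
    have "norm (x i) \<le> Max (R ` {..<n})" if "i < n" for i
    proof -
      have "R i \<le> Max (R ` {..<n})" using that by (intro Max_ge) auto
      then show ?thesis using R[OF x, of i] by linarith
    qed
    then show "x \<in> periodic_box n (Max (R ` {..<n}))"
      using x assms periodic_seqs_all_iff[of x n "\<lambda>y. norm y \<le> Max (R ` {..<n})"]
      by (auto simp: periodic_box_def)
  qed
  then show thesis using that by blast
qed

text \<open>
  \<open>grad\<close> is the gradient with respect to \<open>period_inner\<close>; differentiability along lines suffices for the arguments
  below.
\<close>

locale periodic_functional =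
  fixes n :: nat and J :: "(nat \<Rightarrow> 'b::euclidean_space) \<Rightarrow> real" and grad :: "(nat \<Rightarrow> 'b) \<Rightarrow> nat \<Rightarrow> 'b"
  assumes n_pos: "n > 0"
    and grad_periodic: "x \<in> periodic_seqs n \<Longrightarrow> grad x \<in> periodic_seqs n"
    and grad_continuous: "continuous_on (periodic_seqs n) (\<lambda>x. grad x i)"
    and J_continuous: "continuous_on (periodic_seqs n) J"
    and J_derivative: "x \<in> periodic_seqs n \<Longrightarrow> y \<in> periodic_seqs n \<Longrightarrow>
      ((\<lambda>s. J (\<lambda>i. x i + s *\<^sub>R y i)) has_real_derivative period_inner n (grad (\<lambda>i. x i + s *\<^sub>R y i)) y) (at s)"
begin

abbreviation "descent x s \<equiv> (\<lambda>i. x i - s *\<^sub>R grad x i)"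

lemma descent_periodic: "x \<in> periodic_seqs n \<Longrightarrow> descent x s \<in> periodic_seqs n"
  using grad_periodic by (auto simp: periodic_seqs_def)

lemma J_descent:
  assumes x: "x \<in> periodic_seqs n" and "\<tau> \<ge> 0"
    and c: "\<And>s. 0 \<le> s \<Longrightarrow> s \<le> \<tau> \<Longrightarrow> period_inner n (grad (descent x s)) (grad x) \<ge> c"
  shows "J (descent x \<tau>) \<le> J x - \<tau> * c"
proof -
  have m: "(\<lambda>i. - grad x i) \<in> periodic_seqs n" using grad_periodic[OF x] by (auto simp: periodic_seqs_def)
  let ?\<phi> = "\<lambda>s. J (descent x s) + s * c"
  have "?\<phi> \<tau> \<le> ?\<phi> 0"
  proof (rule DERIV_nonpos_imp_nonincreasing[OF \<open>\<tau> \<ge> 0\<close>])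
    fix s assume s: "0 \<le> s" "s \<le> \<tau>"
    have "(?\<phi> has_real_derivative (- period_inner n (grad (descent x s)) (grad x)) + c) (at s)"
      using J_derivative[OF x m, of s]
      by (auto intro!: derivative_eq_intros simp: period_inner_def sum_negf)
    then show "\<exists>y. (?\<phi> has_real_derivative y) (at s) \<and> y \<le> 0" using c[OF s] by force
  qed
  then show ?thesis by simp
qed

lemma grad_bound: 
  assumes "x \<in> periodic_seqs n"
  shows "norm (grad x i) ^ 2 \<le> period_inner n (grad x) (grad x)"
proof -
  have "norm (grad x i) ^ 2 = grad x (i mod n) \<bullet> grad x (i mod n)"
    using periodic_seqs_mod[OF grad_periodic[OF assms]] by (simp add: dot_square_norm)
  also have "\<dots> \<le> period_inner n (grad x) (grad x)"
    unfolding period_inner_def using n_pos by (intro member_le_sum[where f="\<lambda>i. grad x i \<bullet> grad x i"]) auto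
  finally show ?thesis .
qed

lemma grad_eq_zeroI:
  assumes "x \<in> periodic_seqs n" "period_inner n (grad x) (grad x) \<le> 0"
  shows "grad x = (\<lambda>_. 0)"
proof
  fix i
  have "norm (grad x i) ^ 2 \<le> 0" using grad_bound[OF assms(1), of i] assms(2) by linarith
  then show "grad x i = 0" by simp
qed

lemma grad_square_continuous: "continuous_on (periodic_seqs n) (\<lambda>x. period_inner n (grad x) (grad x))"
  unfolding period_inner_def by (intro continuous_intros grad_continuous)

lemma descent_grad_continuous:
  "continuous_on ({0..1} \<times> periodic_seqs n) (\<lambda>(s, x). period_inner n (grad (descent x s)) (grad x))"
proof -
  let ?D = "{0..1::real} \<times> (periodic_seqs n :: (nat \<Rightarrow> 'b) set)"
  have snd: "continuous_on ?D snd" by (rule continuous_on_snd[OF continuous_on_id])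
  have g: "continuous_on ?D (\<lambda>z. grad (snd z) i)" for i
    by (rule continuous_on_compose2[OF grad_continuous[of i] snd]) auto
  have x: "continuous_on ?D (\<lambda>z. snd z i)" for i
    by (rule continuous_on_compose2[OF continuous_on_product_coordinates snd]) auto
  have "continuous_on ({0..1} \<times> periodic_seqs n) (\<lambda>z. descent (snd z) (fst z))"
    by (intro continuous_on_coordinatewise_then_product continuous_intros g x)
  then have d: "continuous_on ({0..1} \<times> periodic_seqs n) (\<lambda>z. grad (descent (snd z) (fst z)) i)" for i
    by (rule continuous_on_compose2[OF grad_continuous[of i]]) (auto intro!: descent_periodic)
  show ?thesis unfolding case_prod_unfold period_inner_def by (intro continuous_intros g d)
qed

text \<open>
  By continuity and compactness, the gradient along a short descent step keeps at least half of its
  component in the initial direction, uniformly.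
\<close>

lemma uniform_descent:
  assumes \<delta>: "\<delta> > 0"
    and S: "compact S" "S \<subseteq> periodic_seqs n" "\<And>x. x \<in> S \<Longrightarrow> period_inner n (grad x) (grad x) \<ge> \<delta>"
  obtains \<tau> where "\<tau> > 0" "\<tau> \<le> 1" "\<And>x s. x \<in> S \<Longrightarrow> 0 \<le> s \<Longrightarrow> s \<le> \<tau> \<Longrightarrow>
      period_inner n (grad (descent x s)) (grad x) \<ge> period_inner n (grad x) (grad x) / 2"
proof (rule ccontr)
  assume no: "\<not> thesis"
  let ?Q = "\<lambda>(s, x). period_inner n (grad (descent x s)) (grad x)"
  have "\<forall>k. \<exists>p. fst p \<in> S \<and> 0 \<le> snd p \<and> snd p \<le> 1 / real (Suc k) \<and>
      ?Q (snd p, fst p) < period_inner n (grad (fst p)) (grad (fst p)) / 2"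
  proof (rule allI, rule ccontr)
    fix k
    assume *: "\<not> (\<exists>p. fst p \<in> S \<and> 0 \<le> snd p \<and> snd p \<le> 1 / real (Suc k) \<and>
      ?Q (snd p, fst p) < period_inner n (grad (fst p)) (grad (fst p)) / 2)"
    have thesis
    proof (rule that[of "1 / real (Suc k)"])
      fix x and t :: real assume "x \<in> S" "0 \<le> t" "t \<le> 1 / real (Suc k)"
      then have "\<not> ?Q (snd (x, t), fst (x, t)) < period_inner n (grad (fst (x, t))) (grad (fst (x, t))) / 2"
        using spec[OF *[unfolded not_ex], of "(x, t)"] by simp
      then show "period_inner n (grad (descent x t)) (grad x) \<ge> period_inner n (grad x) (grad x) / 2"
        by simp
    qed auto
    then show False using no by contradiction
  qed
  from choice[OF this] obtain p where p: "\<forall>k. fst (p k) \<in> S \<and> 0 \<le> snd (p k) \<and> snd (p k) \<le> 1 / real (Suc k) \<and>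
      ?Q (snd (p k), fst (p k)) < period_inner n (grad (fst (p k))) (grad (fst (p k))) / 2" ..
  define X s where "X k = fst (p k)" and "s k = snd (p k)" for k
  have Xs: "\<And>k. X k \<in> S" "\<And>k. 0 \<le> s k" "\<And>k. s k \<le> 1 / real (Suc k)"
    "\<And>k. ?Q (s k, X k) < period_inner n (grad (X k)) (grad (X k)) / 2"
    using p unfolding X_def s_def by blast+
  obtain x r where xr: "x \<in> S" "strict_mono (r :: nat \<Rightarrow> nat)" "(X \<circ> r) \<longlonglongrightarrow> x"
    using S(1)[unfolded compact_def, rule_format, of X] Xs(1) by blast
  have xP: "x \<in> periodic_seqs n" and XP: "\<And>k. X k \<in> periodic_seqs n" using S(2) xr(1) Xs(1) by auto
  have "s \<longlonglongrightarrow> 0"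
    by (rule tendsto_sandwich[OF _ _ tendsto_const LIMSEQ_inverse_real_of_nat])
      (use Xs in \<open>auto simp: inverse_eq_divide\<close>)
  then have s0: "(s \<circ> r) \<longlonglongrightarrow> 0" using xr(2) LIMSEQ_subseq_LIMSEQ by blast
  have s1: "s k \<le> 1" for k using Xs(3)[of k] by (rule order_trans) simp
  have lim: "((\<lambda>k. ((s \<circ> r) k, (X \<circ> r) k)) \<longlongrightarrow> (0, x)) sequentially" by (intro tendsto_Pair s0 xr(3))
  have "(\<lambda>k. ?Q ((s \<circ> r) k, (X \<circ> r) k)) \<longlonglongrightarrow> ?Q (0, x)"
    using continuous_on_tendsto_compose[OF descent_grad_continuous lim] xP XP Xs(2) s1 by simp
  moreover have "(\<lambda>k. period_inner n (grad ((X \<circ> r) k)) (grad ((X \<circ> r) k)) / 2) \<longlonglongrightarrow> period_inner n (grad x) (grad x) / 2"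
    by (rule tendsto_divide[OF continuous_on_tendsto_compose[OF grad_square_continuous xr(3) xP] tendsto_const])
      (use XP in auto)
  ultimately have "?Q (0, x) \<le> period_inner n (grad x) (grad x) / 2"
    using Xs(4) by (rule_tac tendsto_le[OF sequentially_bot]) (auto simp: less_imp_le)
  then show False using S(3)[OF xr(1)] \<delta> by simp
qed

text \<open>
  If there were no critical point at levels between \<open>\<alpha>/2\<close> and \<open>C\<close>, then the gradient would be bounded
  away from zero there, because points with small gradient lie in a compact set. A short gradient
  step \<open>\<eta>\<close>, cut off below level \<open>\<alpha>/2\<close>, then lowers \<open>J\<close> by a fixed amount wherever \<open>J \<ge> 3\<alpha>/4\<close>, and it moves no
  coordinate by more than a constant times the decrease of \<open>J\<close>. So the iterates of \<open>\<eta>\<close> keep the path in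
  a bounded set, on which the step length is uniform, and fix its end points; after finitely many
  steps the path stays below \<open>\<alpha>\<close>, contrary to the crossing hypothesis.
\<close>

theorem mountain_pass:
  assumes \<alpha>: "\<alpha> > 0" and Jx0: "J x0 \<le> 0" and Jx1: "J x1 \<le> 0"
    and cross: "\<And>\<gamma>. continuous_on {0..1::real} \<gamma> \<Longrightarrow> \<gamma> ` {0..1} \<subseteq> periodic_seqs n \<Longrightarrow> \<gamma> 0 = x0 \<Longrightarrow> \<gamma> 1 = x1
      \<Longrightarrow> \<exists>s\<in>{0..1}. J (\<gamma> s) \<ge> \<alpha>"
    and path: "continuous_on {0..1::real} \<gamma>0" "\<gamma>0 ` {0..1} \<subseteq> periodic_seqs n" "\<gamma>0 0 = x0" "\<gamma>0 1 = x1"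
    and C: "\<And>s. s \<in> {0..1} \<Longrightarrow> J (\<gamma>0 s) \<le> C"
    and PS: "\<And>x i. x \<in> periodic_seqs n \<Longrightarrow> 0 \<le> J x \<Longrightarrow> J x \<le> C \<Longrightarrow> period_inner n (grad x) (grad x) \<le> 1
      \<Longrightarrow> norm (x i) \<le> R"
  shows "\<exists>x\<in>periodic_seqs n. grad x = (\<lambda>_. 0) \<and> \<alpha> / 2 \<le> J x \<and> J x \<le> C"
proof (rule ccontr)
  assume no: "\<not> ?thesis"
  let ?P = "periodic_seqs n :: (nat \<Rightarrow> 'b) set"
  let ?gg = "\<lambda>x. period_inner n (grad x) (grad x)"
  have C0: "C > 0" using cross[OF path] C \<alpha> by force
  have band: "compact {x \<in> periodic_box n r. \<alpha> / 2 \<le> J x \<and> J x \<le> C}" for r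
  proof -
    have cJ: "continuous_on (periodic_box n r) J"
      by (rule continuous_on_subset[OF J_continuous periodic_box_subset])
    have "closed (periodic_box n r :: (nat \<Rightarrow> 'b) set)" by (simp add: compact_imp_closed compact_periodic_box)
    from continuous_closed_preimage[OF cJ this, of "{\<alpha>/2..C}"]
    have "closed (periodic_box n r \<inter> J -` {\<alpha>/2..C})" by simp
    moreover have eq: "{x \<in> periodic_box n r. \<alpha> / 2 \<le> J x \<and> J x \<le> C} = periodic_box n r \<inter> (periodic_box n r \<inter> J -` {\<alpha>/2..C})"
      by auto
    ultimately show ?thesis unfolding eq by (intro compact_Int_closed compact_periodic_box)
  qed
  obtain \<delta> where \<delta>: "\<delta> > 0" "\<And>x. x \<in> ?P \<Longrightarrow> \<alpha> / 2 \<le> J x \<Longrightarrow> J x \<le> C \<Longrightarrow> ?gg x \<ge> \<delta>\<^sup>2"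
  proof (cases "{x \<in> periodic_box n R. \<alpha> / 2 \<le> J x \<and> J x \<le> C} = {}")
    case True
    show ?thesis
    proof (rule that[of 1])
      fix x assume x: "x \<in> ?P" "\<alpha> / 2 \<le> J x" "J x \<le> C"
      show "1\<^sup>2 \<le> ?gg x"
      proof (rule ccontr)
        assume "\<not> 1\<^sup>2 \<le> ?gg x"
        then have "x \<in> periodic_box n R" using x PS[OF x(1) _ x(3)] \<alpha> by (simp add: periodic_box_def)
        then show False using True x by blast
      qed
    qed simp
  next
    case False
    have "continuous_on {x \<in> periodic_box n R. \<alpha> / 2 \<le> J x \<and> J x \<le> C} ?gg"
      by (rule continuous_on_subset[OF grad_square_continuous]) (use periodic_box_subset in blast)
    from continuous_attains_inf[OF band False this]
    obtain z where z: "z \<in> periodic_box n R" "\<alpha> / 2 \<le> J z" "J z \<le> C"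
      and zmin: "\<And>x. x \<in> periodic_box n R \<Longrightarrow> \<alpha> / 2 \<le> J x \<Longrightarrow> J x \<le> C \<Longrightarrow> ?gg z \<le> ?gg x" by auto
    have "z \<in> ?P" using z(1) periodic_box_subset by blast
    then have gz: "?gg z > 0" using no z grad_eq_zeroI[of z] not_le by blast
    let ?\<delta> = "sqrt (min 1 (?gg z))"
    have sq: "?\<delta>\<^sup>2 = min 1 (?gg z)" using gz by simp
    show ?thesis
    proof (rule that[of ?\<delta>])
      show "?\<delta> > 0" using gz by simp
      fix x assume x: "x \<in> ?P" "\<alpha> / 2 \<le> J x" "J x \<le> C"
      show "?\<delta>\<^sup>2 \<le> ?gg x"
      proof (cases "?gg x \<le> 1")
        case True
        then have "x \<in> periodic_box n R" using x PS[OF x(1) _ x(3)] \<alpha> by (simp add: periodic_box_def)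
        then have "?gg z \<le> ?gg x" by (rule zmin[OF _ x(2,3)])
        then show ?thesis unfolding sq by simp
      qed (use sq in auto)
    qed
  qed
  have "compact (\<gamma>0 ` {0..1})" using path(1) compact_continuous_image by blast
  then obtain r0 where r0: "\<gamma>0 ` {0..1} \<subseteq> periodic_box n r0"
    using compact_imp_subset_periodic_box path(2) n_pos by blast
  \<comment> \<open>total displacement at most \<open>2 C / \<delta>\<close> while the level is positive, plus one last step of length at most 1\<close>
  define r1 where "r1 = r0 + 2 * C / \<delta> + 1"
  let ?A = "periodic_box n r1 :: (nat \<Rightarrow> 'b) set"
  let ?B = "{x \<in> ?A. \<alpha> / 2 \<le> J x \<and> J x \<le> C}"
  have BP: "?B \<subseteq> ?P" using periodic_box_subset by blast
  obtain \<tau>0 where \<tau>0: "\<tau>0 > 0" "\<tau>0 \<le> 1" "\<And>x s. x \<in> ?B \<Longrightarrow> 0 \<le> s \<Longrightarrow> s \<le> \<tau>0 \<Longrightarrow>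
      period_inner n (grad (descent x s)) (grad x) \<ge> ?gg x / 2"
    using uniform_descent[OF _ band BP, of "\<delta>\<^sup>2"] \<delta> BP by auto
  obtain L where L: "L > 0" "\<And>x. x \<in> ?B \<Longrightarrow> sqrt (?gg x) \<le> L"
  proof -
    have "compact ((\<lambda>x. sqrt (?gg x)) ` ?B)"
      by (intro compact_continuous_image band continuous_intros continuous_on_subset[OF grad_square_continuous BP])
    then obtain L where "\<forall>y\<in>(\<lambda>x. sqrt (?gg x)) ` ?B. norm y \<le> L" using compact_imp_bounded[THEN bounded_iff[THEN iffD1]] by blast
    then have "sqrt (?gg x) \<le> max L 1" if "x \<in> ?B" for x using that by force
    then show thesis using that[of "max L 1"] by auto
  qed
  define \<tau> where "\<tau> = min \<tau>0 (1 / L)"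
  have \<tau>: "\<tau> > 0" "\<tau> \<le> \<tau>0" "\<tau> * L \<le> 1" using \<tau>0 L by (auto simp: \<tau>_def min_def field_simps)
  define \<psi> where "\<psi> x = max 0 (min 1 ((J x - \<alpha> / 2) / (\<alpha> / 4)))" for x
  have \<psi>01: "0 \<le> \<psi> x" "\<psi> x \<le> 1" for x by (auto simp: \<psi>_def)
  have \<psi>0: "\<psi> x = 0" if "J x \<le> \<alpha> / 2" for x
  proof -
    have "(J x - \<alpha> / 2) / (\<alpha> / 4) \<le> 0" using that \<alpha> by (intro divide_nonpos_pos) auto
    then show ?thesis by (simp add: \<psi>_def)
  qed
  have \<psi>1: "\<psi> x = 1" if "J x \<ge> 3 * \<alpha> / 4" for x
    using that \<alpha> by (auto simp: \<psi>_def max_def min_def field_simps)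
  define \<eta> where "\<eta> x = descent x (\<tau> * \<psi> x)" for x
  have \<eta>P: "\<eta> x \<in> ?P" if "x \<in> ?P" for x using that descent_periodic by (simp add: \<eta>_def)
  have \<eta>_fix: "\<eta> x = x" if "J x \<le> \<alpha> / 2" for x using \<psi>0[OF that] by (simp add: \<eta>_def)
  have \<eta>_cont: "continuous_on ?P \<eta>"
    unfolding \<eta>_def \<psi>_def
    by (intro continuous_on_coordinatewise_then_product continuous_intros J_continuous grad_continuous
        continuous_on_subset[OF continuous_on_product_coordinates]) (use \<alpha> in auto)
  have drop: "J (\<eta> x) \<le> J x - \<tau> * \<psi> x * (?gg x / 2)" if "x \<in> ?B" for x
    unfolding \<eta>_def
  proof (rule J_descent)
    show "0 \<le> \<tau> * \<psi> x" using \<tau> \<psi>01 by simp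
    have "\<tau> * \<psi> x \<le> \<tau>0" using \<tau> \<psi>01[of x] using mult_left_le[of "\<psi> x" \<tau>] by linarith
    then show "?gg x / 2 \<le> period_inner n (grad (descent x s)) (grad x)"
      if "0 \<le> s" "s \<le> \<tau> * \<psi> x" for s using \<tau>0(3)[OF \<open>x \<in> ?B\<close>] that by auto
  qed (use that BP in auto)
  have move: "norm (\<eta> x i - x i) \<le> 2 / \<delta> * (J x - J (\<eta> x))" "norm (\<eta> x i - x i) \<le> 1" if x: "x \<in> ?B" for x i
  proof -
    have xP: "x \<in> ?P" using x BP by blast
    have gb: "norm (grad x i) \<le> sqrt (?gg x)" using grad_bound[OF xP, of i] by (simp add: real_le_rsqrt)
    have gg: "?gg x \<ge> \<delta>\<^sup>2" using \<delta>(2) xP x by auto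
    have g0: "?gg x \<ge> 0" by (rule order_trans[OF zero_le_power2 gg])
    from gg have sd: "sqrt (?gg x) \<ge> \<delta>" using \<delta>(1) by (simp add: real_le_rsqrt)
    have "norm (\<eta> x i - x i) = \<tau> * \<psi> x * norm (grad x i)" using \<tau> \<psi>01[of x] by (simp add: \<eta>_def)
    also have "\<dots> \<le> \<tau> * \<psi> x * sqrt (?gg x)" using gb \<tau> \<psi>01[of x] by (intro mult_left_mono) auto
    finally have 1: "norm (\<eta> x i - x i) \<le> \<tau> * \<psi> x * sqrt (?gg x)" .
    have "sqrt (?gg x) * \<delta> \<le> sqrt (?gg x) * sqrt (?gg x)" using sd g0 by (intro mult_left_mono) auto
    also have "\<dots> = ?gg x" using g0 by simp
    finally have "sqrt (?gg x) \<le> ?gg x / \<delta>" using \<delta>(1) by (simp add: field_simps)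
    then have "\<tau> * \<psi> x * sqrt (?gg x) \<le> \<tau> * \<psi> x * (?gg x / \<delta>)" using \<tau> \<psi>01[of x] by (intro mult_left_mono) auto
    also have "\<dots> = 2 / \<delta> * (\<tau> * \<psi> x * (?gg x / 2))" by simp
    also have "\<dots> \<le> 2 / \<delta> * (J x - J (\<eta> x))" using drop[OF x] \<delta> by (intro mult_left_mono) auto
    finally show "norm (\<eta> x i - x i) \<le> 2 / \<delta> * (J x - J (\<eta> x))" using 1 by linarith
    have "\<tau> * \<psi> x * sqrt (?gg x) \<le> \<tau> * 1 * L"
      using L(2)[OF x] L(1) \<tau> \<psi>01[of x] g0 by (intro mult_mono) auto
    then show "norm (\<eta> x i - x i) \<le> 1" using 1 \<tau>(3) by linarith
  qed
  define \<gamma> where "\<gamma> k = (\<eta> ^^ k) \<circ> \<gamma>0" for k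
  have \<gamma>Suc: "\<gamma> (Suc k) s = \<eta> (\<gamma> k s)" for k s by (simp add: \<gamma>_def)
  have inv: "\<gamma> k s \<in> ?P \<and> J (\<gamma> k s) \<le> C \<and> (\<forall>i. norm (\<gamma> k s i - \<gamma>0 s i) \<le> 2 / \<delta> * (J (\<gamma>0 s) - J (\<gamma> k s)))
      \<and> \<gamma> k s \<in> ?A \<and> J (\<gamma> k s) \<le> max (3 * \<alpha> / 4) (C - real k * (\<tau> * \<delta>\<^sup>2 / 2))" if s: "s \<in> {0..1}" for k s
  proof (induction k)
    case 0
    have "2 * C / \<delta> + 1 \<ge> 0" using C0 \<delta> by simp
    moreover have "\<gamma>0 s \<in> periodic_box n r0" using r0 s by blast
    ultimately have "\<gamma>0 s \<in> ?A" unfolding periodic_box_def r1_def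
      by (simp add: add_increasing2 order_trans[of _ r0])
    then show ?case using path(2) s C[OF s] periodic_box_subset by (auto simp: \<gamma>_def)
  next
    case (Suc k)
    let ?x = "\<gamma> k s"
    show ?case
    proof (cases "J ?x \<le> \<alpha> / 2")
      case True
      then have "\<gamma> (Suc k) s = ?x" "J ?x \<le> 3 * \<alpha> / 4" using \<alpha> by (auto simp: \<gamma>Suc \<eta>_fix)
      then show ?thesis using Suc by (simp add: le_max_iff_disj)
    next
      case False
      then have x: "?x \<in> ?B" using Suc by auto
      have dr: "J (\<eta> ?x) \<le> J ?x - \<tau> * \<psi> ?x * (?gg ?x / 2)" using drop[OF x] .
      have gg: "?gg ?x \<ge> \<delta>\<^sup>2" using \<delta>(2)[of ?x] x Suc by auto
      have g0: "?gg ?x \<ge> 0" by (rule order_trans[OF zero_le_power2 gg])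
      have le: "J (\<eta> ?x) \<le> J ?x" using dr mult_nonneg_nonneg[OF mult_nonneg_nonneg[of \<tau> "\<psi> ?x"], of "?gg ?x / 2"] \<tau> \<psi>01[of ?x] g0
        by linarith
      have "norm (\<eta> ?x i - \<gamma>0 s i) \<le> 2 / \<delta> * (J (\<gamma>0 s) - J (\<eta> ?x))" for i
      proof -
        have "norm (\<eta> ?x i - \<gamma>0 s i) \<le> norm (\<eta> ?x i - ?x i) + norm (?x i - \<gamma>0 s i)"
          using norm_triangle_ineq[of "\<eta> ?x i - ?x i" "?x i - \<gamma>0 s i"] by simp
        also have "\<dots> \<le> 2 / \<delta> * (J ?x - J (\<eta> ?x)) + 2 / \<delta> * (J (\<gamma>0 s) - J ?x)"
          using move(1)[OF x, of i] Suc by (intro add_mono) auto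
        finally show ?thesis by (simp add: algebra_simps)
      qed
      moreover have "\<eta> ?x \<in> ?A"
      proof -
        have "norm (\<eta> ?x i) \<le> r1" for i
        proof -
          have "norm (?x i - \<gamma>0 s i) \<le> 2 / \<delta> * (J (\<gamma>0 s) - J ?x)" using Suc by blast
          also have "\<dots> \<le> 2 / \<delta> * C" using C[OF s] False \<alpha> \<delta> by (intro mult_left_mono) auto
          finally have "norm (?x i - \<gamma>0 s i) \<le> 2 * C / \<delta>" by simp
          moreover have "norm (\<gamma>0 s i) \<le> r0"
            using subsetD[OF r0, of "\<gamma>0 s"] s by (simp add: periodic_box_def)
          moreover have "norm (\<eta> ?x i - ?x i) \<le> 1" using move(2)[OF x] .
          ultimately show ?thesis unfolding r1_def
            using norm_triangle_sub[of "\<eta> ?x i" "?x i"] norm_triangle_sub[of "?x i" "\<gamma>0 s i"] by linarith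
        qed
        then show ?thesis using \<eta>P Suc by (auto simp: periodic_box_def)
      qed
      moreover have "J (\<eta> ?x) \<le> max (3 * \<alpha> / 4) (C - real (Suc k) * (\<tau> * \<delta>\<^sup>2 / 2))"
      proof (cases "J ?x \<ge> 3 * \<alpha> / 4")
        case True
        have "\<tau> * (\<delta>\<^sup>2 / 2) \<le> \<tau> * \<psi> ?x * (?gg ?x / 2)" using \<psi>1[OF True] gg \<tau> by simp
        then have "J (\<eta> ?x) \<le> J ?x - \<tau> * \<delta>\<^sup>2 / 2" using dr by simp
        moreover have "J ?x \<le> max (3 * \<alpha> / 4) (C - real k * (\<tau> * \<delta>\<^sup>2 / 2))" using Suc by blast
        moreover have "\<tau> * \<delta>\<^sup>2 / 2 > 0" using \<tau> \<delta> by simp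
        moreover have "real (Suc k) * (\<tau> * \<delta>\<^sup>2 / 2) = real k * (\<tau> * \<delta>\<^sup>2 / 2) + \<tau> * \<delta>\<^sup>2 / 2"
          by (simp add: distrib_right)
        ultimately show ?thesis by linarith
      next
        case False
        then show ?thesis using le by linarith
      qed
      moreover have "\<eta> ?x \<in> ?P" "J (\<eta> ?x) \<le> C" using \<eta>P le Suc by (blast, linarith)
      ultimately show ?thesis unfolding \<gamma>Suc by (intro conjI allI)
    qed
  qed
  obtain k :: nat where k: "C / (\<tau> * \<delta>\<^sup>2 / 2) < real k" using reals_Archimedean2 by blast
  then have k': "C - real k * (\<tau> * \<delta>\<^sup>2 / 2) < 0" using \<tau> \<delta> by (simp add: pos_divide_less_eq)
  have ends: "\<gamma> k 0 = x0" "\<gamma> k 1 = x1" for k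
    by (induction k) (use path \<eta>_fix Jx0 Jx1 \<alpha> in \<open>auto simp: \<gamma>_def\<close>)
  have "continuous_on {0..1} (\<gamma> k)" for k
  proof (induction k)
    case 0 then show ?case using path by (simp add: \<gamma>_def)
  next
    case (Suc k)
    then show ?case unfolding \<gamma>Suc[abs_def] using inv
      by (intro continuous_on_compose2[OF \<eta>_cont Suc]) auto
  qed
  then obtain s where "s \<in> {0..1}" "J (\<gamma> k s) \<ge> \<alpha>" using cross[of "\<gamma> k"] ends inv by blast
  then show False using inv[of s k] k' \<alpha> by auto
qed

text \<open>
  A minimizer over the compact set \<open>\<Phi> \<le> \<rho>\<close> cannot lie on the sphere \<open>\<Phi> = \<rho>\<close>, so small steps along the
  gradient are admissible and the gradient vanishes.
\<close>

theorem constrained_minimum: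
  fixes \<Phi> :: "(nat \<Rightarrow> 'b) \<Rightarrow> real"
  assumes \<Phi>: "continuous_on (periodic_seqs n) \<Phi>" and y: "y \<in> periodic_seqs n" "\<Phi> y < \<rho>"
    and bounded: "\<And>x i. x \<in> periodic_seqs n \<Longrightarrow> \<Phi> x \<le> \<rho> \<Longrightarrow> norm (x i) \<le> R"
    and sphere: "\<And>x. x \<in> periodic_seqs n \<Longrightarrow> \<Phi> x = \<rho> \<Longrightarrow> J x > J y"
  shows "\<exists>x\<in>periodic_seqs n. grad x = (\<lambda>_. 0) \<and> J x \<le> J y \<and> \<Phi> x < \<rho>"
proof -
  let ?P = "periodic_seqs n :: (nat \<Rightarrow> 'b) set"
  let ?S = "{x \<in> ?P. \<Phi> x \<le> \<rho>}"
  have "?S = {x \<in> periodic_box n R. \<Phi> x \<le> \<rho>}" using bounded by (auto simp: periodic_box_def)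
  moreover have "compact {x \<in> periodic_box n R. \<Phi> x \<le> \<rho>}"
  proof -
    have cJ: "continuous_on (periodic_box n R) \<Phi>"
      by (rule continuous_on_subset[OF \<Phi> periodic_box_subset])
    have "closed (periodic_box n R :: (nat \<Rightarrow> 'b) set)" by (simp add: compact_imp_closed compact_periodic_box)
    from continuous_closed_preimage[OF cJ this, of "{..\<rho>}"]
    have "closed (periodic_box n R \<inter> \<Phi> -` {..\<rho>})" by simp
    moreover have eq: "{x \<in> periodic_box n R. \<Phi> x \<le> \<rho>} = periodic_box n R \<inter> (periodic_box n R \<inter> \<Phi> -` {..\<rho>})"
      by auto
    ultimately show ?thesis unfolding eq by (intro compact_Int_closed compact_periodic_box)
  qed
  ultimately have "compact ?S" by simp
  moreover have "continuous_on ?S J" using J_continuous by (rule continuous_on_subset) auto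
  moreover have "?S \<noteq> {}" using y by force
  ultimately obtain x where x: "x \<in> ?S" "\<And>z. z \<in> ?S \<Longrightarrow> J x \<le> J z"
    using continuous_attains_inf[of ?S J] by blast
  have xP: "x \<in> ?P" and "J x \<le> J y" using x y by auto
  then have lt: "\<Phi> x < \<rho>" using sphere[of x] x(1) by force
  let ?m = "\<lambda>s. (\<lambda>i. x i + s *\<^sub>R (- grad x i))"
  have m: "(\<lambda>i. - grad x i) \<in> ?P" using grad_periodic[OF xP] by (auto simp: periodic_seqs_def)
  have mP: "?m s \<in> ?P" for s using grad_periodic[OF xP] xP by (auto simp: periodic_seqs_def)
  have "continuous_on UNIV (\<lambda>s::real. \<Phi> (?m s))"
    by (rule continuous_on_compose2[OF \<Phi>])
      (use mP in \<open>auto intro!: continuous_on_coordinatewise_then_product continuous_intros\<close>)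
  then have "isCont (\<lambda>s::real. \<Phi> (?m s)) 0" by (simp add: continuous_on_eq_continuous_at)
  then have "eventually (\<lambda>s. \<Phi> (?m s) < \<rho>) (at 0)"
    using lt by (intro order_tendstoD(2)) (auto simp: isCont_def)
  then obtain d where d: "d > 0" "\<And>s. s \<noteq> 0 \<Longrightarrow> \<bar>s\<bar> < d \<Longrightarrow> \<Phi> (?m s) < \<rho>"
    by (auto simp: eventually_at dist_real_def)
  have "period_inner n (grad x) (\<lambda>i. - grad x i) = 0"
  proof (rule DERIV_local_min)
    show "((\<lambda>s. J (?m s)) has_real_derivative period_inner n (grad x) (\<lambda>i. - grad x i)) (at 0)"
      using J_derivative[OF xP m, of 0] by simp
    show "0 < d" by fact
    show "\<forall>s. \<bar>0 - s\<bar> < d \<longrightarrow> J (?m 0) \<le> J (?m s)"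
    proof (intro allI impI)
      fix s assume "\<bar>0 - s\<bar> < d"
      then have "\<Phi> (?m s) \<le> \<rho>" using d(2)[of s] lt by (cases "s = 0") auto
      then show "J (?m 0) \<le> J (?m s)" using x(2)[of "?m s"] mP by simp
    qed
  qed
  then have "grad x = (\<lambda>_. 0)" by (intro grad_eq_zeroI xP) (simp add: period_inner_def sum_negf)
  then show ?thesis using xP \<open>J x \<le> J y\<close> lt by blast
qed

end

section \<open>Lagrangians and discretized actions\<close>

locale lagrangian =
  fixes T :: real and F :: "real \<Rightarrow> 'b::euclidean_space \<Rightarrow> 'b \<Rightarrow> real"
    and Fx Fv :: "real \<Rightarrow> 'b \<Rightarrow> 'b \<Rightarrow> 'b" and V :: "real \<Rightarrow> 'b \<Rightarrow> real" and Vx :: "real \<Rightarrow> 'b \<Rightarrow> 'b"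
  assumes T_pos: "T > 0"
    and F_derivative: "t \<in> {-T..T} \<Longrightarrow>
      ((\<lambda>(x, v). F t x v) has_derivative (\<lambda>(a, b). a \<bullet> Fx t x v + b \<bullet> Fv t x v)) (at (x, v))"
    and V_derivative: "t \<in> {-T..T} \<Longrightarrow> (V t has_derivative (\<lambda>a. a \<bullet> Vx t x)) (at x)"
    and F_continuous: "continuous_on ({-T..T} \<times> UNIV \<times> UNIV) (\<lambda>(t, x, v). F t x v)"
    and Fx_continuous: "continuous_on ({-T..T} \<times> UNIV \<times> UNIV) (\<lambda>(t, x, v). Fx t x v)"
    and Fv_continuous: "continuous_on ({-T..T} \<times> UNIV \<times> UNIV) (\<lambda>(t, x, v). Fv t x v)"
    and V_continuous: "continuous_on ({-T..T} \<times> UNIV) (\<lambda>(t, x). V t x)"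
    and Vx_continuous: "continuous_on ({-T..T} \<times> UNIV) (\<lambda>(t, x). Vx t x)"
    and F_convex: "t \<in> {-T..T} \<Longrightarrow> convex_on UNIV (F t x)"
begin

abbreviation "time \<equiv> {-T..T}"

lemma F_line_derivative:
  assumes "t \<in> time"
  shows "((\<lambda>s. F t (x + s *\<^sub>R a) (v + s *\<^sub>R b)) has_real_derivative
      (a \<bullet> Fx t (x + s *\<^sub>R a) (v + s *\<^sub>R b) + b \<bullet> Fv t (x + s *\<^sub>R a) (v + s *\<^sub>R b))) (at s)"
proof -
  have l: "((\<lambda>s. (x + s *\<^sub>R a, v + s *\<^sub>R b)) has_derivative (\<lambda>r. (r *\<^sub>R a, r *\<^sub>R b))) (at s)"
    by (auto intro!: derivative_eq_intros)
  let ?d = "a \<bullet> Fx t (x + s *\<^sub>R a) (v + s *\<^sub>R b) + b \<bullet> Fv t (x + s *\<^sub>R a) (v + s *\<^sub>R b)"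
  from has_derivative_compose[OF l F_derivative[OF assms]]
  have "((\<lambda>s. F t (x + s *\<^sub>R a) (v + s *\<^sub>R b)) has_derivative
      (\<lambda>r. r * (a \<bullet> Fx t (x + s *\<^sub>R a) (v + s *\<^sub>R b)) + r * (b \<bullet> Fv t (x + s *\<^sub>R a) (v + s *\<^sub>R b)))) (at s)"
    by simp
  moreover have "(\<lambda>r. r * (a \<bullet> Fx t (x + s *\<^sub>R a) (v + s *\<^sub>R b)) + r * (b \<bullet> Fv t (x + s *\<^sub>R a) (v + s *\<^sub>R b))) = (*) ?d"
    by (simp add: fun_eq_iff algebra_simps)
  ultimately show ?thesis unfolding has_field_derivative_def by simp
qed

lemma V_line_derivative:
  assumes "t \<in> time"
  shows "((\<lambda>s. V t (x + s *\<^sub>R a)) has_real_derivative (a \<bullet> Vx t (x + s *\<^sub>R a))) (at s)"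
proof -
  have l: "((\<lambda>s. x + s *\<^sub>R a) has_derivative (\<lambda>r. r *\<^sub>R a)) (at s)"
    by (auto intro!: derivative_eq_intros)
  from has_derivative_compose[OF l V_derivative[OF assms]] show ?thesis
    by (simp add: has_field_derivative_def mult_commute_abs)
qed

lemma F_derivative_x: "t \<in> time \<Longrightarrow> ((\<lambda>y. F t y v) has_derivative (\<lambda>d. d \<bullet> Fx t x v)) (at x)"
proof -
  assume t: "t \<in> time"
  have l: "((\<lambda>y. (y, v)) has_derivative (\<lambda>r. (r, 0))) (at x)" by (auto intro!: derivative_eq_intros)
  from has_derivative_compose[OF l F_derivative[OF t]] show ?thesis by simp
qed

lemma F_derivative_v: "t \<in> time \<Longrightarrow> (F t x has_derivative (\<lambda>d. d \<bullet> Fv t x v)) (at v)"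
proof -
  assume t: "t \<in> time"
  have l: "((\<lambda>w. (x, w)) has_derivative (\<lambda>r. (0, r))) (at v)" by (auto intro!: derivative_eq_intros)
  from has_derivative_compose[OF l F_derivative[OF t]] show ?thesis by simp
qed

lemma F_subgradient:
  assumes t: "t \<in> time"
  shows "F t x w \<ge> F t x v + Fv t x v \<bullet> (w - v)"
proof -
  let ?\<phi> = "\<lambda>s::real. F t x (v + s *\<^sub>R (w - v))"
  have "convex_on UNIV ?\<phi>"
  proof (rule convex_onI)
    fix l a b :: real assume l: "0 < l" "l < 1"
    have "v + ((1 - l) *\<^sub>R a + l *\<^sub>R b) *\<^sub>R (w - v) = (1 - l) *\<^sub>R (v + a *\<^sub>R (w - v)) + l *\<^sub>R (v + b *\<^sub>R (w - v))"
      by (simp add: algebra_simps)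
    then show "?\<phi> ((1 - l) *\<^sub>R a + l *\<^sub>R b) \<le> (1 - l) * ?\<phi> a + l * ?\<phi> b"
      using convex_onD[OF F_convex[OF t], of l "v + a *\<^sub>R (w - v)" "v + b *\<^sub>R (w - v)"] l by simp
  qed simp
  moreover have "(?\<phi> has_real_derivative ((w - v) \<bullet> Fv t x v)) (at 0)"
    using F_line_derivative[OF t, of x 0 v "w - v" 0] by simp
  ultimately have "?\<phi> 1 - ?\<phi> 0 \<ge> ((w - v) \<bullet> Fv t x v) * (1 - 0)"
    by (intro convex_on_imp_above_tangent[where A=UNIV]) auto
  then show ?thesis by (simp add: inner_commute)
qed

lemma continuous_along:
  assumes \<tau>: "\<tau> \<in> time" and X: "continuous_on S X" and Y: "continuous_on S Y"
  shows "continuous_on S (\<lambda>z. F \<tau> (X z) (Y z))" "continuous_on S (\<lambda>z. Fx \<tau> (X z) (Y z))"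
    "continuous_on S (\<lambda>z. Fv \<tau> (X z) (Y z))" "continuous_on S (\<lambda>z. V \<tau> (X z))" "continuous_on S (\<lambda>z. Vx \<tau> (X z))"
proof -
  have 1: "continuous_on S (\<lambda>z. (\<tau>, X z, Y z))" by (intro continuous_intros X Y)
  have 2: "continuous_on S (\<lambda>z. (\<tau>, X z))" by (intro continuous_intros X)
  show "continuous_on S (\<lambda>z. F \<tau> (X z) (Y z))" "continuous_on S (\<lambda>z. Fx \<tau> (X z) (Y z))"
    "continuous_on S (\<lambda>z. Fv \<tau> (X z) (Y z))" "continuous_on S (\<lambda>z. V \<tau> (X z))" "continuous_on S (\<lambda>z. Vx \<tau> (X z))"
    using continuous_on_compose2[OF F_continuous 1] continuous_on_compose2[OF Fx_continuous 1]
      continuous_on_compose2[OF Fv_continuous 1] continuous_on_compose2[OF V_continuous 2]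
      continuous_on_compose2[OF Vx_continuous 2] \<tau> by (auto simp: image_subset_iff)
qed

definition "common_bound X R B \<longleftrightarrow> (\<forall>t x v. t \<in> time \<longrightarrow> norm x \<le> X \<longrightarrow> norm v \<le> R \<longrightarrow>
    \<bar>F t x v\<bar> \<le> B \<and> norm (Fx t x v) \<le> B \<and> norm (Fv t x v) \<le> B \<and> \<bar>V t x\<bar> \<le> B \<and> norm (Vx t x) \<le> B)"

definition "common_modulus X R e d \<longleftrightarrow> (\<forall>t t' x x' v. t \<in> time \<longrightarrow> t' \<in> time \<longrightarrow> \<bar>t - t'\<bar> < d \<longrightarrow>
    norm x \<le> X \<longrightarrow> norm x' \<le> X \<longrightarrow> norm (x - x') < d \<longrightarrow> norm v \<le> R \<longrightarrow>
    \<bar>F t x v - F t' x' v\<bar> \<le> e \<and> norm (Fx t x v - Fx t' x' v) \<le> e \<and> norm (Fv t x v - Fv t' x' v) \<le> e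
    \<and> \<bar>V t x - V t' x'\<bar> \<le> e \<and> norm (Vx t x - Vx t' x') \<le> e)"

lemmas common_boundD = common_bound_def[THEN iffD1, rule_format]

lemmas common_modulusD = common_modulus_def[THEN iffD1, rule_format]

lemma bounded_on_compact:
  obtains B where "B \<ge> 0" "common_bound X R B"
proof -
  let ?K = "time \<times> cball (0::'b) X \<times> cball (0::'b) R"
  let ?K2 = "time \<times> cball (0::'b) X"
  have K: "compact ?K" "compact ?K2" by (intro compact_Times compact_Icc compact_cball)+
  have bd: "\<exists>B. \<forall>z\<in>C. norm (f z) \<le> B" if "compact C" "continuous_on C f"
    for C :: "'x::topological_space set" and f :: "'x \<Rightarrow> 'c::real_normed_vector"
    using compact_imp_bounded[OF compact_continuous_image[OF that(2,1)]] unfolding bounded_iff by auto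
  obtain B1 where B1: "\<forall>z\<in>?K. norm ((\<lambda>(t, x, v). F t x v) z) \<le> B1"
    using bd[OF K(1) continuous_on_subset[OF F_continuous]] by blast
  obtain B2 where B2: "\<forall>z\<in>?K. norm ((\<lambda>(t, x, v). Fx t x v) z) \<le> B2"
    using bd[OF K(1) continuous_on_subset[OF Fx_continuous]] by blast
  obtain B3 where B3: "\<forall>z\<in>?K. norm ((\<lambda>(t, x, v). Fv t x v) z) \<le> B3"
    using bd[OF K(1) continuous_on_subset[OF Fv_continuous]] by blast
  obtain B4 where B4: "\<forall>z\<in>?K2. norm ((\<lambda>(t, x). V t x) z) \<le> B4"
    using bd[OF K(2) continuous_on_subset[OF V_continuous]] by blast
  obtain B5 where B5: "\<forall>z\<in>?K2. norm ((\<lambda>(t, x). Vx t x) z) \<le> B5"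
    using bd[OF K(2) continuous_on_subset[OF Vx_continuous]] by blast
  show thesis
  proof (rule that[of "\<bar>B1\<bar> + \<bar>B2\<bar> + \<bar>B3\<bar> + \<bar>B4\<bar> + \<bar>B5\<bar>"])
    show "common_bound X R (\<bar>B1\<bar> + \<bar>B2\<bar> + \<bar>B3\<bar> + \<bar>B4\<bar> + \<bar>B5\<bar>)"
      unfolding common_bound_def
    proof (intro allI impI)
      fix t and x v :: 'b assume "t \<in> time" "norm x \<le> X" "norm v \<le> R"
      then have z: "(t, x, v) \<in> ?K" "(t, x) \<in> ?K2" by auto
      have "\<bar>F t x v\<bar> \<le> B1" "norm (Fx t x v) \<le> B2" "norm (Fv t x v) \<le> B3" "\<bar>V t x\<bar> \<le> B4" "norm (Vx t x) \<le> B5"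
        using bspec[OF B1 z(1)] bspec[OF B2 z(1)] bspec[OF B3 z(1)] bspec[OF B4 z(2)] bspec[OF B5 z(2)] by simp_all
      then show "\<bar>F t x v\<bar> \<le> \<bar>B1\<bar> + \<bar>B2\<bar> + \<bar>B3\<bar> + \<bar>B4\<bar> + \<bar>B5\<bar> \<and> norm (Fx t x v) \<le> \<bar>B1\<bar> + \<bar>B2\<bar> + \<bar>B3\<bar> + \<bar>B4\<bar> + \<bar>B5\<bar>
        \<and> norm (Fv t x v) \<le> \<bar>B1\<bar> + \<bar>B2\<bar> + \<bar>B3\<bar> + \<bar>B4\<bar> + \<bar>B5\<bar> \<and> \<bar>V t x\<bar> \<le> \<bar>B1\<bar> + \<bar>B2\<bar> + \<bar>B3\<bar> + \<bar>B4\<bar> + \<bar>B5\<bar>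
        \<and> norm (Vx t x) \<le> \<bar>B1\<bar> + \<bar>B2\<bar> + \<bar>B3\<bar> + \<bar>B4\<bar> + \<bar>B5\<bar>" by linarith
    qed
  qed simp
qed

lemma uniformly_close:
  assumes e: "e > 0"
  obtains d where "d > 0" "common_modulus X R e d"
proof -
  let ?K = "time \<times> cball (0::'b) X \<times> cball (0::'b) R"
  let ?K2 = "time \<times> cball (0::'b) X"
  have K: "compact ?K" "compact ?K2" by (intro compact_Times compact_Icc compact_cball)+
  have uc: "\<exists>d>0. \<forall>z\<in>C. \<forall>z'\<in>C. dist z' z < d \<longrightarrow> dist (f z') (f z) < e" if "compact C" "continuous_on C f"
    for C :: "'x::metric_space set" and f :: "'x \<Rightarrow> 'c::real_normed_vector"
    using compact_uniformly_continuous[OF that(2,1)] e unfolding uniformly_continuous_on_def by blast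
  obtain d1 where d1: "d1 > 0" "\<forall>z\<in>?K. \<forall>z'\<in>?K. dist z' z < d1 \<longrightarrow> dist ((\<lambda>(t, x, v). F t x v) z') ((\<lambda>(t, x, v). F t x v) z) < e"
    using uc[OF K(1) continuous_on_subset[OF F_continuous]] by blast
  obtain d2 where d2: "d2 > 0" "\<forall>z\<in>?K. \<forall>z'\<in>?K. dist z' z < d2 \<longrightarrow> dist ((\<lambda>(t, x, v). Fx t x v) z') ((\<lambda>(t, x, v). Fx t x v) z) < e"
    using uc[OF K(1) continuous_on_subset[OF Fx_continuous]] by blast
  obtain d3 where d3: "d3 > 0" "\<forall>z\<in>?K. \<forall>z'\<in>?K. dist z' z < d3 \<longrightarrow> dist ((\<lambda>(t, x, v). Fv t x v) z') ((\<lambda>(t, x, v). Fv t x v) z) < e"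
    using uc[OF K(1) continuous_on_subset[OF Fv_continuous]] by blast
  obtain d4 where d4: "d4 > 0" "\<forall>z\<in>?K2. \<forall>z'\<in>?K2. dist z' z < d4 \<longrightarrow> dist ((\<lambda>(t, x). V t x) z') ((\<lambda>(t, x). V t x) z) < e"
    using uc[OF K(2) continuous_on_subset[OF V_continuous]] by blast
  obtain d5 where d5: "d5 > 0" "\<forall>z\<in>?K2. \<forall>z'\<in>?K2. dist z' z < d5 \<longrightarrow> dist ((\<lambda>(t, x). Vx t x) z') ((\<lambda>(t, x). Vx t x) z) < e"
    using uc[OF K(2) continuous_on_subset[OF Vx_continuous]] by blast
  define d where "d = min d1 (min d2 (min d3 (min d4 d5))) / 2"
  have d: "d > 0" "2 * d \<le> d1" "2 * d \<le> d2" "2 * d \<le> d3" "2 * d \<le> d4" "2 * d \<le> d5"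
    using d1 d2 d3 d4 d5 by (auto simp: d_def)
  show thesis
  proof (rule that[OF d(1)], unfold common_modulus_def, intro allI impI)
    fix t t' and x x' v :: 'b
    assume a: "t \<in> time" "t' \<in> time" "\<bar>t - t'\<bar> < d" "norm x \<le> X" "norm x' \<le> X" "norm (x - x') < d" "norm v \<le> R"
    have z: "(t, x, v) \<in> ?K" "(t', x', v) \<in> ?K" "(t, x) \<in> ?K2" "(t', x') \<in> ?K2" using a by auto
    have "dist (t, x) (t', x') \<le> dist t t' + dist x x'"
      unfolding dist_Pair_Pair by (rule sqrt_sum_squares_le_sum) auto
    then have D: "dist (t, x) (t', x') < 2 * d" using a by (simp add: dist_norm)
    have D': "dist (t, x, v) (t', x', v) = dist (t, x) (t', x')" by (simp add: dist_Pair_Pair)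
    have "dist (F t x v) (F t' x' v) < e" using d1(2)[rule_format, OF z(2,1)] D D' d by simp
    moreover have "dist (Fx t x v) (Fx t' x' v) < e" using d2(2)[rule_format, OF z(2,1)] D D' d by simp
    moreover have "dist (Fv t x v) (Fv t' x' v) < e" using d3(2)[rule_format, OF z(2,1)] D D' d by simp
    moreover have "dist (V t x) (V t' x') < e" using d4(2)[rule_format, OF z(4,3)] D D' d by simp
    moreover have "dist (Vx t x) (Vx t' x') < e" using d5(2)[rule_format, OF z(4,3)] D D' d by simp
    ultimately show "\<bar>F t x v - F t' x' v\<bar> \<le> e \<and> norm (Fx t x v - Fx t' x' v) \<le> e \<and> norm (Fv t x v - Fv t' x' v) \<le> e
     \<and> \<bar>V t x - V t' x'\<bar> \<le> e \<and> norm (Vx t x - Vx t' x') \<le> e" by (simp add: dist_norm dist_real_def)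
  qed
qed

end

locale discretization = lagrangian T F Fx Fv V Vx
  for T :: real and F :: "real \<Rightarrow> 'b::euclidean_space \<Rightarrow> 'b \<Rightarrow> real"
    and Fx Fv :: "real \<Rightarrow> 'b \<Rightarrow> 'b \<Rightarrow> 'b" and V :: "real \<Rightarrow> 'b \<Rightarrow> real" and Vx :: "real \<Rightarrow> 'b \<Rightarrow> 'b" +
  fixes n :: nat and \<tau> :: "nat \<Rightarrow> real"
  assumes n_pos: "n > 0" and \<tau>_time: "\<tau> i \<in> {-T..T}" and \<tau>_periodic: "\<tau> \<in> periodic_seqs n"
begin

text \<open>
  After summation by parts the derivative of the action is represented by \<open>action_grad\<close>, so that its zeros are the
  solutions of the discrete Euler-Lagrange equation: the increment of the momentum is the force times the mesh.
\<close>

definition "mesh = 2 * T / real n"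
definition "velocity x i = (x (Suc i) - x i) /\<^sub>R mesh" for x :: "nat \<Rightarrow> 'b"
definition "momentum x i = Fv (\<tau> i) (x i) (velocity x i)"
definition "force x i = Fx (\<tau> i) (x i) (velocity x i) + Vx (\<tau> i) (x i)"
definition "action x = (\<Sum>i<n. mesh * (F (\<tau> i) (x i) (velocity x i) + V (\<tau> i) (x i)))"
definition "action_grad x i = mesh *\<^sub>R force x i - (momentum x i - momentum x (i + n - 1))"

lemma mesh_pos: "mesh > 0" using T_pos n_pos by (simp add: mesh_def)

lemma n_mesh: "real n * mesh = 2 * T" using n_pos by (simp add: mesh_def)

lemma step_velocity: "x (Suc i) = x i + mesh *\<^sub>R velocity x i"
  using mesh_pos by (simp add: velocity_def)

lemma \<tau>_shift: "\<tau> (i + n) = \<tau> i" using \<tau>_periodic by (simp add: periodic_seqs_def)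

lemma periodic_shift: "x \<in> periodic_seqs n \<Longrightarrow> x (i + n) = x i" by (simp add: periodic_seqs_def)

lemma velocity_periodic:
  assumes "x \<in> periodic_seqs n" shows "velocity x \<in> periodic_seqs n"
  using assms unfolding periodic_seqs_def velocity_def by (simp flip: add_Suc)

lemma momentum_periodic:
  assumes "x \<in> periodic_seqs n" shows "momentum x \<in> periodic_seqs n"
  using periodic_shift[OF assms] periodic_shift[OF velocity_periodic[OF assms]] \<tau>_shift
  by (simp add: periodic_seqs_def momentum_def)

lemma force_periodic:
  assumes "x \<in> periodic_seqs n" shows "force x \<in> periodic_seqs n"
  using periodic_shift[OF assms] periodic_shift[OF velocity_periodic[OF assms]] \<tau>_shift
  by (simp add: periodic_seqs_def force_def)

lemma action_grad_periodic:
  assumes "x \<in> periodic_seqs n" shows "action_grad x \<in> periodic_seqs n"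
proof -
  have "i + n + n - 1 = (i + n - 1) + n" for i using n_pos by simp
  then show ?thesis
    using periodic_shift[OF momentum_periodic[OF assms]] periodic_shift[OF force_periodic[OF assms]]
    by (simp add: periodic_seqs_def action_grad_def)
qed

lemma critical_momentum_step:
  assumes "action_grad x = (\<lambda>_. 0)"
  shows "momentum x i = momentum x (i + n - 1) + mesh *\<^sub>R force x i"
  using fun_cong[OF assms, of i] unfolding action_grad_def by simp

lemma critical_momentum_Suc:
  assumes "action_grad x = (\<lambda>_. 0)" "x \<in> periodic_seqs n"
  shows "momentum x (Suc i) = momentum x i + mesh *\<^sub>R force x (Suc i)"
  using critical_momentum_step[OF assms(1), of "Suc i"] periodic_shift[OF momentum_periodic[OF assms(2)], of i]
  by simp

text \<open>
  Summation by parts on the cyclic group; \<open>i + n - 1\<close> stands for the predecessor of \<open>i\<close> modulo \<open>n\<close>, which avoids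
  a truncated subtraction at \<open>i = 0\<close>.
\<close>

lemma sum_velocity_by_parts:
  assumes q: "q \<in> periodic_seqs n" and y: "y \<in> periodic_seqs n"
  shows "(\<Sum>i<n. mesh * (q i \<bullet> velocity y i)) = - (\<Sum>i<n. (q i - q (i + n - 1)) \<bullet> y i)"
proof -
  let ?f = "\<lambda>i. q (i + n - 1) \<bullet> y i"
  have e: "i + n + n - 1 = (i + n - 1) + n" "Suc i + n - 1 = i + n" for i using n_pos by auto
  have "?f \<in> periodic_seqs n"
    unfolding periodic_seqs_def mem_Collect_eq e(1) by (intro allI arg_cong2[where f=inner] periodic_shift q y)
  from sum_periodic_shift[OF this] have s: "(\<Sum>i<n. q i \<bullet> y (Suc i)) = (\<Sum>i<n. ?f i)"
    by (simp only: e periodic_shift[OF q])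
  have "mesh * (q i \<bullet> velocity y i) = q i \<bullet> y (Suc i) - q i \<bullet> y i" for i
    using mesh_pos by (simp add: velocity_def inner_diff_right mult.assoc[symmetric])
  then have "(\<Sum>i<n. mesh * (q i \<bullet> velocity y i)) = (\<Sum>i<n. q i \<bullet> y (Suc i)) - (\<Sum>i<n. q i \<bullet> y i)"
    by (simp add: sum_subtractf)
  then show ?thesis unfolding s by (simp add: inner_diff_left sum_subtractf)
qed

lemma action_derivative:
  assumes x: "x \<in> periodic_seqs n" and y: "y \<in> periodic_seqs n"
  shows "((\<lambda>s. action (\<lambda>i. x i + s *\<^sub>R y i)) has_real_derivative
      period_inner n (action_grad (\<lambda>i. x i + s *\<^sub>R y i)) y) (at s)"
proof -
  let ?z = "\<lambda>s i. x i + s *\<^sub>R y i"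
  have vel: "velocity (?z s) i = velocity x i + s *\<^sub>R velocity y i" for s i
    by (simp add: velocity_def algebra_simps)
  have zP: "?z s \<in> periodic_seqs n" for s using x y by (simp add: periodic_seqs_def)
  have "((\<lambda>s. action (?z s)) has_real_derivative
      (\<Sum>i<n. mesh * ((y i \<bullet> Fx (\<tau> i) (?z s i) (velocity (?z s) i) + velocity y i \<bullet> momentum (?z s) i)
        + y i \<bullet> Vx (\<tau> i) (?z s i)))) (at s)"
    unfolding action_def momentum_def vel
    by (intro DERIV_sum DERIV_cmult DERIV_add F_line_derivative V_line_derivative \<tau>_time)
  moreover have "(\<Sum>i<n. mesh * ((y i \<bullet> Fx (\<tau> i) (?z s i) (velocity (?z s) i) + velocity y i \<bullet> momentum (?z s) i)
        + y i \<bullet> Vx (\<tau> i) (?z s i))) =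
      (\<Sum>i<n. mesh * (force (?z s) i \<bullet> y i)) + (\<Sum>i<n. mesh * (momentum (?z s) i \<bullet> velocity y i))"
    unfolding sum.distrib[symmetric] force_def
    by (intro sum.cong refl) (simp add: inner_add_left inner_commute algebra_simps)
  moreover have "\<dots> = period_inner n (action_grad (?z s)) y"
    unfolding sum_velocity_by_parts[OF momentum_periodic[OF zP] y] period_inner_def action_grad_def
    by (simp add: inner_diff_left sum_subtractf)
  ultimately show ?thesis by simp
qed

lemma velocity_continuous: "continuous_on S (\<lambda>x. velocity x i)"
  unfolding velocity_def by (intro continuous_intros continuous_on_subset[OF continuous_on_product_coordinates subset_UNIV])

lemma coordinate_continuous: "continuous_on S (\<lambda>x::nat \<Rightarrow> 'b. x i)"
  by (rule continuous_on_subset[OF continuous_on_product_coordinates subset_UNIV])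

sublocale periodic_functional n action action_grad
proof
  show "0 < n" by (rule n_pos)
  fix x y :: "nat \<Rightarrow> 'b" and i s
  assume x: "x \<in> periodic_seqs n"
  show "action_grad x \<in> periodic_seqs n" by (rule action_grad_periodic[OF x])
  assume y: "y \<in> periodic_seqs n"
  show "((\<lambda>s. action (\<lambda>i. x i + s *\<^sub>R y i)) has_real_derivative
      period_inner n (action_grad (\<lambda>i. x i + s *\<^sub>R y i)) y) (at s)"
    by (rule action_derivative[OF x y])
next
  note c = continuous_along[OF \<tau>_time coordinate_continuous velocity_continuous]
  show "continuous_on (periodic_seqs n) action"
    unfolding action_def by (intro continuous_on_sum continuous_on_mult_left continuous_on_add c)
  show "continuous_on (periodic_seqs n) (\<lambda>x. action_grad x i)" for i
    unfolding action_grad_def force_def momentum_def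
    by (intro continuous_on_diff continuous_on_scaleR continuous_on_const continuous_on_add c)
qed

end

section \<open>Mountain pass geometry of the discretized action\<close>

lemma powr_dominates_linear:
  fixes c p :: real
  assumes "c > 0" "p > 1"
  obtains K where "\<And>r. r \<ge> 0 \<Longrightarrow> c * r powr p - r \<ge> r - K"
proof -
  define r1 where "r1 = (2 / c) powr (1 / (p - 1))"
  have r1: "r1 > 0" "r1 powr (p - 1) = 2 / c" using assms by (auto simp: r1_def powr_powr)
  show thesis
  proof (rule that[of "2 * r1"])
    fix r :: real assume r: "r \<ge> 0"
    show "c * r powr p - r \<ge> r - 2 * r1"
    proof (cases "r \<ge> r1")
      case True
      have "r1 powr (p - 1) \<le> r powr (p - 1)" using True r1 assms by (intro powr_mono2) auto
      then have "2 \<le> c * r powr (p - 1)" using r1 assms by (simp add: field_simps)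
      then have "2 * r \<le> c * r powr (p - 1) * r" using r by (intro mult_right_mono)
      also have "\<dots> = c * r powr p" using True r1 powr_mult_base[of r "p - 1"] by (simp add: mult.commute)
      finally show ?thesis using r1 by linarith
    next
      case False
      have "c * r powr p \<ge> 0" using assms by simp
      then show ?thesis using False by linarith
    qed
  qed
qed

text \<open>
  The variational argument sees the potential only through \<open>V\<close>: in the Ambrosetti-Rabinowitz condition \<open>V_AR\<close> the term
  \<open>\<epsilon> K\<close> is replaced by its lower bound \<open>\<epsilon> |x|\<^sup>p\<close>. The vector \<open>e0\<close> is a constant curve of small energy along which the
  potential is uniformly negative.
\<close>

locale mountain_pass_lagrangian = lagrangian T F Fx Fv V Vx
  for T :: real and F :: "real \<Rightarrow> 'b::euclidean_space \<Rightarrow> 'b \<Rightarrow> real"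
    and Fx Fv :: "real \<Rightarrow> 'b \<Rightarrow> 'b \<Rightarrow> 'b" and V :: "real \<Rightarrow> 'b \<Rightarrow> real" and Vx :: "real \<Rightarrow> 'b \<Rightarrow> 'b" +
  fixes G :: "'b \<Rightarrow> real" and a \<beta> g :: "real \<Rightarrow> real" and \<theta>F \<Lambda> M \<epsilon> \<theta>V p \<rho> b \<eta> :: real and e0 :: 'b
  assumes period: "2 * T \<ge> 1"
    and G_nonneg: "G x \<ge> 0" and G_convex: "convex_on UNIV G" and G_even: "G (- x) = G x" and G_zero: "G 0 = 0"
    and G_superlinear: "filterlim (\<lambda>x. G x / norm x) at_top at_infinity"
    and a_continuous: "continuous_on {0..} a"
    and \<beta>_nonneg: "t \<in> {-T..T} \<Longrightarrow> \<beta> t \<ge> 0"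
    and Fx_bound: "t \<in> {-T..T} \<Longrightarrow> norm (Fx t x v) \<le> a (norm x) * (\<beta> t + G v)"
    and F_AR: "t \<in> {-T..T} \<Longrightarrow> Fx t x v \<bullet> x + Fv t x v \<bullet> v \<le> \<theta>F * F t x v"
    and \<theta>: "0 < \<theta>F" "\<theta>F < \<theta>V" and \<Lambda>: "\<Lambda> > 0"
    and F_coercive: "t \<in> {-T..T} \<Longrightarrow> F t x v \<ge> \<Lambda> * G v"
    and F_zero: "t \<in> {-T..T} \<Longrightarrow> F t x 0 = 0" and Fv_zero: "t \<in> {-T..T} \<Longrightarrow> Fv t x 0 = 0"
    and \<epsilon>: "\<epsilon> > 0" and p: "p > 1"
    and V_AR: "t \<in> {-T..T} \<Longrightarrow> norm x > M \<Longrightarrow> Vx t x \<bullet> x \<le> \<theta>V * V t x - \<epsilon> * norm x powr p"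
    and V_negative: "t \<in> {-T..T} \<Longrightarrow> norm x > M \<Longrightarrow> V t x < 0"
    and \<rho>: "\<rho> > 0" and b: "b > 0"
    and V_well: "t \<in> {-T..T} \<Longrightarrow> G (x /\<^sub>R (2 * (2 * T))) \<le> \<rho> / 2 \<Longrightarrow> V t x \<ge> b * G x - g t"
    and V_zero: "t \<in> {-T..T} \<Longrightarrow> V t 0 = 0"
    and \<eta>: "\<eta> > 0" and e0: "2 * T * G e0 < \<rho>" "t \<in> {-T..T} \<Longrightarrow> V t e0 \<le> - \<eta>"
begin

lemma G_linear_minorant:
  obtains K where "\<And>w. G w \<ge> A * norm w - K"
proof -
  have "eventually (\<lambda>w. G w / norm w \<ge> A) at_infinity"
    using G_superlinear unfolding filterlim_at_top by blast
  then obtain r where r: "\<And>w. norm w \<ge> r \<Longrightarrow> G w / norm w \<ge> A" unfolding eventually_at_infinity by blast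
  have "G w \<ge> A * norm w - \<bar>A\<bar> * \<bar>r\<bar>" for w
  proof (cases "norm w \<ge> r \<and> w \<noteq> 0")
    case True
    then have "A * norm w \<le> G w" using r[of w] by (simp add: field_simps)
    then show ?thesis by (smt (verit) abs_ge_zero mult_nonneg_nonneg)
  next
    case False
    have "A * norm w \<le> \<bar>A\<bar> * norm w" by (intro mult_right_mono) auto
    also have "\<dots> \<le> \<bar>A\<bar> * \<bar>r\<bar>" using False by (intro mult_left_mono) auto
    finally show ?thesis using G_nonneg[of w] by linarith
  qed
  then show thesis by (rule that)
qed

lemma G_continuous: "continuous_on UNIV G"
  by (rule convex_on_continuous[OF open_UNIV G_convex])

lemma G_scale: "0 \<le> c \<Longrightarrow> c \<le> 1 \<Longrightarrow> G (c *\<^sub>R x) \<le> c * G x"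
  using convex_onD[OF G_convex, of c 0 x] G_zero by simp

text \<open>
  On the compact set \<open>norm x \<le> M\<close> all terms are bounded, at the price of the constant.
\<close>

lemma V_AR_global:
  obtains C0 where "C0 \<ge> 0" "\<And>t x. t \<in> time \<Longrightarrow> Vx t x \<bullet> x \<le> \<theta>V * V t x - \<epsilon> * norm x powr p + C0"
proof -
  define m where "m = max M 0"
  obtain B where B: "B \<ge> 0" "common_bound m 0 B" by (rule bounded_on_compact)
  let ?C = "B * m + \<theta>V * B + \<epsilon> * m powr p"
  have C: "?C \<ge> 0" using B(1) \<theta> \<epsilon> by (simp add: m_def)
  have "Vx t x \<bullet> x \<le> \<theta>V * V t x - \<epsilon> * norm x powr p + ?C" if t: "t \<in> time" for t x
  proof (cases "norm x > M")
    case True then show ?thesis using V_AR[OF t True] C by linarith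
  next
    case False
    then have x: "norm x \<le> m" by (simp add: m_def)
    have Bx: "\<bar>V t x\<bar> \<le> B" "norm (Vx t x) \<le> B" using common_boundD[OF B(2) t x, of 0] by auto
    have "Vx t x \<bullet> x \<le> norm (Vx t x) * norm x" by (rule norm_cauchy_schwarz)
    also have "\<dots> \<le> B * m" using Bx x B(1) by (intro mult_mono) auto
    finally have 1: "Vx t x \<bullet> x \<le> B * m" .
    have "\<theta>V * (- B) \<le> \<theta>V * V t x" using Bx(1) \<theta> by (intro mult_left_mono) (auto simp: abs_le_iff)
    moreover have "\<epsilon> * norm x powr p \<le> \<epsilon> * m powr p" using x \<epsilon> p by (intro mult_left_mono powr_mono2) auto
    ultimately show ?thesis using 1 by simp
  qed
  then show thesis using C that by blast
qed

end

locale mountain_pass_discretization =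
  mountain_pass_lagrangian T F Fx Fv V Vx G a \<beta> g \<theta>F \<Lambda> M \<epsilon> \<theta>V p \<rho> b \<eta> e0 + discretization T F Fx Fv V Vx n \<tau>
  for T :: real and F :: "real \<Rightarrow> 'b::euclidean_space \<Rightarrow> 'b \<Rightarrow> real"
    and Fx Fv :: "real \<Rightarrow> 'b \<Rightarrow> 'b \<Rightarrow> 'b" and V :: "real \<Rightarrow> 'b \<Rightarrow> real" and Vx :: "real \<Rightarrow> 'b \<Rightarrow> 'b"
    and G :: "'b \<Rightarrow> real" and a \<beta> g :: "real \<Rightarrow> real" and \<theta>F \<Lambda> M \<epsilon> \<theta>V p \<rho> b \<eta> :: real and e0 :: 'b
    and n :: nat and \<tau> :: "nat \<Rightarrow> real"
begin

lemma sum_mesh: "(\<Sum>i<n. mesh * c) = 2 * T * c"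
  using n_mesh by (simp add: mult.assoc[symmetric])

text \<open>
  The classical combination \<open>\<theta>V J x - J' x x\<close>: the kinetic part leaves \<open>(\<theta>V - \<theta>F) F\<close>, which is coercive in
  the velocity, and the potential part leaves \<open>\<epsilon> |x|\<^sup>p\<close>.
\<close>

lemma AR_inequality:
  assumes C0: "\<And>t x. t \<in> time \<Longrightarrow> Vx t x \<bullet> x \<le> \<theta>V * V t x - \<epsilon> * norm x powr p + C0"
    and x: "x \<in> periodic_seqs n"
  shows "(\<theta>V - \<theta>F) * \<Lambda> * (\<Sum>i<n. mesh * G (velocity x i)) + \<epsilon> * (\<Sum>i<n. mesh * norm (x i) powr p)
    \<le> \<theta>V * action x + 2 * T * C0 - period_inner n (action_grad x) x"
proof -
  have "period_inner n (action_grad x) x = (\<Sum>i<n. mesh * (force x i \<bullet> x i)) + (\<Sum>i<n. mesh * (momentum x i \<bullet> velocity x i))"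
    unfolding sum_velocity_by_parts[OF momentum_periodic[OF x] x] period_inner_def action_grad_def
    by (simp add: inner_diff_left sum_subtractf)
  also have "\<dots> = (\<Sum>i<n. mesh * (force x i \<bullet> x i + momentum x i \<bullet> velocity x i))"
    by (simp add: sum.distrib distrib_left)
  also have "\<dots> \<le> (\<Sum>i<n. mesh * (\<theta>V * (F (\<tau> i) (x i) (velocity x i) + V (\<tau> i) (x i)) + C0
      - (\<theta>V - \<theta>F) * \<Lambda> * G (velocity x i) - \<epsilon> * norm (x i) powr p))"
  proof (intro sum_mono mult_left_mono)
    fix i
    have "(\<theta>V - \<theta>F) * (\<Lambda> * G (velocity x i)) \<le> (\<theta>V - \<theta>F) * F (\<tau> i) (x i) (velocity x i)"
      using \<theta> by (intro mult_left_mono F_coercive \<tau>_time) auto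
    then show "force x i \<bullet> x i + momentum x i \<bullet> velocity x i \<le> \<theta>V * (F (\<tau> i) (x i) (velocity x i) + V (\<tau> i) (x i)) + C0
      - (\<theta>V - \<theta>F) * \<Lambda> * G (velocity x i) - \<epsilon> * norm (x i) powr p"
      using F_AR[OF \<tau>_time, of i "x i" "velocity x i"] C0[OF \<tau>_time, of i "x i"]
      unfolding force_def momentum_def inner_add_left by (simp add: algebra_simps)
  qed (use mesh_pos in auto)
  also have "\<dots> = \<theta>V * action x + (\<Sum>i<n. mesh * C0) - (\<theta>V - \<theta>F) * \<Lambda> * (\<Sum>i<n. mesh * G (velocity x i))
      - \<epsilon> * (\<Sum>i<n. mesh * norm (x i) powr p)"
    unfolding action_def sum_distrib_left sum.distrib[symmetric] sum_subtractf[symmetric]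
    by (intro sum.cong refl) (simp add: algebra_simps)
  finally show ?thesis unfolding sum_mesh by linarith
qed

text \<open>
  When the gradient is at most 1, the right-hand side of the preceding inequality grows at most
  linearly in \<open>x\<close>, whereas the left-hand side grows like the power \<open>p > 1\<close>.
\<close>

lemma Palais_Smale_bounded:
  obtains R where "\<And>x i. x \<in> periodic_seqs n \<Longrightarrow> action x \<le> C \<Longrightarrow> period_inner n (action_grad x) (action_grad x) \<le> 1
      \<Longrightarrow> norm (x i) \<le> R"
proof -
  obtain C0 where C0: "C0 \<ge> 0" "\<And>t x. t \<in> time \<Longrightarrow> Vx t x \<bullet> x \<le> \<theta>V * V t x - \<epsilon> * norm x powr p + C0"
    by (rule V_AR_global) blast
  obtain K where K: "\<And>r. r \<ge> 0 \<Longrightarrow> \<epsilon> * mesh * r powr p - r \<ge> r - K"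
    using powr_dominates_linear[of "\<epsilon> * mesh" p] \<epsilon> mesh_pos p by auto
  show thesis
  proof (rule that[of "\<theta>V * C + 2 * T * C0 + real n * K"])
    fix x :: "nat \<Rightarrow> 'b" and j
    assume x: "x \<in> periodic_seqs n" and C: "action x \<le> C" and g: "period_inner n (action_grad x) (action_grad x) \<le> 1"
    have "norm (action_grad x i) \<le> 1" for i
      by (rule power2_le_imp_le[of _ 1]) (use order_trans[OF grad_bound[OF x, of i] g] in auto)
    then have "- (action_grad x i \<bullet> x i) \<le> norm (x i)" for i
      using norm_cauchy_schwarz[of "- action_grad x i" "x i"] mult_right_mono[of "norm (action_grad x i)" 1 "norm (x i)"]
      by (simp add: order_trans)
    then have ip: "- period_inner n (action_grad x) x \<le> (\<Sum>i<n. norm (x i))"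
      unfolding period_inner_def sum_negf[symmetric] by (intro sum_mono)
    have "0 \<le> (\<theta>V - \<theta>F) * \<Lambda> * (\<Sum>i<n. mesh * G (velocity x i))"
      using \<theta> \<Lambda> mesh_pos G_nonneg by (intro mult_nonneg_nonneg sum_nonneg) auto
    moreover have "\<theta>V * action x \<le> \<theta>V * C" using C \<theta> by (intro mult_left_mono) auto
    ultimately have "\<epsilon> * (\<Sum>i<n. mesh * norm (x i) powr p) - (\<Sum>i<n. norm (x i)) \<le> \<theta>V * C + 2 * T * C0"
      using AR_inequality[OF C0(2) x] ip by linarith
    moreover have "(\<Sum>i<n. norm (x i) - K) \<le> (\<Sum>i<n. \<epsilon> * mesh * norm (x i) powr p - norm (x i))"
      by (intro sum_mono K norm_ge_zero)
    moreover have "(\<Sum>i<n. \<epsilon> * mesh * norm (x i) powr p - norm (x i)) = \<epsilon> * (\<Sum>i<n. mesh * norm (x i) powr p) - (\<Sum>i<n. norm (x i))"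
      by (simp add: sum_subtractf sum_distrib_left mult.assoc)
    ultimately have "(\<Sum>i<n. norm (x i)) \<le> \<theta>V * C + 2 * T * C0 + real n * K" by (simp add: sum_subtractf)
    moreover have "norm (x (j mod n)) \<le> (\<Sum>i<n. norm (x i))"
      using n_pos by (intro member_le_sum) auto
    ultimately show "norm (x j) \<le> \<theta>V * C + 2 * T * C0 + real n * K"
      unfolding periodic_seqs_mod[OF x] by linarith
  qed
qed

definition "energy x = (\<Sum>i<n. mesh * (G (x i) + G (velocity x i)))" for x :: "nat \<Rightarrow> 'b"

lemma energy_continuous: "continuous_on S energy"
  unfolding energy_def
  by (intro continuous_on_sum continuous_on_mult_left continuous_on_add
      continuous_on_compose2[OF G_continuous coordinate_continuous] continuous_on_compose2[OF G_continuous velocity_continuous]) auto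

lemma constant_seq: "(\<lambda>_. z) \<in> periodic_seqs n" "velocity (\<lambda>_. z) = (\<lambda>_. 0)"
  by (auto simp: periodic_seqs_def velocity_def)

lemma energy_constant: "energy (\<lambda>_. z) = 2 * T * G z"
  unfolding energy_def constant_seq G_zero add_0_right by (rule sum_mesh)

lemma action_constant: "action (\<lambda>_. z) = (\<Sum>i<n. mesh * V (\<tau> i) z)"
  unfolding action_def constant_seq using F_zero[OF \<tau>_time] by simp

lemma telescope_velocity: "j \<le> i \<Longrightarrow> x i - x j = (\<Sum>k=j..<i. mesh *\<^sub>R velocity x k)"
proof (induction i rule: dec_induct)
  case (step i)
  then show ?case using step_velocity[of x i] by (simp add: algebra_simps)
qed simp

text \<open>
  Write \<open>x i / 4T\<close> as the midpoint of \<open>x j / 2T\<close> and \<open>(x i - x j) / 2T\<close>. The second point is a combination of the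
  velocities with weights \<open>1/n\<close>, some of them replaced by zero, so that \<open>G\<close> of it is at most the mean of the
  \<open>G (v k)\<close>. Averaging over \<open>j\<close> gives the claim; \<open>2T \<ge> 1\<close> enters through \<open>G (x j / 2T) \<le> G (x j)\<close> and in the
  last step.
\<close>

lemma energy_controls_sup:
  assumes x: "x \<in> periodic_seqs n"
  shows "G (x i /\<^sub>R (2 * (2 * T))) \<le> energy x / 2"
proof -
  define D where "D = (\<Sum>k<n. (1 / real n) * G (velocity x k))"
  have mT: "mesh / (2 * T) = 1 / real n" using T_pos by (simp add: mesh_def)
  have diff: "G ((x i - x j) /\<^sub>R (2 * T)) \<le> D" if "j \<le> i" "i < n" for i j
  proof -
    let ?y = "\<lambda>k. if k \<in> {j..<i} then velocity x k else 0"
    have "(x i - x j) /\<^sub>R (2 * T) = (\<Sum>k=j..<i. (1 / real n) *\<^sub>R velocity x k)"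
      unfolding telescope_velocity[OF that(1)] scaleR_sum_right mT[symmetric] by (simp add: field_simps)
    also have "\<dots> = (\<Sum>k<n. (1 / real n) *\<^sub>R ?y k)"
      using that by (intro sum.mono_neutral_cong_left) auto
    finally have "G ((x i - x j) /\<^sub>R (2 * T)) = G (\<Sum>k<n. (1 / real n) *\<^sub>R ?y k)" by simp
    also have "\<dots> \<le> (\<Sum>k<n. (1 / real n) * G (?y k))"
      using n_pos by (intro convex_on_sum[OF _ _ G_convex]) auto
    also have "\<dots> \<le> D" unfolding D_def using G_nonneg G_zero by (intro sum_mono mult_left_mono) auto
    finally show ?thesis .
  qed
  have "G (x i /\<^sub>R (2 * (2 * T))) \<le> energy x / 2" if i: "i < n" for i
  proof -
    have each: "G (x i /\<^sub>R (2 * (2 * T))) \<le> (G (x j) + D) / 2" if j: "j < n" for j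
    proof -
      have "G ((x i - x j) /\<^sub>R (2 * T)) \<le> D"
      proof (cases "j \<le> i")
        case False
        have "(x i - x j) /\<^sub>R (2 * T) = - ((x j - x i) /\<^sub>R (2 * T))" by (simp add: algebra_simps)
        then show ?thesis using diff[of i j] False j G_even by simp
      qed (use diff i in auto)
      moreover have "G (x j /\<^sub>R (2 * T)) \<le> G (x j)"
      proof -
        have inv: "0 \<le> inverse (2 * T)" "inverse (2 * T) \<le> 1"
          using period T_pos by (simp, subst inverse_eq_divide, simp add: divide_le_eq)
        have "G (x j /\<^sub>R (2 * T)) \<le> inverse (2 * T) * G (x j)" by (rule G_scale[OF inv])
        also have "\<dots> \<le> 1 * G (x j)" by (rule mult_right_mono[OF inv(2) G_nonneg])
        finally show ?thesis by simp
      qed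
      moreover have "G (x i /\<^sub>R (2 * (2 * T))) \<le> 1/2 * G (x j /\<^sub>R (2 * T)) + 1/2 * G ((x i - x j) /\<^sub>R (2 * T))"
      proof -
        have "x i /\<^sub>R (2 * (2 * T)) = (1 - 1/2) *\<^sub>R (x j /\<^sub>R (2 * T)) + (1/2) *\<^sub>R ((x i - x j) /\<^sub>R (2 * T))"
          by (simp add: scaleR_diff_right)
        then show ?thesis using convex_onD[OF G_convex, of "1/2" "x j /\<^sub>R (2 * T)" "(x i - x j) /\<^sub>R (2 * T)"] by simp
      qed
      ultimately show ?thesis by simp
    qed
    have "(\<Sum>j<n. mesh * G (x i /\<^sub>R (2 * (2 * T)))) \<le> (\<Sum>j<n. mesh * ((G (x j) + D) / 2))"
      using each mesh_pos by (intro sum_mono mult_left_mono) auto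
    also have "\<dots> = ((\<Sum>j<n. mesh * G (x j)) + (\<Sum>j<n. mesh * D)) / 2"
      by (simp add: sum.distrib sum_divide_distrib[symmetric] distrib_left)
    also have "(\<Sum>j<n. mesh * D) = (\<Sum>k<n. mesh * G (velocity x k))"
      by (simp only: sum_mesh) (simp add: D_def sum_distrib_left mesh_def)
    also have "((\<Sum>j<n. mesh * G (x j)) + (\<Sum>k<n. mesh * G (velocity x k))) / 2 = energy x / 2"
      by (simp add: energy_def sum.distrib distrib_left)
    finally have "2 * T * G (x i /\<^sub>R (2 * (2 * T))) \<le> energy x / 2" unfolding sum_mesh .
    moreover have "1 * G (x i /\<^sub>R (2 * (2 * T))) \<le> 2 * T * G (x i /\<^sub>R (2 * (2 * T)))"
      using period G_nonneg by (intro mult_right_mono)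
    ultimately show ?thesis by simp
  qed
  from this[of "i mod n"] show ?thesis unfolding periodic_seqs_mod[OF x] using n_pos by simp
qed

text \<open>
  The energy bound places all values in the potential well, where \<open>V\<close> dominates \<open>b G - g\<close>; the kinetic part
  contributes \<open>\<Lambda> G\<close> of the velocities.
\<close>

lemma action_on_sphere:
  assumes x: "x \<in> periodic_seqs n" and e: "energy x = \<rho>"
    and \<kappa>: "(\<Sum>i<n. mesh * g (\<tau> i)) \<le> \<kappa>"
  shows "action x \<ge> min \<Lambda> b * \<rho> - \<kappa>"
proof -
  have "(\<Sum>i<n. mesh * (min \<Lambda> b * (G (x i) + G (velocity x i)) - g (\<tau> i))) \<le> action x"
    unfolding action_def
  proof (intro sum_mono mult_left_mono)
    fix i
    have "V (\<tau> i) (x i) \<ge> b * G (x i) - g (\<tau> i)"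
      using energy_controls_sup[OF x, of i] e by (intro V_well \<tau>_time) simp
    moreover have "F (\<tau> i) (x i) (velocity x i) \<ge> \<Lambda> * G (velocity x i)" by (intro F_coercive \<tau>_time)
    moreover have "min \<Lambda> b * G (x i) \<le> b * G (x i)" "min \<Lambda> b * G (velocity x i) \<le> \<Lambda> * G (velocity x i)"
      using G_nonneg by (auto intro!: mult_right_mono)
    ultimately show "min \<Lambda> b * (G (x i) + G (velocity x i)) - g (\<tau> i) \<le> F (\<tau> i) (x i) (velocity x i) + V (\<tau> i) (x i)"
      by (simp add: distrib_left)
  qed (use mesh_pos in auto)
  moreover have "(\<Sum>i<n. mesh * (min \<Lambda> b * (G (x i) + G (velocity x i)) - g (\<tau> i))) = min \<Lambda> b * energy x - (\<Sum>i<n. mesh * g (\<tau> i))"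
    unfolding energy_def sum_distrib_left sum_subtractf[symmetric] by (intro sum.cong refl) (simp add: algebra_simps)
  ultimately show ?thesis using e \<kappa> by simp
qed

text \<open>
  The constant \<open>e0\<close> lies inside the sphere \<open>energy = \<rho>\<close> at a negative level, the constant \<open>z\<close> outside it, also at
  a negative level. The segment of constants from 0 to \<open>z\<close> bounds the mountain pass level from above
  independently of the mesh, because the kinetic part vanishes on it.
\<close>

lemma two_critical_points:
  assumes \<kappa>: "(\<Sum>i<n. mesh * g (\<tau> i)) \<le> \<kappa>" "\<kappa> < min \<Lambda> b * \<rho>"
    and z: "norm z > M" "2 * T * G z > \<rho>"
    and C: "\<And>t s. t \<in> time \<Longrightarrow> s \<in> {0..1} \<Longrightarrow> V t (s *\<^sub>R z) \<le> C"
  shows "\<exists>x\<in>periodic_seqs n. action_grad x = (\<lambda>_. 0) \<and> action x \<le> - (2 * T * \<eta>)"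
    and "\<exists>x\<in>periodic_seqs n. action_grad x = (\<lambda>_. 0) \<and> (min \<Lambda> b * \<rho> - \<kappa>) / 2 \<le> action x \<and> action x \<le> 2 * T * C"
proof -
  let ?\<alpha> = "min \<Lambda> b * \<rho> - \<kappa>"
  have Je0: "action (\<lambda>_. e0) \<le> - (2 * T * \<eta>)"
  proof -
    have "action (\<lambda>_. e0) \<le> (\<Sum>i<n. mesh * (- \<eta>))"
      unfolding action_constant using mesh_pos e0(2)[OF \<tau>_time] by (intro sum_mono mult_left_mono) auto
    then show ?thesis unfolding sum_mesh by simp
  qed
  have "2 * T * \<eta> > 0" using T_pos \<eta> by simp
  obtain K where K: "\<And>w. G w \<ge> 1 * norm w - K" using G_linear_minorant[of 1] by blast
  have bounded: "norm (x i) \<le> \<rho> / mesh + K" if x: "x \<in> periodic_seqs n" and "energy x \<le> \<rho>" for x i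
  proof -
    have "mesh * G (x (i mod n)) \<le> mesh * (G (x (i mod n)) + G (velocity x (i mod n)))"
      using mesh_pos G_nonneg by simp
    also have "\<dots> \<le> energy x"
      unfolding energy_def using n_pos mesh_pos G_nonneg
      by (intro member_le_sum[where f="\<lambda>i. mesh * (G (x i) + G (velocity x i))"]) auto
    finally have "G (x i) \<le> \<rho> / mesh"
      using that(2) mesh_pos unfolding periodic_seqs_mod[OF x] by (simp add: field_simps)
    then show ?thesis using K[of "x i"] by linarith
  qed
  have "\<exists>x\<in>periodic_seqs n. action_grad x = (\<lambda>_. 0) \<and> action x \<le> action (\<lambda>_. e0) \<and> energy x < \<rho>"
  proof (rule constrained_minimum[OF energy_continuous constant_seq(1)])
    show "energy (\<lambda>_. e0) < \<rho>" using e0(1) by (simp add: energy_constant)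
    fix x :: "nat \<Rightarrow> 'b" assume "x \<in> periodic_seqs n" "energy x = \<rho>"
    then show "action (\<lambda>_. e0) < action x"
      using action_on_sphere[OF _ _ \<kappa>(1)] \<kappa>(2) Je0 \<open>2 * T * \<eta> > 0\<close> by fastforce
  qed (rule bounded)
  then show "\<exists>x\<in>periodic_seqs n. action_grad x = (\<lambda>_. 0) \<and> action x \<le> - (2 * T * \<eta>)"
    using Je0 by force
  have V0: "action (\<lambda>_. 0) = 0" unfolding action_constant using V_zero[OF \<tau>_time] by simp
  have Vz: "action (\<lambda>_. z) \<le> 0"
    unfolding action_constant using V_negative[OF \<tau>_time z(1)] mesh_pos
    by (intro sum_nonpos) (auto intro: mult_nonneg_nonpos less_imp_le)
  obtain R where R: "\<And>x i. x \<in> periodic_seqs n \<Longrightarrow> action x \<le> 2 * T * C \<Longrightarrow> period_inner n (action_grad x) (action_grad x) \<le> 1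
      \<Longrightarrow> norm (x i) \<le> R" by (rule Palais_Smale_bounded[of "2 * T * C"]) blast
  show "\<exists>x\<in>periodic_seqs n. action_grad x = (\<lambda>_. 0) \<and> ?\<alpha> / 2 \<le> action x \<and> action x \<le> 2 * T * C"
  proof (rule mountain_pass[of ?\<alpha> "\<lambda>_. 0" "\<lambda>_. z" "\<lambda>s _. s *\<^sub>R z" _ R])
    show "?\<alpha> > 0" using \<kappa>(2) by simp
    show "action (\<lambda>_. 0) \<le> 0" "action (\<lambda>_. z) \<le> 0" using V0 Vz by auto
    show "continuous_on {0..1} (\<lambda>(s::real) (_::nat). s *\<^sub>R z)"
      by (intro continuous_on_coordinatewise_then_product continuous_intros)
    show "(\<lambda>s _. s *\<^sub>R z) ` {0..1} \<subseteq> periodic_seqs n" using constant_seq(1) by auto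
    fix s :: real assume s: "s \<in> {0..1}"
    have "action (\<lambda>_. s *\<^sub>R z) \<le> (\<Sum>i<n. mesh * C)"
      unfolding action_constant using mesh_pos C[OF \<tau>_time s] by (intro sum_mono mult_left_mono) auto
    then show "action (\<lambda>_. s *\<^sub>R z) \<le> 2 * T * C" unfolding sum_mesh .
  next
    fix \<gamma> :: "real \<Rightarrow> nat \<Rightarrow> 'b"
    assume \<gamma>: "continuous_on {0..1} \<gamma>" "\<gamma> ` {0..1} \<subseteq> periodic_seqs n" "\<gamma> 0 = (\<lambda>_. 0)" "\<gamma> 1 = (\<lambda>_. z)"
    have "continuous_on {0..1} (\<lambda>s. energy (\<gamma> s))"
      by (rule continuous_on_compose2[OF energy_continuous[of UNIV] \<gamma>(1)]) auto
    moreover have "energy (\<gamma> 0) \<le> \<rho>" "\<rho> \<le> energy (\<gamma> 1)"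
      using z(2) \<rho> unfolding \<gamma>(3,4) energy_constant G_zero by auto
    ultimately obtain s where "0 \<le> s" "s \<le> 1" "energy (\<gamma> s) = \<rho>"
      using IVT'[of "\<lambda>s. energy (\<gamma> s)" 0 \<rho> 1] by auto
    then have "\<gamma> s \<in> periodic_seqs n" using \<gamma>(2) by (simp add: image_subset_iff)
    then have "?\<alpha> \<le> action (\<gamma> s)" using action_on_sphere[OF _ _ \<kappa>(1)] \<open>energy (\<gamma> s) = \<rho>\<close> by blast
    then show "\<exists>s\<in>{0..1}. ?\<alpha> \<le> action (\<gamma> s)" using \<open>0 \<le> s\<close> \<open>s \<le> 1\<close> by auto
  qed (use R in auto)
qed

end

section \<open>A priori bounds for discrete critical points\<close>

context mountain_pass_discretization
begin

lemma dist_le_total_variation: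
  assumes "i < n" "j < n"
  shows "norm (x i - x j) \<le> (\<Sum>k<n. mesh * norm (velocity x k))"
proof -
  have *: "norm (x i - x j) \<le> (\<Sum>k<n. mesh * norm (velocity x k))" if "j \<le> i" "i < n" for i j
  proof -
    have "norm (x i - x j) \<le> (\<Sum>k=j..<i. mesh * norm (velocity x k))"
      unfolding telescope_velocity[OF that(1)] using mesh_pos by (intro sum_norm_le) simp
    also have "\<dots> \<le> (\<Sum>k<n. mesh * norm (velocity x k))"
      using that mesh_pos by (intro sum_mono2) auto
    finally show ?thesis .
  qed
  show ?thesis using *[of j i] *[of i j] assms by (cases "j \<le> i") (auto simp: norm_minus_commute)
qed

text \<open>
  The gradient term in \<open>AR_inequality\<close> is zero. A bound for the weighted sum of \<open>norm (x i)\<close> and for the total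
  variation gives a bound for the supremum.
\<close>

lemma critical_sum_bounds:
  assumes x: "x \<in> periodic_seqs n" "action_grad x = (\<lambda>_. 0)" "action x \<le> C"
    and C0: "\<And>t x. t \<in> time \<Longrightarrow> Vx t x \<bullet> x \<le> \<theta>V * V t x - \<epsilon> * norm x powr p + C0"
    and K: "\<And>r. r \<ge> 0 \<Longrightarrow> \<epsilon> * r powr p - r \<ge> r - K"
    and K2: "\<And>w. G w \<ge> norm w - K2"
  defines "E \<equiv> (\<theta>V * C + 2 * T * C0) / ((\<theta>V - \<theta>F) * \<Lambda>)"
  shows "(\<Sum>i<n. mesh * G (velocity x i)) \<le> E"
    and "norm (x i) \<le> (\<theta>V * C + 2 * T * C0 + 2 * T * K) / (2 * T) + (E + 2 * T * K2)"
proof -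
  let ?D = "\<theta>V * C + 2 * T * C0"
  have "period_inner n (action_grad x) x = 0" unfolding x(2) by (simp add: period_inner_def)
  moreover have "\<theta>V * action x \<le> \<theta>V * C" using x(3) \<theta> by (intro mult_left_mono) auto
  ultimately have AR: "(\<theta>V - \<theta>F) * \<Lambda> * (\<Sum>i<n. mesh * G (velocity x i)) + \<epsilon> * (\<Sum>i<n. mesh * norm (x i) powr p) \<le> ?D"
    using AR_inequality[OF C0 x(1)] by linarith
  have c: "(\<theta>V - \<theta>F) * \<Lambda> > 0" using \<theta> \<Lambda> by simp
  have "\<epsilon> * (\<Sum>i<n. mesh * norm (x i) powr p) \<ge> 0"
    using \<epsilon> mesh_pos by (intro mult_nonneg_nonneg sum_nonneg) auto
  then have "(\<theta>V - \<theta>F) * \<Lambda> * (\<Sum>i<n. mesh * G (velocity x i)) \<le> ?D" using AR by linarith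
  then show E: "(\<Sum>i<n. mesh * G (velocity x i)) \<le> E"
    unfolding E_def using c by (simp add: pos_le_divide_eq mult.commute)
  have "(\<theta>V - \<theta>F) * \<Lambda> * (\<Sum>i<n. mesh * G (velocity x i)) \<ge> 0"
    using mesh_pos G_nonneg by (intro mult_nonneg_nonneg[OF less_imp_le[OF c]] sum_nonneg) auto
  then have "(\<Sum>i<n. mesh * (\<epsilon> * norm (x i) powr p)) \<le> ?D"
    using AR by (simp add: sum_distrib_left mult.left_commute)
  moreover have "(\<Sum>i<n. mesh * (norm (x i) - K)) \<le> (\<Sum>i<n. mesh * (\<epsilon> * norm (x i) powr p))"
  proof (intro sum_mono mult_left_mono)
    show "norm (x i) - K \<le> \<epsilon> * norm (x i) powr p" for i
      using K[OF norm_ge_zero, of "x i"] norm_ge_zero[of "x i"] by linarith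
  qed (use mesh_pos in auto)
  ultimately have sx: "(\<Sum>i<n. mesh * norm (x i)) \<le> ?D + 2 * T * K"
    unfolding right_diff_distrib sum_subtractf sum_mesh by linarith
  have "(\<Sum>k<n. mesh * norm (velocity x k)) \<le> (\<Sum>k<n. mesh * (G (velocity x k) + K2))"
    using mesh_pos K2 by (intro sum_mono mult_left_mono) (auto simp: diff_le_eq)
  also have "\<dots> \<le> E + 2 * T * K2" unfolding distrib_left sum.distrib sum_mesh using E by simp
  finally have tv: "(\<Sum>k<n. mesh * norm (velocity x k)) \<le> E + 2 * T * K2" .
  have "norm (x i) \<le> (?D + 2 * T * K) / (2 * T) + (E + 2 * T * K2)" if i: "i < n" for i
  proof -
    have "(\<Sum>j<n. mesh * norm (x i)) \<le> (\<Sum>j<n. mesh * (norm (x j) + (E + 2 * T * K2)))"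
    proof (intro sum_mono mult_left_mono)
      fix j assume "j \<in> {..<n}"
      then show "norm (x i) \<le> norm (x j) + (E + 2 * T * K2)"
        using dist_le_total_variation[OF i, of j x] tv norm_triangle_sub[of "x i" "x j"] by simp
    qed (use mesh_pos in auto)
    then have "2 * T * norm (x i) \<le> ?D + 2 * T * K + 2 * T * (E + 2 * T * K2)"
      unfolding distrib_left sum.distrib sum_mesh using sx by linarith
    then have "norm (x i) \<le> (?D + 2 * T * K + 2 * T * (E + 2 * T * K2)) / (2 * T)"
      using T_pos by (simp add: pos_le_divide_eq mult.commute)
    also have "\<dots> = (?D + 2 * T * K) / (2 * T) + (E + 2 * T * K2)"
      using T_pos by (simp add: add_divide_distrib)
    finally show ?thesis .
  qed
  from this[of "i mod n"] show "norm (x i) \<le> (?D + 2 * T * K) / (2 * T) + (E + 2 * T * K2)"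
    unfolding periodic_seqs_mod[OF x(1)] using n_pos by simp
qed

text \<open>
  The momenta have bounded total variation, since their increments are the forces, and one of them is bounded,
  since some \<open>G (velocity x j)\<close> does not exceed its mean; so all momenta are bounded by \<open>Pm\<close>. By convexity
  \<open>F \<le> momentum \<bullet> velocity\<close>, and \<open>F \<ge> \<Lambda> G\<close> with \<open>G\<close> superlinear then bounds each velocity.
\<close>

lemma critical_velocity_bound:
  assumes x: "x \<in> periodic_seqs n" "action_grad x = (\<lambda>_. 0)"
    and X: "\<And>i. norm (x i) \<le> X" and E: "(\<Sum>i<n. mesh * G (velocity x i)) \<le> E"
    and \<beta>: "(\<Sum>i<n. mesh * \<beta> (\<tau> i)) \<le> B\<beta>"
    and A: "\<And>r. 0 \<le> r \<Longrightarrow> r \<le> X \<Longrightarrow> a r \<le> A" "A \<ge> 0"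
    and K2: "\<And>w. G w \<ge> norm w - K2"
    and B: "\<And>t x v. t \<in> time \<Longrightarrow> norm x \<le> X \<Longrightarrow> norm v \<le> E / (2 * T) + K2 \<Longrightarrow> norm (Fv t x v) \<le> B \<and> norm (Vx t x) \<le> B"
    and Pm: "Pm = B + (A * (B\<beta> + E) + 2 * T * B)"
    and K3: "\<And>w. G w \<ge> (Pm / \<Lambda> + 1) * norm w - K3"
  shows "norm (velocity x i) \<le> K3"
proof -
  have "\<exists>j<n. 2 * T * G (velocity x j) \<le> E"
  proof (rule ccontr)
    assume "\<not> ?thesis"
    then have gt: "E < 2 * T * G (velocity x j)" if "j < n" for j using that by force
    have "(\<Sum>j<n. mesh * E) < (\<Sum>j<n. mesh * (2 * T * G (velocity x j)))"
      using n_pos by (intro sum_strict_mono mult_strict_left_mono gt mesh_pos) auto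
    also have "\<dots> = 2 * T * (\<Sum>j<n. mesh * G (velocity x j))" by (simp add: sum_distrib_left mult.left_commute)
    also have "\<dots> \<le> 2 * T * E" using E T_pos by (intro mult_left_mono) auto
    finally show False unfolding sum_mesh by simp
  qed
  then obtain j where j: "j < n" "2 * T * G (velocity x j) \<le> E" by blast
  have vj: "norm (velocity x j) \<le> E / (2 * T) + K2"
    using K2[of "velocity x j"] j(2) T_pos by (simp add: pos_le_divide_eq mult.commute)
       (smt (verit) pos_le_divide_eq mult.commute)
  have mj: "norm (momentum x j) \<le> B" unfolding momentum_def using B[OF \<tau>_time X vj] by blast
  have force: "norm (force x k) \<le> A * (\<beta> (\<tau> k) + G (velocity x k)) + B" for k
  proof -
    have "norm (force x k) \<le> norm (Fx (\<tau> k) (x k) (velocity x k)) + norm (Vx (\<tau> k) (x k))"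
      unfolding force_def by (rule norm_triangle_ineq)
    moreover have "norm (Fx (\<tau> k) (x k) (velocity x k)) \<le> A * (\<beta> (\<tau> k) + G (velocity x k))"
      by (rule order_trans[OF Fx_bound[OF \<tau>_time]])
        (use A X \<beta>_nonneg[OF \<tau>_time] G_nonneg in \<open>auto intro!: mult_right_mono add_nonneg_nonneg\<close>)
    moreover have "norm (Vx (\<tau> k) (x k)) \<le> B" using B[OF \<tau>_time X vj] by blast
    ultimately show ?thesis by linarith
  qed
  have total: "(\<Sum>k<n. mesh * norm (force x k)) \<le> A * (B\<beta> + E) + 2 * T * B"
  proof -
    have "(\<Sum>k<n. mesh * norm (force x k)) \<le> (\<Sum>k<n. mesh * (A * (\<beta> (\<tau> k) + G (velocity x k)) + B))"
      using force mesh_pos by (intro sum_mono mult_left_mono) auto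
    also have "\<dots> = A * ((\<Sum>k<n. mesh * \<beta> (\<tau> k)) + (\<Sum>k<n. mesh * G (velocity x k))) + (\<Sum>k<n. mesh * B)"
      unfolding sum.distrib[symmetric] sum_distrib_left by (intro sum.cong refl) (simp add: algebra_simps)
    also have "\<dots> \<le> A * (B\<beta> + E) + 2 * T * B"
      unfolding sum_mesh using \<beta> E A(2) by (intro add_right_mono mult_left_mono) auto
    finally show ?thesis .
  qed
  have step: "norm (momentum x k - momentum x l) \<le> A * (B\<beta> + E) + 2 * T * B" if "l \<le> k" "k < n" for k l
  proof -
    have "momentum x k - momentum x l = (\<Sum>i=l..<k. mesh *\<^sub>R force x (Suc i))"
      using that(1)
    proof (induction k rule: dec_induct)
      case (step k)
      then show ?case using critical_momentum_Suc[OF x(2,1), of k] by (simp add: algebra_simps)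
    qed simp
    then have "norm (momentum x k - momentum x l) \<le> (\<Sum>i=l..<k. mesh * norm (force x (Suc i)))"
      using mesh_pos by (metis (no_types, lifting) norm_scaleR abs_of_pos sum_norm_le order_refl)
    also have "\<dots> = (\<Sum>i=Suc l..<Suc k. mesh * norm (force x i))"
      by (rule sum.shift_bounds_Suc_ivl[symmetric])
    also have "\<dots> \<le> (\<Sum>i<n. mesh * norm (force x i))"
      using that mesh_pos by (intro sum_mono2) auto
    finally show ?thesis using total by linarith
  qed
  have mom: "norm (momentum x i) \<le> Pm" if "i < n" for i
  proof -
    have "norm (momentum x i - momentum x j) \<le> A * (B\<beta> + E) + 2 * T * B"
      using step[of i j] step[of j i] that j(1) by (cases "i \<le> j") (auto simp: norm_minus_commute)
    then show ?thesis using mj norm_triangle_sub[of "momentum x i" "momentum x j"] unfolding Pm by linarith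
  qed
  have "norm (velocity x i) \<le> K3" if i: "i < n" for i
  proof -
    let ?v = "velocity x i"
    have "F (\<tau> i) (x i) 0 \<ge> F (\<tau> i) (x i) ?v + momentum x i \<bullet> (0 - ?v)"
      unfolding momentum_def by (rule F_subgradient[OF \<tau>_time])
    then have "F (\<tau> i) (x i) ?v \<le> momentum x i \<bullet> ?v" using F_zero[OF \<tau>_time] by (simp add: inner_diff_right)
    also have "\<dots> \<le> norm (momentum x i) * norm ?v" by (rule norm_cauchy_schwarz)
    also have "\<dots> \<le> Pm * norm ?v" by (intro mult_right_mono mom i norm_ge_zero)
    finally have "\<Lambda> * G ?v \<le> Pm * norm ?v" using F_coercive[OF \<tau>_time, of ?v i "x i"] by linarith
    then have "G ?v \<le> Pm / \<Lambda> * norm ?v" using \<Lambda> by (simp add: field_simps)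
    then show ?thesis using K3[of ?v] by (simp add: distrib_right)
  qed
  from this[of "i mod n"] show ?thesis
    unfolding periodic_seqs_mod[OF velocity_periodic[OF x(1)]] using n_pos by simp
qed

end

context mountain_pass_lagrangian
begin

lemma mountain_pass_discretizationI:
  assumes "n > 0" "\<And>i. \<tau> i \<in> time" "\<tau> \<in> periodic_seqs n"
  shows "mountain_pass_discretization T F Fx Fv V Vx G a \<beta> g \<theta>F \<Lambda> M \<epsilon> \<theta>V p \<rho> b \<eta> e0 n \<tau>"
  using assms by unfold_locales auto

text \<open>
  The bounds depend on the mesh and on the sample times only through the weighted sum of \<open>\<beta> (\<tau> i)\<close>.
\<close>

theorem critical_points_uniformly_bounded:
  obtains X R where "\<And>n \<tau> x. n > 0 \<Longrightarrow> (\<And>i. \<tau> i \<in> time) \<Longrightarrow> \<tau> \<in> periodic_seqs n \<Longrightarrow>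
      (\<Sum>i<n. discretization.mesh T n * \<beta> (\<tau> i)) \<le> B\<beta> \<Longrightarrow> x \<in> periodic_seqs n \<Longrightarrow>
      discretization.action_grad T Fx Fv Vx n \<tau> x = (\<lambda>_. 0) \<Longrightarrow> discretization.action T F V n \<tau> x \<le> C \<Longrightarrow>
      (\<forall>i. norm (x i) \<le> X \<and> norm (discretization.velocity T n x i) \<le> R)"
proof -
  obtain C0 where C0: "C0 \<ge> 0" "\<And>t x. t \<in> time \<Longrightarrow> Vx t x \<bullet> x \<le> \<theta>V * V t x - \<epsilon> * norm x powr p + C0"
    by (rule V_AR_global) blast
  obtain K where K: "\<And>r. r \<ge> 0 \<Longrightarrow> \<epsilon> * r powr p - r \<ge> r - K"
    using powr_dominates_linear[OF \<epsilon> p] by blast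
  obtain K2 where K2: "\<And>w. G w \<ge> norm w - K2" using G_linear_minorant[of 1] by auto
  define E where "E = (\<theta>V * C + 2 * T * C0) / ((\<theta>V - \<theta>F) * \<Lambda>)"
  define X where "X = (\<theta>V * C + 2 * T * C0 + 2 * T * K) / (2 * T) + (E + 2 * T * K2)"
  obtain A where A: "A \<ge> 0" "\<And>r. 0 \<le> r \<Longrightarrow> r \<le> X \<Longrightarrow> a r \<le> A"
  proof -
    have "compact (a ` {0..X})"
      by (intro compact_continuous_image continuous_on_subset[OF a_continuous]) auto
    then obtain A where "\<forall>y\<in>a ` {0..X}. norm y \<le> A" using compact_imp_bounded bounded_iff by metis
    then show thesis by (intro that[of "max A 0"]) force+
  qed
  obtain B where B: "B \<ge> 0" "common_bound X (E / (2 * T) + K2) B" by (rule bounded_on_compact)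
  define Pm where "Pm = B + (A * (B\<beta> + E) + 2 * T * B)"
  obtain K3 where K3: "\<And>w. G w \<ge> (Pm / \<Lambda> + 1) * norm w - K3" using G_linear_minorant by blast
  show thesis
  proof (rule that[of X K3])
    fix n \<tau> and x :: "nat \<Rightarrow> 'b"
    assume n: "n > 0" "\<And>i. \<tau> i \<in> time" "\<tau> \<in> periodic_seqs n"
      and \<beta>: "(\<Sum>i<n. discretization.mesh T n * \<beta> (\<tau> i)) \<le> B\<beta>" and x: "x \<in> periodic_seqs n"
      "discretization.action_grad T Fx Fv Vx n \<tau> x = (\<lambda>_. 0)" "discretization.action T F V n \<tau> x \<le> C"
    interpret D: mountain_pass_discretization T F Fx Fv V Vx G a \<beta> g \<theta>F \<Lambda> M \<epsilon> \<theta>V p \<rho> b \<eta> e0 n \<tau>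
      by (rule mountain_pass_discretizationI[OF n])
    note bounds = D.critical_sum_bounds[OF x C0(2) K K2, folded E_def, folded X_def]
    have X: "norm (x i) \<le> X" for i by (rule bounds(2))
    show "\<forall>i. norm (x i) \<le> X \<and> norm (D.velocity x i) \<le> K3"
    proof (intro allI conjI X)
      show "norm (D.velocity x i) \<le> K3" for i
        by (rule D.critical_velocity_bound[OF x(1,2) X bounds(1) \<beta> A(2,1) K2 _ Pm_def K3]) (use common_boundD[OF B(2)] in blast)+
    qed
  qed
qed

end

section \<open>Gradients along faces of convex functions\<close>

text \<open>
  The defect \<open>h y = (\<Sum>i\<in>S. c i * f y (v i)) - f y (\<Sum>i\<in>S. c i *\<^sub>R v i)\<close> is nonnegative by Jensen's inequality. If it
  is at most \<open>\<epsilon>\<close> at \<open>u\<close> while its gradient there were longer than \<open>e\<close>, a step of length \<open>\<delta>\<close> against the gradient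
  would make it negative, where \<open>\<delta>\<close> comes from the uniform continuity of \<open>fx\<close>.
\<close>

lemma face_gradient:
  fixes f :: "'a::euclidean_space \<Rightarrow> 'b::euclidean_space \<Rightarrow> real" and fx :: "'a \<Rightarrow> 'b \<Rightarrow> 'a"
  assumes conv: "\<And>y. convex_on UNIV (f y)"
    and der: "\<And>y w. ((\<lambda>y. f y w) has_derivative (\<lambda>d. d \<bullet> fx y w)) (at y)"
    and cont: "continuous_on UNIV (\<lambda>(y, w). fx y w)"
    and e: "e > 0"
  obtains \<epsilon> where "\<epsilon> > 0"
    "\<And>(S :: nat set) c v. finite S \<Longrightarrow> (\<And>i. i \<in> S \<Longrightarrow> c i \<ge> 0) \<Longrightarrow> sum c S = 1 \<Longrightarrow> (\<And>i. i \<in> S \<Longrightarrow> norm (v i) \<le> R) \<Longrightarrow>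
       (\<Sum>i\<in>S. c i * f u (v i)) \<le> f u (\<Sum>i\<in>S. c i *\<^sub>R v i) + \<epsilon> \<Longrightarrow>
       norm ((\<Sum>i\<in>S. c i *\<^sub>R fx u (v i)) - fx u (\<Sum>i\<in>S. c i *\<^sub>R v i)) \<le> e"
proof -
  let ?K = "cball u 1 \<times> cball (0::'b) R"
  have "uniformly_continuous_on ?K (\<lambda>(y, w). fx y w)"
    by (rule compact_uniformly_continuous[OF continuous_on_subset[OF cont]]) (auto intro: compact_Times)
  then obtain d where d: "d > 0" and dd: "\<And>z z'. z \<in> ?K \<Longrightarrow> z' \<in> ?K \<Longrightarrow> dist z' z < d \<Longrightarrow>
      dist ((\<lambda>(y, w). fx y w) z') ((\<lambda>(y, w). fx y w) z) < e / 4"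
    unfolding uniformly_continuous_on_def using e by (metis zero_less_divide_iff zero_less_numeral)
  define \<delta> where "\<delta> = min 1 (d / 2)"
  have \<delta>: "\<delta> > 0" "\<delta> \<le> 1" "\<delta> < d" using d by (auto simp: \<delta>_def)
  have close: "norm (fx y w - fx u w) \<le> e / 4" if "norm (y - u) \<le> \<delta>" "norm w \<le> R" for y w
  proof -
    have "dist (fx y w) (fx u w) < e / 4"
      using dd[of "(u, w)" "(y, w)"] that \<delta> by (simp add: dist_Pair_Pair dist_norm norm_minus_commute)
    then show ?thesis by (simp add: dist_norm)
  qed
  show thesis
  proof (rule that[of "\<delta> * e / 2"])
    show "\<delta> * e / 2 > 0" using \<delta> e by simp
    fix S :: "nat set" and c :: "nat \<Rightarrow> real" and v :: "nat \<Rightarrow> 'b"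
    assume S: "finite S" "\<And>i. i \<in> S \<Longrightarrow> c i \<ge> 0" "sum c S = 1" "\<And>i. i \<in> S \<Longrightarrow> norm (v i) \<le> R"
    let ?v = "\<Sum>i\<in>S. c i *\<^sub>R v i"
    assume near: "(\<Sum>i\<in>S. c i * f u (v i)) \<le> f u ?v + \<delta> * e / 2"
    let ?D = "\<lambda>y. (\<Sum>i\<in>S. c i *\<^sub>R fx y (v i)) - fx y ?v"
    let ?h = "\<lambda>y. (\<Sum>i\<in>S. c i * f y (v i)) - f y ?v"
    have vR: "norm ?v \<le> R"
    proof -
      have "?v \<in> cball 0 R" using S by (intro convex_sum) auto
      then show ?thesis by simp
    qed
    have h0: "?h y \<ge> 0" for y
      using convex_on_sum[OF S(1) _ conv S(3), of v y] S by fastforce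
    have Dclose: "norm (?D y - ?D u) \<le> e / 2" if y: "norm (y - u) \<le> \<delta>" for y
    proof -
      have "norm (\<Sum>i\<in>S. c i *\<^sub>R (fx y (v i) - fx u (v i))) \<le> (\<Sum>i\<in>S. c i * (e / 4))"
      proof (rule sum_norm_le)
        fix i assume i: "i \<in> S"
        have "c i * norm (fx y (v i) - fx u (v i)) \<le> c i * (e / 4)"
          by (intro mult_left_mono close y S(2,4) i)
        then show "norm (c i *\<^sub>R (fx y (v i) - fx u (v i))) \<le> c i * (e / 4)" using S(2)[OF i] by simp
      qed
      also have "\<dots> = e / 4" by (simp only: sum_distrib_right[symmetric] S(3) mult_1)
      finally have 1: "norm (\<Sum>i\<in>S. c i *\<^sub>R (fx y (v i) - fx u (v i))) \<le> e / 4" .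
      have eq: "?D y - ?D u = (\<Sum>i\<in>S. c i *\<^sub>R (fx y (v i) - fx u (v i))) - (fx y ?v - fx u ?v)"
        by (simp add: scaleR_diff_right sum_subtractf)
      show ?thesis unfolding eq
        using 1 close[OF y vR] norm_triangle_ineq4[of "\<Sum>i\<in>S. c i *\<^sub>R (fx y (v i) - fx u (v i))" "fx y ?v - fx u ?v"]
        by linarith
    qed
    show "norm (?D u) \<le> e"
    proof (rule ccontr)
      assume "\<not> norm (?D u) \<le> e"
      then have De: "norm (?D u) > e" by simp
      \<comment> \<open>a step of length \<open>\<delta>\<close> in the direction of steepest descent of the defect\<close>
      define z where "z = - (\<delta> / norm (?D u)) *\<^sub>R ?D u"
      have D0: "norm (?D u) > 0" using De e by linarith
      have nz: "norm z = \<delta>" unfolding z_def norm_scaleR using D0 \<delta>(1) by simp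
      have uz: "z \<bullet> ?D u = - \<delta> * norm (?D u)"
        unfolding z_def inner_scaleR_left dot_square_norm power2_eq_square using D0 by simp
      have hder: "((\<lambda>s. ?h (u + s *\<^sub>R z)) has_real_derivative (z \<bullet> ?D (u + s *\<^sub>R z))) (at s)" for s
      proof -
        have l: "((\<lambda>s. u + s *\<^sub>R z) has_derivative (\<lambda>r. r *\<^sub>R z)) (at s)" by (auto intro!: derivative_eq_intros)
        have "((\<lambda>s. f (u + s *\<^sub>R z) w) has_derivative (*) (z \<bullet> fx (u + s *\<^sub>R z) w)) (at s)" for w
          using has_derivative_compose[OF l der[of w "u + s *\<^sub>R z"]] by (simp add: mult_commute_abs)
        then have 1: "((\<lambda>s. f (u + s *\<^sub>R z) w) has_real_derivative (z \<bullet> fx (u + s *\<^sub>R z) w)) (at s)" for w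
          unfolding has_field_derivative_def .
        have "((\<lambda>s. ?h (u + s *\<^sub>R z)) has_real_derivative
            ((\<Sum>i\<in>S. c i * (z \<bullet> fx (u + s *\<^sub>R z) (v i))) - z \<bullet> fx (u + s *\<^sub>R z) ?v)) (at s)"
          by (intro DERIV_diff DERIV_sum DERIV_cmult 1)
        then show ?thesis by (simp add: inner_diff_right inner_sum_right)
      qed
      have "\<exists>s. 0 < s \<and> s < 1 \<and> ?h (u + 1 *\<^sub>R z) - ?h (u + 0 *\<^sub>R z) = (1 - 0) * (z \<bullet> ?D (u + s *\<^sub>R z))"
        using hder by (intro MVT2) auto
      then obtain s where s: "0 < s" "s < 1" "?h (u + z) - ?h u = z \<bullet> ?D (u + s *\<^sub>R z)" by auto
      have "norm ((u + s *\<^sub>R z) - u) \<le> \<delta>" using s nz \<delta> by (simp add: mult_left_le_one_le)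
      from Dclose[OF this] have "norm z * norm (?D (u + s *\<^sub>R z) - ?D u) \<le> \<delta> * (e / 2)"
        using nz \<delta> by (intro mult_mono) auto
      then have "z \<bullet> (?D (u + s *\<^sub>R z) - ?D u) \<le> \<delta> * (e / 2)"
        using norm_cauchy_schwarz[of z "?D (u + s *\<^sub>R z) - ?D u"] by linarith
      then have "?h (u + z) - ?h u \<le> \<delta> * (e / 2) - \<delta> * norm (?D u)"
        using s(3) uz by (simp add: inner_diff_right)
      moreover have "\<delta> * norm (?D u) > \<delta> * e" using De \<delta> by simp
      ultimately show False using h0[of "u + z"] near by simp
    qed
  qed
qed

text \<open>
  The points \<open>v i\<close> almost minimize \<open>f u w - p \<bullet> w\<close>. By Jensen's inequality so does their mean, which tends to \<open>u'\<close>,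
  whence \<open>p = fv u'\<close>; and the means of \<open>f u (v i)\<close> are almost \<open>f u\<close> at the mean, which is the situation of
  \<open>face_gradient\<close>. Radius \<open>R + 1\<close> for the competitors leaves room around \<open>u'\<close>, which may have norm \<open>R\<close>.
\<close>

lemma gradient_pair_limit:
  fixes f :: "'a::euclidean_space \<Rightarrow> 'a \<Rightarrow> real" and fx :: "'a \<Rightarrow> 'a \<Rightarrow> 'a" and fv :: "'a \<Rightarrow> 'a"
  assumes conv: "\<And>y. convex_on UNIV (f y)"
    and der: "\<And>y w. ((\<lambda>y. f y w) has_derivative (\<lambda>d. d \<bullet> fx y w)) (at y)"
    and cont: "continuous_on UNIV (\<lambda>(y, w). fx y w)"
    and derv: "\<And>w. (f u has_derivative (\<lambda>d. d \<bullet> fv w)) (at w)"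
    and approx: "\<And>e. e > 0 \<Longrightarrow> \<exists>(S :: nat set) c v. finite S \<and> (\<forall>i\<in>S. c i \<ge> 0) \<and> sum c S = 1 \<and>
        (\<forall>i\<in>S. norm (v i) \<le> R) \<and> norm ((\<Sum>i\<in>S. c i *\<^sub>R v i) - u') \<le> e \<and>
        norm ((\<Sum>i\<in>S. c i *\<^sub>R fx u (v i)) - q') \<le> e \<and>
        (\<forall>i\<in>S. \<forall>w. norm w \<le> R + 1 \<longrightarrow> f u w + e \<ge> f u (v i) + p \<bullet> (w - v i))"
  shows "p = fv u'" "q' = fx u u'"
proof -
  define P where "P e S c v \<longleftrightarrow> finite S \<and> (\<forall>i\<in>S. c i \<ge> 0) \<and> sum c S = 1 \<and>
        (\<forall>i\<in>S. norm (v i) \<le> R) \<and> norm ((\<Sum>i\<in>S. c i *\<^sub>R v i) - u') \<le> e \<and>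
        norm ((\<Sum>i\<in>S. c i *\<^sub>R fx u (v i)) - q') \<le> e \<and>
        (\<forall>i\<in>S. \<forall>w. norm w \<le> R + 1 \<longrightarrow> f u w + e \<ge> f u (v i) + p \<bullet> (w - v i))"
    for e :: real and S :: "nat set" and c :: "nat \<Rightarrow> real" and v :: "nat \<Rightarrow> 'a"
  have "\<exists>S c v. P (1 / real (Suc k)) S c v" for k
    using approx[of "1 / real (Suc k)"] unfolding P_def by simp
  then obtain S c v where SP: "\<And>k. P (1 / real (Suc k)) (S k) (c k) (v k)" by metis
  define V where "V k = (\<Sum>i\<in>S k. c k i *\<^sub>R v k i)" for k
  define Q where "Q k = (\<Sum>i\<in>S k. c k i *\<^sub>R fx u (v k i))" for k
  have S: "finite (S k)" "\<And>i. i \<in> S k \<Longrightarrow> c k i \<ge> 0" "sum (c k) (S k) = 1" "\<And>i. i \<in> S k \<Longrightarrow> norm (v k i) \<le> R"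
    and Vu: "norm (V k - u') \<le> 1 / real (Suc k)" and Qq: "norm (Q k - q') \<le> 1 / real (Suc k)"
    and sub: "\<And>i w. i \<in> S k \<Longrightarrow> norm w \<le> R + 1 \<Longrightarrow> f u w + 1 / real (Suc k) \<ge> f u (v k i) + p \<bullet> (w - v k i)" for k
    using SP[of k] unfolding P_def V_def Q_def by blast+
  have VR: "norm (V k) \<le> R" for k
  proof -
    have "V k \<in> cball 0 R" unfolding V_def using S by (intro convex_sum) auto
    then show ?thesis by simp
  qed
  have avg: "(\<Sum>i\<in>S k. c k i * f u (v k i)) + p \<bullet> (w - V k) \<le> f u w + 1 / real (Suc k)" if w: "norm w \<le> R + 1" for w k
  proof -
    let ?e = "1 / real (Suc k)"
    have "(\<Sum>i\<in>S k. c k i * (f u (v k i) + p \<bullet> (w - v k i))) \<le> (\<Sum>i\<in>S k. c k i * (f u w + ?e))"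
      using S(2) sub w by (intro sum_mono mult_left_mono) auto
    also have "\<dots> = f u w + ?e" by (simp only: sum_distrib_right[symmetric] S(3) mult_1)
    also have "(\<Sum>i\<in>S k. c k i * (f u (v k i) + p \<bullet> (w - v k i))) =
        (\<Sum>i\<in>S k. c k i * f u (v k i)) + (\<Sum>i\<in>S k. c k i * (p \<bullet> w)) - (\<Sum>i\<in>S k. p \<bullet> (c k i *\<^sub>R v k i))"
      by (simp add: inner_diff_right algebra_simps sum.distrib sum_subtractf)
    also have "(\<Sum>i\<in>S k. c k i * (p \<bullet> w)) = p \<bullet> w" by (simp only: sum_distrib_right[symmetric] S(3) mult_1)
    also have "(\<Sum>i\<in>S k. p \<bullet> (c k i *\<^sub>R v k i)) = p \<bullet> V k" by (simp add: inner_sum_right V_def)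
    finally show ?thesis by (simp add: inner_diff_right)
  qed
  have jensen: "f u (V k) \<le> (\<Sum>i\<in>S k. c k i * f u (v k i))" for k
    unfolding V_def by (rule convex_on_sum[OF S(1) _ conv S(3)]) (use S(2) S(3)[of k] in auto)
  have VQ4: "f u w + 1 / real (Suc k) \<ge> f u (V k) + p \<bullet> (w - V k)" if "norm w \<le> R + 1" for w k
    using avg[OF that, of k] jensen[of k] by linarith
  have nearly: "(\<Sum>i\<in>S k. c k i * f u (v k i)) \<le> f u (V k) + 1 / real (Suc k)" for k
    using avg[of "V k" k] VR[of k] by simp
  have inv0: "(\<lambda>k. 1 / real (Suc k)) \<longlonglongrightarrow> 0" using LIMSEQ_inverse_real_of_nat by (simp add: inverse_eq_divide)
  have "(\<lambda>k. V k - u') \<longlonglongrightarrow> 0" by (rule Lim_null_comparison[OF _ inv0]) (use Vu in auto)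
  then have Vlim: "V \<longlonglongrightarrow> u'" by (rule Lim_null[THEN iffD2])
  have "(\<lambda>k. Q k - q') \<longlonglongrightarrow> 0" by (rule Lim_null_comparison[OF _ inv0]) (use Qq in auto)
  then have Qlim: "Q \<longlonglongrightarrow> q'" by (rule Lim_null[THEN iffD2])
  have u'R: "norm u' \<le> R" by (rule Lim_bounded[OF tendsto_norm[OF Vlim], of 0]) (use VR in auto)
  have fcont: "isCont (f u) w" for w using derv has_derivative_continuous by blast
  have fxcont: "isCont (fx u) w" for w
  proof -
    have "continuous_on UNIV (\<lambda>w. (\<lambda>(y, w). fx y w) (u, w))"
      by (rule continuous_on_compose2[OF cont]) (auto intro!: continuous_intros)
    then show ?thesis by (simp add: continuous_on_eq_continuous_at)
  qed
  have min: "f u w \<ge> f u u' + p \<bullet> (w - u')" if w: "norm w \<le> R + 1" for w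
  proof (rule LIMSEQ_le)
    show "(\<lambda>k. f u (V k) + p \<bullet> (w - V k)) \<longlonglongrightarrow> f u u' + p \<bullet> (w - u')"
      by (intro tendsto_intros Vlim isCont_tendsto_compose[OF fcont])
    have "(\<lambda>k. f u w + 1 / real (Suc k)) \<longlonglongrightarrow> f u w + 0" by (intro tendsto_intros inv0)
    then show "(\<lambda>k. f u w + 1 / real (Suc k)) \<longlonglongrightarrow> f u w" by simp
    show "\<exists>N. \<forall>k\<ge>N. f u (V k) + p \<bullet> (w - V k) \<le> f u w + 1 / real (Suc k)" using VQ4[OF w] by blast
  qed
  show "p = fv u'"
  proof -
    let ?g = "\<lambda>w. f u w - p \<bullet> (w - u')"
    have "(?g has_derivative (\<lambda>d. d \<bullet> fv u' - p \<bullet> d)) (at u')"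
      using derv[of u'] by (auto intro!: derivative_eq_intros)
    moreover have "\<forall>w\<in>ball u' 1. ?g u' \<le> ?g w"
    proof
      fix w assume "w \<in> ball u' 1"
      then have "norm w \<le> R + 1" using u'R norm_triangle_ineq2[of w u'] by (simp add: dist_norm norm_minus_commute)
      then show "?g u' \<le> ?g w" using min[of w] by simp
    qed
    ultimately have "(\<lambda>d. d \<bullet> fv u' - p \<bullet> d) = (\<lambda>d. 0)"
      using differential_zero_maxmin[of u' "ball u' 1" ?g] by auto
    then have "(fv u' - p) \<bullet> fv u' - p \<bullet> (fv u' - p) = 0" by (rule fun_cong)
    then have "(fv u' - p) \<bullet> (fv u' - p) = 0" by (simp add: inner_diff_left inner_diff_right inner_commute)
    then show ?thesis by simp
  qed
  have "norm (q' - fx u u') \<le> e" if e: "e > 0" for e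
  proof -
    obtain \<epsilon> where \<epsilon>: "\<epsilon> > 0" "\<And>(S :: nat set) c v. finite S \<Longrightarrow> (\<And>i. i \<in> S \<Longrightarrow> c i \<ge> 0) \<Longrightarrow> sum c S = 1 \<Longrightarrow> (\<And>i. i \<in> S \<Longrightarrow> norm (v i) \<le> R) \<Longrightarrow>
       (\<Sum>i\<in>S. c i * f u (v i)) \<le> f u (\<Sum>i\<in>S. c i *\<^sub>R v i) + \<epsilon> \<Longrightarrow>
       norm ((\<Sum>i\<in>S. c i *\<^sub>R fx u (v i)) - fx u (\<Sum>i\<in>S. c i *\<^sub>R v i)) \<le> e"
      by (rule face_gradient[OF conv der cont e, of R u]) blast
    obtain k0 where k0: "1 / real (Suc k0) < \<epsilon>" using nat_approx_posE[OF \<epsilon>(1)] by blast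
    have "norm (Q k - fx u (V k)) \<le> e" if "k \<ge> k0" for k
    proof -
      have "1 / real (Suc k) \<le> 1 / real (Suc k0)" using that by (intro divide_left_mono) auto
      then have "(\<Sum>i\<in>S k. c k i * f u (v k i)) \<le> f u (V k) + \<epsilon>" using k0 nearly[of k] by linarith
      then show ?thesis unfolding V_def Q_def by (intro \<epsilon>(2) S)
    qed
    then show ?thesis
      by (intro Lim_bounded[of "\<lambda>k. norm (Q k - fx u (V k))" _ k0] tendsto_norm tendsto_diff Qlim
          isCont_tendsto_compose[OF fxcont] Vlim) auto
  qed
  then have "norm (q' - fx u u') \<le> 0" by (rule field_le_epsilon[of _ 0, simplified])
  then show "q' = fx u u'" by simp
qed

section \<open>Limits of discrete extremals\<close>

definition ramp :: "real \<Rightarrow> real \<Rightarrow> real" where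
  "ramp h s = max 0 (min h s)"

lemma ramp_mono: "s \<le> s' \<Longrightarrow> ramp h s \<le> ramp h s'"
  by (auto simp: ramp_def)

lemma sum_ramp:
  assumes "h \<ge> 0"
  shows "(\<Sum>i<n. ramp h (s - real i * h)) = ramp (real n * h) s"
proof (induction n)
  case (Suc n)
  have "real n * h \<ge> 0" using assms by simp
  moreover have "real (Suc n) * h = real n * h + h" by (simp add: algebra_simps)
  ultimately have "ramp (real n * h) s + ramp h (s - real n * h) = ramp (real (Suc n) * h) s"
    using assms unfolding ramp_def by linarith
  then show ?case using Suc by simp
qed (simp add: ramp_def)

lemma ramp_increment_pos:
  assumes "ramp h (s' - a) - ramp h (s - a) > 0"
  shows "a < s'" "s < a + h"
  using assms by (auto simp: ramp_def max_def min_def split: if_splits)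

text \<open>
  The polygon with slope \<open>v i\<close> on the cell \<open>[i h, (i+1) h]\<close>, constant outside \<open>[0, n h]\<close>; a ramp is the time
  spent in a cell.
\<close>

definition polygon :: "nat \<Rightarrow> real \<Rightarrow> 'b::real_normed_vector \<Rightarrow> (nat \<Rightarrow> 'b) \<Rightarrow> real \<Rightarrow> 'b" where
  "polygon n h y v s = y + (\<Sum>i<n. ramp h (s - real i * h) *\<^sub>R v i)"

text \<open>
  The increments of the ramps are nonnegative weights that sum to the length of the time step and that vanish for
  cells away from it. So difference quotients of a polygon are convex combinations of nearby slopes.
\<close>

lemma polygon_diff:
  "polygon n h y v s' - polygon n h y v s = (\<Sum>i<n. (ramp h (s' - real i * h) - ramp h (s - real i * h)) *\<^sub>R v i)"
  by (simp add: polygon_def scaleR_diff_left sum_subtractf)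

lemma polygon_Lipschitz:
  assumes h: "h \<ge> 0" and v: "\<And>i. i < n \<Longrightarrow> norm (v i) \<le> R" and R: "R \<ge> 0"
  shows "norm (polygon n h y v s' - polygon n h y v s) \<le> R * \<bar>s' - s\<bar>"
proof -
  have *: "norm (polygon n h y v s' - polygon n h y v s) \<le> R * (s' - s)" if "s \<le> s'" for s s'
  proof -
    let ?w = "\<lambda>i. ramp h (s' - real i * h) - ramp h (s - real i * h)"
    have w: "?w i \<ge> 0" for i using ramp_mono[of "s - real i * h" "s' - real i * h" h] that by simp
    have "norm (polygon n h y v s' - polygon n h y v s) \<le> (\<Sum>i<n. ?w i * R)"
      unfolding polygon_diff
    proof (rule sum_norm_le)
      fix i assume "i \<in> {..<n}"
      then show "norm (?w i *\<^sub>R v i) \<le> ?w i * R" using w[of i] v[of i] by (simp add: mult_left_mono)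
    qed
    also have "\<dots> = (ramp (real n * h) s' - ramp (real n * h) s) * R"
      unfolding sum_distrib_right[symmetric] sum_subtractf sum_ramp[OF h] ..
    also have "\<dots> \<le> (s' - s) * R"
      using that R by (intro mult_right_mono) (auto simp: ramp_def max_def min_def)
    finally show ?thesis by (simp add: mult.commute)
  qed
  show ?thesis using *[of s s'] *[of s' s] by (cases "s \<le> s'") (auto simp: norm_minus_commute)
qed

lemma polygon_node:
  assumes h: "h \<ge> 0" and "k \<le> n"
  shows "polygon n h y v (real k * h) = y + (\<Sum>i<k. h *\<^sub>R v i)"
proof -
  have "ramp h (real k * h - real i * h) = (if i < k then h else 0)" for i
  proof (cases "i < k")
    case True
    then have "1 * h \<le> (real k - real i) * h" using h by (intro mult_right_mono) auto
    then show ?thesis using True h by (simp add: ramp_def left_diff_distrib)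
  next
    case False
    then have "real k * h \<le> real i * h" using h by (intro mult_right_mono) auto
    then show ?thesis using False h by (simp add: ramp_def)
  qed
  then have "(\<Sum>i<n. ramp h (real k * h - real i * h) *\<^sub>R v i) = (\<Sum>i<n. if i < k then h *\<^sub>R v i else 0)"
    by (intro sum.cong refl) simp
  also have "\<dots> = (\<Sum>i\<in>{..<n} \<inter> {i. i < k}. h *\<^sub>R v i)" by (simp add: sum.inter_restrict)
  also have "{..<n} \<inter> {i. i < k} = {..<k}" using assms by auto
  finally show ?thesis by (simp add: polygon_def)
qed

lemma polygon_interpolates:
  assumes "h \<ge> 0" "k \<le> n" "\<And>i. i < n \<Longrightarrow> x (Suc i) = x i + h *\<^sub>R v i"
  shows "polygon n h (x 0) v (real k * h) = x k"
proof -
  have "x 0 + (\<Sum>i<k. h *\<^sub>R v i) = x k" using \<open>k \<le> n\<close> by (induction k) (auto simp: assms(3) add.assoc[symmetric])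
  then show ?thesis using polygon_node assms by metis
qed

lemma right_difference_quotient:
  fixes y :: "real \<Rightarrow> 'b::real_normed_vector"
  assumes dy: "(y has_vector_derivative y') (at t)" and e: "e > 0"
  shows "\<exists>s0>0. \<forall>s. 0 < s \<and> s < s0 \<longrightarrow> norm ((y (t + s) - y t) /\<^sub>R s - y') \<le> e"
proof -
  obtain \<delta> where \<delta>: "\<delta> > 0" "\<And>z. norm (z - t) < \<delta> \<Longrightarrow> norm (y z - y t - (z - t) *\<^sub>R y') \<le> e * norm (z - t)"
    using dy e unfolding has_vector_derivative_def has_derivative_at_alt by blast
  have "norm ((y (t + s) - y t) /\<^sub>R s - y') \<le> e" if "0 < s" "s < \<delta>" for s
  proof -
    have "(y (t + s) - y t) /\<^sub>R s - y' = (1 / s) *\<^sub>R (y (t + s) - y t - s *\<^sub>R y')"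
      using that by (simp add: scaleR_diff_right inverse_eq_divide)
    moreover have "norm (y (t + s) - y t - s *\<^sub>R y') \<le> e * s" using \<delta>(2)[of "t + s"] that by simp
    ultimately show ?thesis using that by (simp add: divide_le_eq)
  qed
  then show ?thesis using \<delta>(1) by blast
qed

context lagrangian
begin

text \<open>
  \<open>P k (Suc i)\<close> is the momentum in cell \<open>i\<close>; with this shift of the index the polygon through the momenta has slope
  \<open>Fx + Vx\<close>, evaluated at cell \<open>i\<close>, in the same cell \<open>i\<close> in which the polygon through \<open>x\<close> has slope \<open>v k i\<close>. Both
  difference quotients are therefore averages with the same weights, as \<open>gradient_pair_limit\<close> requires.
\<close>

theorem limit_of_discrete_extremals:
  fixes N :: "nat \<Rightarrow> nat" and h :: "nat \<Rightarrow> real" and \<tau> :: "nat \<Rightarrow> nat \<Rightarrow> real" and x v P :: "nat \<Rightarrow> nat \<Rightarrow> 'b"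
  defines "h \<equiv> \<lambda>k. 2 * T / real (N k)"
  assumes N: "\<And>k. N k > 0" "filterlim N at_top sequentially"
    and cell: "\<And>k i. i < N k \<Longrightarrow> real i * h k - T \<le> \<tau> k i \<and> \<tau> k i \<le> real (Suc i) * h k - T"
    and step: "\<And>k i. i < N k \<Longrightarrow> x k (Suc i) = x k i + h k *\<^sub>R v k i"
    and periodic: "\<And>k. x k (N k) = x k 0"
    and momentum: "\<And>k i. i < N k \<Longrightarrow> P k (Suc i) = Fv (\<tau> k i) (x k i) (v k i)"
    and extremal: "\<And>k i. i < N k \<Longrightarrow>
       P k (Suc i) = P k i + h k *\<^sub>R (Fx (\<tau> k i) (x k i) (v k i) + Vx (\<tau> k i) (x k i))"
    and X: "\<And>k i. i \<le> N k \<Longrightarrow> norm (x k i) \<le> X" and R: "\<And>k i. i < N k \<Longrightarrow> norm (v k i) \<le> R"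
  shows "\<exists>r u p L. strict_mono (r :: nat \<Rightarrow> nat) \<and> u (-T) = u T \<and>
    (\<forall>s t. norm (u t - u s) \<le> L * \<bar>t - s\<bar>) \<and> (\<forall>s t. norm (p t - p s) \<le> L * \<bar>t - s\<bar>) \<and>
    (\<forall>e>0. \<exists>K. \<forall>k\<ge>K. \<forall>i\<le>N (r k). norm (x (r k) i - u (real i * h (r k) - T)) < e) \<and>
    (\<forall>t u' p'. -T < t \<and> t < T \<and> (u has_vector_derivative u') (at t) \<and> (p has_vector_derivative p') (at t) \<longrightarrow>
       p t = Fv t (u t) u' \<and> p' = Fx t (u t) u' + Vx t (u t))"
proof -
  have h_pos: "h k > 0" for k using T_pos N(1) by (simp add: h_def)
  have NH: "real (N k) * h k = 2 * T" for k using N(1)[of k] by (simp add: h_def)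
  have h_le: "h k \<le> 2 * T" for k using N(1)[of k] T_pos by (simp add: h_def divide_le_eq)
  have h_lim: "h \<longlonglongrightarrow> 0"
    unfolding h_def by (intro real_tendsto_divide_at_top[OF tendsto_const]
        filterlim_compose[OF filterlim_real_sequentially N(2)])
  have R0: "R \<ge> 0" using R[of 0 0] N(1)[of 0] norm_ge_zero order_trans by blast
  have \<tau>I: "\<tau> k i \<in> time" if "i < N k" for k i
  proof -
    have "real (Suc i) * h k \<le> real (N k) * h k" using that h_pos[of k] by (intro mult_right_mono) auto
    moreover have "0 \<le> real i * h k" using h_pos[of k] by simp
    ultimately show ?thesis using cell[OF that] NH[of k] by auto
  qed
  define q where "q k i = Fx (\<tau> k i) (x k i) (v k i) + Vx (\<tau> k i) (x k i)" for k i
  obtain B where B: "B \<ge> 0" "common_bound X R B" by (rule bounded_on_compact)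
  have q: "norm (q k i) \<le> 2 * B" if "i < N k" for k i
    using common_boundD[OF B(2) \<tau>I[OF that] X[OF less_imp_le[OF that]] R[OF that]] norm_triangle_ineq[of "Fx (\<tau> k i) (x k i) (v k i)" "Vx (\<tau> k i) (x k i)"]
    unfolding q_def by linarith
  have Psuc: "norm (P k (Suc i)) \<le> B" if "i < N k" for k i
    unfolding momentum[OF that] using common_boundD[OF B(2) \<tau>I[OF that] X[OF less_imp_le[OF that]] R[OF that]] by blast
  have P0: "norm (P k 0) \<le> B + 2 * T * (2 * B)" for k
  proof -
    have "P k 0 = P k (Suc 0) - h k *\<^sub>R q k 0" using extremal[of 0 k] N(1) by (simp add: q_def)
    then have "norm (P k 0) \<le> norm (P k (Suc 0)) + h k * norm (q k 0)"
      using norm_triangle_ineq4[of "P k (Suc 0)" "h k *\<^sub>R q k 0"] h_pos[of k] by simp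
    moreover have "h k * norm (q k 0) \<le> 2 * T * (2 * B)"
      using h_le[of k] q[of 0 k] N(1) T_pos by (intro mult_mono) auto
    ultimately show ?thesis using Psuc[of 0 k] N(1) by force
  qed
  define U where "U k t = polygon (N k) (h k) (x k 0) (v k) (t + T)" for k t
  define Q where "Q k t = polygon (N k) (h k) (P k 0) (q k) (t + T)" for k t
  define L where "L = max R (2 * B)"
  have L: "L \<ge> 0" "R \<le> L" "2 * B \<le> L" using R0 by (auto simp: L_def)
  have U_lip: "norm (U k t - U k s) \<le> L * \<bar>t - s\<bar>" for k s t
    using polygon_Lipschitz[of "h k" "N k" "v k" L "x k 0" "t + T" "s + T"] h_pos[of k] R[of _ k] L
    by (force simp: U_def)
  have Q_lip: "norm (Q k t - Q k s) \<le> L * \<bar>t - s\<bar>" for k s t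
    using polygon_Lipschitz[of "h k" "N k" "q k" L "P k 0" "t + T" "s + T"] h_pos[of k] q[of _ k] L
    by (force simp: Q_def)
  have U_node: "U k (real i * h k - T) = x k i" if "i \<le> N k" for k i
    using polygon_interpolates[of "h k" i "N k" "x k" "v k"] that step h_pos[of k] by (simp add: U_def)
  have Q_node: "Q k (real i * h k - T) = P k i" if "i \<le> N k" for k i
    using polygon_interpolates[of "h k" i "N k" "P k" "q k"] that extremal h_pos[of k] by (simp add: Q_def q_def)
  have U_bd: "norm (U k t) \<le> X + L * (2 * T)" if "t \<in> time" for k t
  proof -
    have "norm (U k t - U k (-T)) \<le> L * (2 * T)"
      by (rule order_trans[OF U_lip]) (use that L in \<open>auto intro!: mult_left_mono\<close>)
    moreover have "U k (-T) = x k 0" using U_node[of 0 k] by simp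
    ultimately show ?thesis using norm_triangle_sub[of "U k t" "x k 0"] X[of 0 k] by simp
  qed
  have Q_bd: "norm (Q k t) \<le> (B + 2 * T * (2 * B)) + L * (2 * T)" if "t \<in> time" for k t
  proof -
    have "norm (Q k t - Q k (-T)) \<le> L * (2 * T)"
      by (rule order_trans[OF Q_lip]) (use that L in \<open>auto intro!: mult_left_mono\<close>)
    moreover have "Q k (-T) = P k 0" using Q_node[of 0 k] by simp
    ultimately show ?thesis using norm_triangle_sub[of "Q k t" "P k 0"] P0[of k] by simp
  qed
  obtain g r where gr: "continuous_on time g" "strict_mono (r :: nat \<Rightarrow> nat)"
    "\<And>e. 0 < e \<Longrightarrow> \<exists>K. \<forall>k t. k \<ge> K \<and> t \<in> time \<longrightarrow> norm ((U (r k) t, Q (r k) t) - g t) < e"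
  proof (rule Arzela_Ascoli[of time "\<lambda>k t. (U k t, Q k t)" "(X + L * (2 * T)) + ((B + 2 * T * (2 * B)) + L * (2 * T))"])
    fix k t assume "t \<in> time"
    then show "norm (U k t, Q k t) \<le> (X + L * (2 * T)) + ((B + 2 * T * (2 * B)) + L * (2 * T))"
      using norm_Pair_le[of "U k t" "Q k t"] U_bd[of t k] Q_bd[of t k] by linarith
  next
    fix t e :: real assume "0 < e"
    show "\<exists>d>0. \<forall>k s. s \<in> time \<and> norm (t - s) < d \<longrightarrow> norm ((U k t, Q k t) - (U k s, Q k s)) < e"
    proof (intro exI[of _ "e / (2 * L + 1)"] conjI allI impI)
      show "e / (2 * L + 1) > 0" using \<open>0 < e\<close> L by simp
      fix k s assume "s \<in> time \<and> norm (t - s) < e / (2 * L + 1)"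
      then have "\<bar>t - s\<bar> * (2 * L + 1) < e" using L by (simp add: field_simps)
      moreover have "norm ((U k t, Q k t) - (U k s, Q k s)) \<le> norm (U k t - U k s) + norm (Q k t - Q k s)"
        using norm_Pair_le by simp
      moreover have "\<dots> \<le> \<bar>t - s\<bar> * (2 * L)" using U_lip[of k t s] Q_lip[of k t s] by (simp add: algebra_simps)
      moreover have "\<bar>t - s\<bar> * (2 * L) \<le> \<bar>t - s\<bar> * (2 * L + 1)" by (intro mult_left_mono) auto
      ultimately show "norm ((U k t, Q k t) - (U k s, Q k s)) < e" by linarith
    qed
  qed auto
  define c where "c t = max (-T) (min T t)" for t
  have cI: "c t \<in> time" for t using T_pos by (auto simp: c_def)
  have c_id: "c t = t" if "t \<in> time" for t using that by (auto simp: c_def)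
  have c_lip: "\<bar>c t - c s\<bar> \<le> \<bar>t - s\<bar>" for s t by (auto simp: c_def)
  define u p where "u t = fst (g (c t))" and "p t = snd (g (c t))" for t
  have conv: "\<exists>K. \<forall>k\<ge>K. \<forall>t\<in>time. norm (U (r k) t - u t) < e \<and> norm (Q (r k) t - p t) < e" if pos: "e > 0" for e
  proof -
    obtain K where K: "\<And>k t. k \<ge> K \<Longrightarrow> t \<in> time \<Longrightarrow> norm ((U (r k) t, Q (r k) t) - g t) < e"
      using gr(3)[OF pos] by blast
    have "norm (U (r k) t - u t) < e \<and> norm (Q (r k) t - p t) < e" if "k \<ge> K" "t \<in> time" for k t
      using K[OF that] norm_fst_le[of "U (r k) t - fst (g t)" "Q (r k) t - snd (g t)"] norm_snd_le[of "Q (r k) t - snd (g t)" "U (r k) t - fst (g t)"]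
      unfolding u_def p_def c_id[OF that(2)] by (cases "g t") simp
    then show ?thesis by blast
  qed
  have U_lim: "(\<lambda>k. U (r k) t) \<longlonglongrightarrow> u t" if "t \<in> time" for t
    unfolding LIMSEQ_iff using conv that by blast
  have Q_lim: "(\<lambda>k. Q (r k) t) \<longlonglongrightarrow> p t" if "t \<in> time" for t
    unfolding LIMSEQ_iff using conv that by blast
  have u_c: "u (c t) = u t" "p (c t) = p t" for t unfolding u_def p_def c_id[OF cI] by (rule refl)+
  have u_lip: "norm (u t - u s) \<le> L * \<bar>t - s\<bar>" and p_lip: "norm (p t - p s) \<le> L * \<bar>t - s\<bar>" for s t
  proof -
    have Lc: "L * \<bar>c t - c s\<bar> \<le> L * \<bar>t - s\<bar>" using c_lip L by (intro mult_left_mono)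
    have "norm (u (c t) - u (c s)) \<le> L * \<bar>c t - c s\<bar>"
      by (rule Lim_bounded[OF tendsto_norm[OF tendsto_diff[OF U_lim[OF cI] U_lim[OF cI]]], of 0]) (use U_lip in auto)
    then show "norm (u t - u s) \<le> L * \<bar>t - s\<bar>" using Lc unfolding u_c by linarith
    have "norm (p (c t) - p (c s)) \<le> L * \<bar>c t - c s\<bar>"
      by (rule Lim_bounded[OF tendsto_norm[OF tendsto_diff[OF Q_lim[OF cI] Q_lim[OF cI]]], of 0]) (use Q_lip in auto)
    then show "norm (p t - p s) \<le> L * \<bar>t - s\<bar>" using Lc unfolding u_c by linarith
  qed
  have u_per: "u (-T) = u T"
  proof -
    have "U (r k) (-T) = U (r k) T" for k
      using U_node[of 0 "r k"] U_node[of "N (r k)" "r k"] periodic NH[of "r k"] by simp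
    then have "(\<lambda>k. U (r k) (-T)) \<longlonglongrightarrow> u T" using U_lim[of T] T_pos by simp
    then show ?thesis using U_lim[of "-T"] T_pos LIMSEQ_unique by force
  qed
  have nodes: "\<exists>K. \<forall>k\<ge>K. \<forall>i\<le>N (r k). norm (x (r k) i - u (real i * h (r k) - T)) < e" if pos: "e > 0" for e
  proof -
    obtain K where K: "\<And>k t. k \<ge> K \<Longrightarrow> t \<in> time \<Longrightarrow> norm (U (r k) t - u t) < e" using conv[OF pos] by blast
    have "norm (x (r k) i - u (real i * h (r k) - T)) < e" if "k \<ge> K" "i \<le> N (r k)" for k i
    proof -
      have "real i * h (r k) \<le> real (N (r k)) * h (r k)" using that(2) h_pos[of "r k"] by (intro mult_right_mono) auto
      moreover have "0 \<le> real i * h (r k)" using h_pos[of "r k"] by simp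
      ultimately have "real i * h (r k) - T \<in> time" using NH[of "r k"] by auto
      then show ?thesis using K[OF that(1), of "real i * h (r k) - T"] U_node[OF that(2)] by simp
    qed
    then show ?thesis by blast
  qed
  define X' where "X' = X + L * (2 * T)"
  have XX': "X \<le> X'" using L T_pos by (simp add: X'_def)
  have u_bd: "norm (u t) \<le> X'" if "t \<in> time" for t
    by (rule Lim_bounded[OF tendsto_norm[OF U_lim[OF that]], of 0]) (use U_bd that in \<open>auto simp: X'_def\<close>)
  have "p t = Fv t (u t) u' \<and> p' = Fx t (u t) u' + Vx t (u t)"
    if t: "-T < t" "t < T" and du: "(u has_vector_derivative u') (at t)" and dp: "(p has_vector_derivative p') (at t)" for t u' p'
  proof -
    have tI: "t \<in> time" using t by simp
    have "\<exists>(S :: nat set) c v. finite S \<and> (\<forall>i\<in>S. c i \<ge> 0) \<and> sum c S = 1 \<and>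
        (\<forall>i\<in>S. norm (v i) \<le> R) \<and> norm ((\<Sum>i\<in>S. c i *\<^sub>R v i) - u') \<le> e \<and>
        norm ((\<Sum>i\<in>S. c i *\<^sub>R Fx t (u t) (v i)) - (p' - Vx t (u t))) \<le> e \<and>
        (\<forall>i\<in>S. \<forall>w. norm w \<le> R + 1 \<longrightarrow> F t (u t) w + e \<ge> F t (u t) (v i) + p t \<bullet> (w - v i))" if e: "e > 0" for e
    proof -
      define e1 where "e1 = e / 4"
      have e1: "e1 > 0" "4 * e1 = e" using e by (auto simp: e1_def)
      obtain d where d: "d > 0" and dd: "common_modulus X' (R + 1) e1 d"
        by (rule uniformly_close[OF e1(1)])
      note quot = right_difference_quotient[OF _ e1(1)]
      obtain su where su: "su > 0" "\<And>s. 0 < s \<Longrightarrow> s < su \<Longrightarrow> norm ((u (t + s) - u t) /\<^sub>R s - u') \<le> e1" using quot[OF du] by blast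
      obtain sp where sp: "sp > 0" "\<And>s. 0 < s \<Longrightarrow> s < sp \<Longrightarrow> norm ((p (t + s) - p t) /\<^sub>R s - p') \<le> e1" using quot[OF dp] by blast
      \<comment> \<open>\<open>2 * R + 1\<close> bounds the distance of a competitor \<open>z\<close> from a slope \<open>v k i\<close>\<close>
      define e2 where "e2 = min d (e1 / (2 * R + 1))"
      have e2: "e2 > 0" "e2 \<le> d" using d e1 R0 by (auto simp: e2_def)
      have e2': "e2 * (2 * R + 1) \<le> e1"
      proof -
        have "e2 * (2 * R + 1) \<le> e1 / (2 * R + 1) * (2 * R + 1)"
          using R0 by (intro mult_right_mono) (auto simp: e2_def)
        then show ?thesis using R0 by simp
      qed
      define M where "M = 4 * (L + 1)"
      have M: "M > 0" "4 * L \<le> M" "4 \<le> M" using L by (auto simp: M_def)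
      \<comment> \<open>the time step is fixed before the index \<open>k\<close>, whose mesh must be finer than it\<close>
      define s where "s = min (min su sp) (min (T - t) (e2 / M)) / 2"
      have s: "0 < s" "s < su" "s < sp" "t + s < T" "M * s < e2"
      proof -
        have pos: "0 < min (min su sp) (min (T - t) (e2 / M))" using su sp t e2 M by simp
        then show "0 < s" by (simp add: s_def)
        have half: "a / 2 < a" if "0 < a" for a :: real using that by simp
        have "s < min (min su sp) (min (T - t) (e2 / M))" unfolding s_def by (rule half[OF pos])
        then have "s < su" "s < sp" "s < T - t" "s < e2 / M" by auto
        then show "s < su" "s < sp" "t + s < T" "M * s < e2" using M by (auto simp: field_simps)
      qed
      obtain K1 where K1: "\<And>k. k \<ge> K1 \<Longrightarrow> h (r k) < s"
      proof -
        have "(\<lambda>k. h (r k)) \<longlonglongrightarrow> 0" using LIMSEQ_subseq_LIMSEQ[OF h_lim gr(2)] by (simp add: o_def)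
        then have "eventually (\<lambda>k. h (r k) < s) sequentially" using s(1) by (rule order_tendstoD(2))
        then show thesis using that unfolding eventually_sequentially by blast
      qed
      have "min (e2 / 4) (e1 * s / 2) > 0" using e1 e2 s by simp
      from conv[OF this] obtain K2 where K2: "\<And>k t. k \<ge> K2 \<Longrightarrow> t \<in> time \<Longrightarrow>
          norm (U (r k) t - u t) < min (e2 / 4) (e1 * s / 2) \<and> norm (Q (r k) t - p t) < min (e2 / 4) (e1 * s / 2)" by blast
      define k where "k = r (max K1 K2)"
      have hk: "h k < s" using K1[of "max K1 K2"] by (simp add: k_def)
      have tsI: "t + s \<in> time" using t s by simp
      have near: "norm (U k y - u y) < e2 / 4" "norm (Q k y - p y) < e2 / 4"
          "norm (U k y - u y) < e1 * s / 2" "norm (Q k y - p y) < e1 * s / 2" if "y \<in> time" for y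
        using K2[of "max K1 K2" y] that by (auto simp: k_def)
      define w where "w i = ramp (h k) (t + s + T - real i * h k) - ramp (h k) (t + T - real i * h k)" for i
      have w0: "w i \<ge> 0" for i unfolding w_def using ramp_mono[of "t + T - real i * h k" "t + s + T - real i * h k" "h k"] s by simp
      have sum_w: "(\<Sum>i<N k. w i) = s"
        unfolding w_def sum_subtractf sum_ramp[OF less_imp_le[OF h_pos]] NH
        using t s by (simp add: ramp_def)
      define S where "S = {i. i < N k \<and> w i > 0}"
      have finS: "finite S" by (simp add: S_def)
      have sumS: "(\<Sum>i\<in>S. w i *\<^sub>R z i) = (\<Sum>i<N k. w i *\<^sub>R z i)" for z :: "nat \<Rightarrow> 'z::real_vector"
        using w0 by (intro sum.mono_neutral_left) (auto simp: S_def less_le)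
      have sumSr: "(\<Sum>i\<in>S. w i) = s" using sumS[of "\<lambda>_. 1::real"] sum_w by simp
      define c where "c i = w i / s" for i
      have c: "\<And>i. c i \<ge> 0" "sum c S = 1" using w0 s sumSr by (auto simp: c_def sum_divide_distrib[symmetric])
      have csum: "(\<Sum>i\<in>S. c i *\<^sub>R z i) = (\<Sum>i<N k. w i *\<^sub>R z i) /\<^sub>R s" for z :: "nat \<Rightarrow> 'b"
        unfolding sumS[symmetric] scaleR_sum_right c_def by (simp add: field_simps)
      have quotient_close: "norm ((Y (t + s) - Y t) /\<^sub>R s - y') \<le> 2 * e1"
        if "norm ((y (t + s) - y t) /\<^sub>R s - y') \<le> e1" "norm (Y (t + s) - y (t + s)) < e1 * s / 2" "norm (Y t - y t) < e1 * s / 2"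
        for Y y :: "real \<Rightarrow> 'b" and y'
      proof -
        have "norm ((Y (t + s) - y (t + s)) - (Y t - y t)) \<le> e1 * s"
          using norm_triangle_ineq4[of "Y (t + s) - y (t + s)" "Y t - y t"] that by linarith
        then have A: "norm (((Y (t + s) - y (t + s)) - (Y t - y t)) /\<^sub>R s) \<le> e1"
          unfolding norm_scaleR using s(1) by (simp add: inverse_eq_divide divide_le_eq)
        have eq: "(Y (t + s) - Y t) /\<^sub>R s - y' = ((Y (t + s) - y (t + s)) - (Y t - y t)) /\<^sub>R s + ((y (t + s) - y t) /\<^sub>R s - y')"
          by (simp add: algebra_simps)
        show ?thesis unfolding eq using that(1) A norm_triangle_ineq[of "((Y (t + s) - y (t + s)) - (Y t - y t)) /\<^sub>R s" "(y (t + s) - y t) /\<^sub>R s - y'"]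
          by linarith
      qed
      have v_avg: "(\<Sum>i\<in>S. c i *\<^sub>R v k i) = (U k (t + s) - U k t) /\<^sub>R s"
        unfolding csum U_def polygon_diff w_def ..
      have q_avg: "(\<Sum>i\<in>S. c i *\<^sub>R q k i) = (Q k (t + s) - Q k t) /\<^sub>R s"
        unfolding csum Q_def polygon_diff w_def ..
      have V: "norm ((\<Sum>i\<in>S. c i *\<^sub>R v k i) - u') \<le> 2 * e1"
        unfolding v_avg by (rule quotient_close[OF su(2)[OF s(1,2)] near(3)[OF tsI] near(3)[OF tI]])
      have Q': "norm ((\<Sum>i\<in>S. c i *\<^sub>R q k i) - p') \<le> 2 * e1"
        unfolding q_avg by (rule quotient_close[OF sp(2)[OF s(1,3)] near(4)[OF tsI] near(4)[OF tI]])
      have local: "i < N k \<and> \<bar>\<tau> k i - t\<bar> < d \<and> norm (x k i - u t) < d \<and> norm (P k (Suc i) - p t) \<le> e2" if "i \<in> S" for i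
      proof -
        have i: "i < N k" and wi: "w i > 0" using that by (auto simp: S_def)
        from ramp_increment_pos[OF wi[unfolded w_def]]
        have ti: "real i * h k < t + s + T" "t + T < real i * h k + h k" by auto
        have Si: "real (Suc i) * h k = real i * h k + h k" by (simp add: algebra_simps)
        have "\<bar>\<tau> k i - t\<bar> \<le> 2 * s" using cell[OF i] ti hk unfolding Si by (auto simp: abs_le_iff)
        moreover have "4 * s \<le> M * s" using M s by (intro mult_right_mono) auto
        ultimately have A: "\<bar>\<tau> k i - t\<bar> < d" using s e2 by linarith
        have "norm (x k i - U k t) \<le> L * \<bar>(real i * h k - T) - t\<bar>"
          using U_lip[of k "real i * h k - T" t] U_node[of i k] i by simp
        also have "\<dots> \<le> L * (2 * s)" using ti hk s L by (intro mult_left_mono) auto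
        also have "\<dots> \<le> M / 2 * s" using M s by (simp add: mult_right_mono)
        finally have "norm (x k i - U k t) \<le> e2 / 2" using s by simp
        then have B': "norm (x k i - u t) < d"
          using near(1)[OF tI] norm_triangle_ineq[of "x k i - U k t" "U k t - u t"] e2 by simp
        have "norm (P k (Suc i) - Q k t) \<le> L * \<bar>(real (Suc i) * h k - T) - t\<bar>"
          using Q_lip[of k "real (Suc i) * h k - T" t] Q_node[of "Suc i" k] i by simp
        also have "\<dots> \<le> L * (2 * s)" unfolding Si using ti hk s L by (intro mult_left_mono) auto
        also have "\<dots> \<le> M / 2 * s" using M s by (simp add: mult_right_mono)
        finally have "norm (P k (Suc i) - Q k t) \<le> e2 / 2" using s by simp
        then have "norm (P k (Suc i) - p t) \<le> e2"
          using near(2)[OF tI] norm_triangle_ineq[of "P k (Suc i) - Q k t" "Q k t - p t"] e2 by simp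
        then show ?thesis using i A B' by blast
      qed
      have close: "\<bar>F (\<tau> k i) (x k i) z - F t (u t) z\<bar> \<le> e1 \<and> norm (Fx (\<tau> k i) (x k i) z - Fx t (u t) z) \<le> e1
          \<and> norm (Vx (\<tau> k i) (x k i) - Vx t (u t)) \<le> e1" if "i \<in> S" "norm z \<le> R + 1" for i z
        using common_modulusD[OF dd, of "\<tau> k i" t "x k i" "u t" z] local[OF that(1)] \<tau>I[of i k] tI X[of i k] XX' u_bd[OF tI] that(2) by auto
      have sub: "F t (u t) z + e \<ge> F t (u t) (v k i) + p t \<bullet> (z - v k i)" if i: "i \<in> S" and z: "norm z \<le> R + 1" for i z
      proof -
        note li = local[OF i]
        have iN: "i < N k" using li by blast
        have vR: "norm (v k i) \<le> R + 1" using R[OF iN] by simp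
        have "F (\<tau> k i) (x k i) z \<ge> F (\<tau> k i) (x k i) (v k i) + P k (Suc i) \<bullet> (z - v k i)"
          unfolding momentum[OF iN] by (rule F_subgradient[OF \<tau>I[OF iN]])
        moreover have "(p t - P k (Suc i)) \<bullet> (z - v k i) \<le> e1"
        proof -
          have "(p t - P k (Suc i)) \<bullet> (z - v k i) \<le> norm (p t - P k (Suc i)) * norm (z - v k i)" by (rule norm_cauchy_schwarz)
          also have "\<dots> \<le> e2 * (2 * R + 1)"
          proof (rule mult_mono)
            show "norm (p t - P k (Suc i)) \<le> e2" using li by (simp add: norm_minus_commute)
            show "norm (z - v k i) \<le> 2 * R + 1" using norm_triangle_ineq4[of z "v k i"] z R[OF iN] by linarith
          qed (use e2 in auto)
          finally show ?thesis using e2' by linarith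
        qed
        ultimately show ?thesis using close[OF i z] close[OF i vR] e1 unfolding inner_diff_left by linarith
      qed
      have "norm ((\<Sum>i\<in>S. c i *\<^sub>R Fx t (u t) (v k i)) - (p' - Vx t (u t))) \<le> e"
      proof -
        have "norm (\<Sum>i\<in>S. c i *\<^sub>R (q k i - (Fx t (u t) (v k i) + Vx t (u t)))) \<le> (\<Sum>i\<in>S. c i * (2 * e1))"
        proof (rule sum_norm_le)
          fix i assume i: "i \<in> S"
          have vR: "norm (v k i) \<le> R + 1" using R[of i k] i by (simp add: S_def)
          have "norm (q k i - (Fx t (u t) (v k i) + Vx t (u t))) \<le> 2 * e1"
            using close[OF i vR] norm_triangle_ineq[of "Fx (\<tau> k i) (x k i) (v k i) - Fx t (u t) (v k i)" "Vx (\<tau> k i) (x k i) - Vx t (u t)"]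
            unfolding q_def by (simp add: algebra_simps)
          then show "norm (c i *\<^sub>R (q k i - (Fx t (u t) (v k i) + Vx t (u t)))) \<le> c i * (2 * e1)"
            using c(1)[of i] by (simp add: mult_left_mono)
        qed
        also have "\<dots> = 2 * e1" by (simp only: sum_distrib_right[symmetric] c(2) mult_1)
        finally have 1: "norm (\<Sum>i\<in>S. c i *\<^sub>R (q k i - (Fx t (u t) (v k i) + Vx t (u t)))) \<le> 2 * e1" .
        have "(\<Sum>i\<in>S. c i *\<^sub>R (q k i - (Fx t (u t) (v k i) + Vx t (u t)))) =
            (\<Sum>i\<in>S. c i *\<^sub>R q k i) - (\<Sum>i\<in>S. c i *\<^sub>R Fx t (u t) (v k i)) - (\<Sum>i\<in>S. c i) *\<^sub>R Vx t (u t)"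
          by (simp add: scaleR_diff_right scaleR_add_right sum_subtractf sum.distrib scaleR_sum_left)
        also have "\<dots> = (\<Sum>i\<in>S. c i *\<^sub>R q k i) - (\<Sum>i\<in>S. c i *\<^sub>R Fx t (u t) (v k i)) - Vx t (u t)"
          by (simp only: c(2) scaleR_one)
        finally have eq: "(\<Sum>i\<in>S. c i *\<^sub>R Fx t (u t) (v k i)) - (p' - Vx t (u t)) =
            ((\<Sum>i\<in>S. c i *\<^sub>R q k i) - p') - (\<Sum>i\<in>S. c i *\<^sub>R (q k i - (Fx t (u t) (v k i) + Vx t (u t))))"
          by simp
        show ?thesis unfolding eq
          using 1 Q' e1 norm_triangle_ineq4[of "(\<Sum>i\<in>S. c i *\<^sub>R q k i) - p'" "\<Sum>i\<in>S. c i *\<^sub>R (q k i - (Fx t (u t) (v k i) + Vx t (u t)))"]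
          by linarith
      qed
      moreover have "norm ((\<Sum>i\<in>S. c i *\<^sub>R v k i) - u') \<le> e" using V e1 by linarith
      moreover have "\<forall>i\<in>S. norm (v k i) \<le> R" using R by (auto simp: S_def)
      ultimately show ?thesis
        using finS c sub by (intro exI[of _ S] exI[of _ c] exI[of _ "v k"] conjI ballI allI impI) auto
    qed
    note approx = this
    have cont: "continuous_on UNIV (\<lambda>(y, w). Fx t y w)"
      unfolding case_prod_unfold by (rule continuous_along(2)[OF tI]) (auto intro!: continuous_intros)
    have "p t = Fv t (u t) u'"
      by (rule gradient_pair_limit(1)[OF F_convex[OF tI] F_derivative_x[OF tI] cont F_derivative_v[OF tI] approx])
    moreover have "p' - Vx t (u t) = Fx t (u t) u'"
      by (rule gradient_pair_limit(2)[OF F_convex[OF tI] F_derivative_x[OF tI] cont F_derivative_v[OF tI] approx])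
    ultimately show ?thesis by (simp add: diff_eq_eq)
  qed
  then show ?thesis using gr(2) u_per u_lip p_lip nodes by blast
qed

end

section \<open>Orlicz-Sobolev membership, gradients and sample times\<close>

lemma Lipschitz_imp_abs_continuous_on:
  assumes lip: "\<And>s t. norm (f t - f s) \<le> L * \<bar>t - s\<bar>"
  shows "abs_continuous_on S f"
  unfolding abs_continuous_on_def
proof (intro allI impI)
  fix e :: real assume e: "e > 0"
  have L: "L \<ge> 0" using order_trans[OF norm_ge_zero lip[of 1 0]] by simp
  show "\<exists>\<delta>>0. \<forall>d. d division_of \<Union>d \<and> \<Union>d \<subseteq> S \<and> (\<Sum>k\<in>d. Sup k - Inf k) < \<delta>
        \<longrightarrow> (\<Sum>k\<in>d. norm (f (Sup k) - f (Inf k))) < e"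
  proof (intro exI[of _ "e / (L + 1)"] conjI allI impI)
    show "0 < e / (L + 1)" using e L by simp
    fix d assume d: "d division_of \<Union>d \<and> \<Union>d \<subseteq> S \<and> (\<Sum>k\<in>d. Sup k - Inf k) < e / (L + 1)"
    have le: "Inf k \<le> Sup k" if k: "k \<in> d" for k
    proof -
      obtain a b where "k = cbox a b" "k \<noteq> {}"
        using division_ofD(3,4)[OF conjunct1[OF d] k] by blast
      then show ?thesis by simp
    qed
    have "(\<Sum>k\<in>d. norm (f (Sup k) - f (Inf k))) \<le> (\<Sum>k\<in>d. L * (Sup k - Inf k))"
    proof (rule sum_mono)
      fix k assume "k \<in> d"
      then show "norm (f (Sup k) - f (Inf k)) \<le> L * (Sup k - Inf k)" using lip[of "Sup k" "Inf k"] le by simp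
    qed
    also have "\<dots> = L * (\<Sum>k\<in>d. Sup k - Inf k)" by (simp add: sum_distrib_left)
    also have "\<dots> \<le> L * (e / (L + 1))" using d L by (intro mult_left_mono) auto
    also have "\<dots> < e" using e L by (simp add: field_simps)
    finally show "(\<Sum>k\<in>d. norm (f (Sup k) - f (Inf k))) < e" .
  qed
qed

lemma AE_interval_negligible:
  fixes P :: "real \<Rightarrow> bool"
  assumes "negligible N" "\<And>t. t \<in> {a..b} \<Longrightarrow> t \<notin> N \<Longrightarrow> P t"
  shows "AE t in lebesgue_on {a..b}. P t"
proof -
  have "AE t in lebesgue. t \<in> {a..b} \<longrightarrow> P t"
    unfolding eventually_ae_filter_negligible using assms by (intro exI[of _ N]) auto
  then show ?thesis by (subst AE_restrict_space_iff) auto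
qed

text \<open>
  The derivative exists almost everywhere, is bounded by the Lipschitz constant, and is measurable as an almost
  everywhere limit of difference quotients.
\<close>

lemma Lipschitz_in_Orlicz_Sobolev_periodic:
  fixes u :: "real \<Rightarrow> 'b::euclidean_space"
  assumes T: "T > 0" and lip: "\<And>s t. norm (u t - u s) \<le> L * \<bar>t - s\<bar>" and per: "u (-T) = u T"
    and G: "continuous_on UNIV G"
  shows "u \<in> Orlicz_Sobolev_periodic T G"
proof -
  let ?I = "{-T..T}"
  have L: "L \<ge> 0" using order_trans[OF norm_ge_zero lip[of 1 0]] by simp
  have "L-lipschitz_on UNIV u" using lip L by (auto simp: lipschitz_on_def dist_norm dist_real_def)
  then have cu: "continuous_on UNIV u" by (rule lipschitz_on_continuous_on)
  have cu_on: "continuous_on S u" for S by (rule continuous_on_subset[OF cu]) simp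
  have uO: "u \<in> Orlicz ?I G"
    unfolding Orlicz_def
    using continuous_imp_measurable_on_sets_lebesgue[OF cu_on[of ?I]]
      continuous_imp_integrable_real[OF continuous_on_compose2[OF G cu_on[of ?I]]] by simp
  define D where "D = {t. \<not> u differentiable (at t)}"
  have negD: "negligible D" unfolding D_def by (rule Lipschitz_differentiable_ae[OF lip])
  define d where "d k t = (u (t + 1 / real (Suc k)) - u t) /\<^sub>R (1 / real (Suc k))" for k t
  have dcont: "continuous_on UNIV (d k)" for k
    unfolding d_def by (intro continuous_intros continuous_on_compose2[OF cu]) auto
  have der: "(u has_vector_derivative vector_derivative u (at t)) (at t)" if "t \<notin> D" for t
    using that by (simp add: D_def vector_derivative_works)
  have dlim: "(\<lambda>k. d k t) \<longlonglongrightarrow> vector_derivative u (at t)" if t: "t \<notin> D" for t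
    unfolding LIMSEQ_iff
  proof (intro allI impI)
    fix e :: real assume "e > 0"
    then obtain s0 where s0: "s0 > 0" "\<And>s. 0 < s \<Longrightarrow> s < s0 \<Longrightarrow> norm ((u (t + s) - u t) /\<^sub>R s - vector_derivative u (at t)) \<le> e / 2"
      using right_difference_quotient[OF der[OF t], of "e / 2"] by auto
    obtain N where N: "1 / real (Suc N) < s0" using nat_approx_posE[OF s0(1)] by blast
    show "\<exists>N. \<forall>k\<ge>N. norm (d k t - vector_derivative u (at t)) < e"
    proof (intro exI[of _ N] allI impI)
      fix k assume "N \<le> k"
      then have "1 / real (Suc k) \<le> 1 / real (Suc N)" by (intro divide_left_mono) auto
      then have "norm (d k t - vector_derivative u (at t)) \<le> e / 2" unfolding d_def using N by (intro s0(2)) auto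
      then show "norm (d k t - vector_derivative u (at t)) < e" using \<open>e > 0\<close> by linarith
    qed
  qed
  have dbound: "norm (vector_derivative u (at t)) \<le> L" if "t \<notin> D" for t
  proof (rule Lim_bounded[OF tendsto_norm[OF dlim[OF that]], of 0], intro allI impI)
    fix k
    have "norm (u (t + 1 / real (Suc k)) - u t) \<le> L * (1 / real (Suc k))" using lip[of "t + 1 / real (Suc k)" t] by simp
    then show "norm (d k t) \<le> L" unfolding d_def norm_scaleR by (simp add: field_simps)
  qed
  have "(\<lambda>t. vector_derivative u (at t)) measurable_on UNIV"
    unfolding measurable_on_def using negD dcont dlim by (intro exI[of _ D] exI[of _ d]) auto
  then have "(\<lambda>t. vector_derivative u (at t)) \<in> borel_measurable (lebesgue_on ?I)"
    by (intro measurable_restrict_space1 measurable_on_imp_borel_measurable_lebesgue_UNIV)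
  then have "(\<lambda>t. vector_derivative u (at t)) measurable_on ?I"
    by (simp add: measurable_on_iff_borel_measurable)
  moreover have eq: "deriv_on ?I u t = vector_derivative u (at t)" if "t \<in> ?I - D" for t
    unfolding deriv_on_def using that T by (intro vector_derivative_at_within_ivl der) auto
  ultimately have "deriv_on ?I u measurable_on ?I" using measurable_on_spike[OF _ negD] by blast
  then have dm: "deriv_on ?I u \<in> borel_measurable (lebesgue_on ?I)" by (simp add: measurable_on_iff_borel_measurable)
  obtain B where B: "\<And>w. norm w \<le> L \<Longrightarrow> \<bar>G w\<bar> \<le> B"
  proof -
    have "compact (G ` cball 0 L)" by (intro compact_continuous_image continuous_on_subset[OF G]) auto
    then obtain B where "\<forall>y\<in>G ` cball 0 L. norm y \<le> B" using compact_imp_bounded bounded_iff by metis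
    then show thesis using that[of B] by simp
  qed
  have "integrable (lebesgue_on ?I) (\<lambda>t. G (deriv_on ?I u t))"
  proof (rule finite_measure.integrable_const_bound)
    show "finite_measure (lebesgue_on ?I)" by (rule finite_measure_lebesgue_on) simp
    show "(\<lambda>t. G (deriv_on ?I u t)) \<in> borel_measurable (lebesgue_on ?I)"
      using measurable_compose[OF dm borel_measurable_continuous_onI[OF G]] by simp
    show "AE t in lebesgue_on ?I. norm (G (deriv_on ?I u t)) \<le> B"
      by (rule AE_interval_negligible[OF negD]) (simp add: eq B dbound)
  qed
  then have "deriv_on ?I u \<in> Orlicz ?I G" unfolding Orlicz_def using dm by simp
  then show ?thesis
    unfolding Orlicz_Sobolev_periodic_def Orlicz_Sobolev_def
    using uO per Lipschitz_imp_abs_continuous_on[OF lip] by simp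
qed

lemma gradient_eqI:
  assumes "(f has_derivative (\<lambda>h. h \<bullet> D)) (at x)"
  shows "gradient f x = D"
  unfolding gradient_def gderiv_def
proof (rule the_equality)
  show "(f has_derivative (\<lambda>h. h \<bullet> D)) (at x)" by (rule assms)
next
  fix D' assume "(f has_derivative (\<lambda>h. h \<bullet> D')) (at x)"
  then have "(\<lambda>h. h \<bullet> D') = (\<lambda>h. h \<bullet> D)" using assms has_derivative_unique by blast
  then have "(D' - D) \<bullet> D' = (D' - D) \<bullet> D" by (rule fun_cong)
  then have "(D' - D) \<bullet> (D' - D) = 0" by (simp add: inner_diff_right)
  then show "D' = D" by simp
qed

lemma linear_functional_inner:
  fixes l :: "'b::euclidean_space \<Rightarrow> real"
  assumes "linear l"
  shows "l a = a \<bullet> (\<Sum>i\<in>Basis. l i *\<^sub>R i)"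
proof -
  have "l a = l (\<Sum>i\<in>Basis. (a \<bullet> i) *\<^sub>R i)" by (simp add: euclidean_representation)
  also have "\<dots> = (\<Sum>i\<in>Basis. (a \<bullet> i) * l i)" using assms by (simp add: linear_sum linear_scale)
  finally show ?thesis by (simp add: inner_sum_right mult.commute)
qed

lemma C1_on_two_variables:
  fixes f :: "real \<Rightarrow> 'c::euclidean_space \<Rightarrow> real"
  assumes "C1_on (I \<times> UNIV) (\<lambda>(t, z). f t z)"
  obtains D where "\<And>t z. t \<in> I \<Longrightarrow> (f t has_derivative (\<lambda>h. h \<bullet> D t z)) (at z)"
    "continuous_on (I \<times> UNIV) (\<lambda>(t, z). D t z)" "continuous_on (I \<times> UNIV) (\<lambda>(t, z). f t z)"
proof -
  obtain f' where f': "\<And>y. y \<in> I \<times> UNIV \<Longrightarrow> ((\<lambda>(t, z). f t z) has_derivative blinfun_apply (f' y)) (at y within I \<times> UNIV)"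
    and cf': "continuous_on (I \<times> UNIV) f'"
    using assms unfolding C1_on_def by blast
  define D where "D t z = (\<Sum>i\<in>Basis. blinfun_apply (f' (t, z)) (0, i) *\<^sub>R i)" for t z
  show thesis
  proof (rule that)
    fix t and z :: 'c assume t: "t \<in> I"
    have 1: "((\<lambda>z. (t, z)) has_derivative (\<lambda>h. (0, h))) (at z)" by (auto intro!: derivative_eq_intros)
    have 2: "((\<lambda>(t, z). f t z) has_derivative blinfun_apply (f' (t, z))) (at (t, z) within range (Pair t))"
      by (rule has_derivative_subset[OF f']) (use t in auto)
    have "(f t has_derivative (\<lambda>h. blinfun_apply (f' (t, z)) (0, h))) (at z)"
      using has_derivative_in_compose[OF 1 2] by simp
    moreover have "(\<lambda>h. blinfun_apply (f' (t, z)) (0, h)) = (\<lambda>h. h \<bullet> D t z)"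
      unfolding D_def by (rule ext, rule linear_functional_inner, rule has_derivative_linear[OF calculation])
    ultimately show "(f t has_derivative (\<lambda>h. h \<bullet> D t z)) (at z)" by simp
  next
    show "continuous_on (I \<times> UNIV) (\<lambda>(t, z). D t z)"
      unfolding D_def case_prod_unfold prod.collapse by (intro continuous_intros cf')
    show "continuous_on (I \<times> UNIV) (\<lambda>(t, z). f t z)"
      unfolding continuous_on_eq_continuous_within by (intro ballI has_derivative_continuous[OF f'])
  qed
qed

lemma C1_on_three_variables:
  fixes F :: "real \<Rightarrow> 'b::euclidean_space \<Rightarrow> 'b \<Rightarrow> real"
  assumes C1: "C1_on (I \<times> UNIV \<times> UNIV) (\<lambda>(t, x, v). F t x v)"
  shows "t \<in> I \<Longrightarrow> ((\<lambda>(x, v). F t x v) has_derivative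
      (\<lambda>(a, c). a \<bullet> gradient (\<lambda>y. F t y v) x + c \<bullet> gradient (F t x) v)) (at (x, v))"
    and "continuous_on (I \<times> UNIV \<times> UNIV) (\<lambda>(t, x, v). F t x v)"
    and "continuous_on (I \<times> UNIV \<times> UNIV) (\<lambda>(t, x, v). gradient (\<lambda>y. F t y v) x)"
    and "continuous_on (I \<times> UNIV \<times> UNIV) (\<lambda>(t, x, v). gradient (F t x) v)"
proof -
  have U: "(UNIV :: 'b set) \<times> (UNIV :: 'b set) = UNIV" by simp
  obtain D where D: "\<And>t z. t \<in> I \<Longrightarrow> ((\<lambda>(x, v). F t x v) has_derivative (\<lambda>h. h \<bullet> D t z)) (at z)"
    and cD: "continuous_on (I \<times> UNIV) (\<lambda>(t, z). D t z)" and cF: "continuous_on (I \<times> UNIV) (\<lambda>(t, z). (\<lambda>(x, v). F t x v) z)"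
    using C1_on_two_variables[of I "\<lambda>t (x, v). F t x v"] C1 unfolding U by auto
  have gx: "gradient (\<lambda>y. F t y v) x = fst (D t (x, v))" if "t \<in> I" for t x v
  proof (rule gradient_eqI)
    have l: "((\<lambda>y. (y, v)) has_derivative (\<lambda>r. (r, 0))) (at x)" by (auto intro!: derivative_eq_intros)
    from has_derivative_compose[OF l D[OF that]] show "((\<lambda>y. F t y v) has_derivative (\<lambda>h. h \<bullet> fst (D t (x, v)))) (at x)"
      by (simp add: inner_prod_def)
  qed
  have gv: "gradient (F t x) v = snd (D t (x, v))" if "t \<in> I" for t x v
  proof (rule gradient_eqI)
    have l: "((\<lambda>w. (x, w)) has_derivative (\<lambda>r. (0, r))) (at v)" by (auto intro!: derivative_eq_intros)
    from has_derivative_compose[OF l D[OF that]] show "(F t x has_derivative (\<lambda>h. h \<bullet> snd (D t (x, v)))) (at v)"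
      by (simp add: inner_prod_def)
  qed
  show "t \<in> I \<Longrightarrow> ((\<lambda>(x, v). F t x v) has_derivative
      (\<lambda>(a, c). a \<bullet> gradient (\<lambda>y. F t y v) x + c \<bullet> gradient (F t x) v)) (at (x, v))"
    using D[of t "(x, v)"] by (simp add: gx gv inner_prod_def case_prod_unfold)
  show "continuous_on (I \<times> UNIV \<times> UNIV) (\<lambda>(t, x, v). F t x v)"
    using cF unfolding U .
  have "continuous_on (I \<times> UNIV \<times> UNIV) (\<lambda>y. fst ((\<lambda>(t, z). D t z) y))"
    using continuous_on_fst[OF cD] unfolding U .
  then show "continuous_on (I \<times> UNIV \<times> UNIV) (\<lambda>(t, x, v). gradient (\<lambda>y. F t y v) x)"
    by (rule continuous_on_eq) (auto simp: gx)
  have "continuous_on (I \<times> UNIV \<times> UNIV) (\<lambda>y. snd ((\<lambda>(t, z). D t z) y))"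
    using continuous_on_snd[OF cD] unfolding U .
  then show "continuous_on (I \<times> UNIV \<times> UNIV) (\<lambda>(t, x, v). gradient (F t x) v)"
    by (rule continuous_on_eq) (auto simp: gv)
qed

lemma C1_on_two_variables_gradient:
  fixes V :: "real \<Rightarrow> 'b::euclidean_space \<Rightarrow> real"
  assumes C1: "C1_on (I \<times> UNIV) (\<lambda>(t, x). V t x)"
  shows "t \<in> I \<Longrightarrow> (V t has_derivative (\<lambda>a. a \<bullet> gradient (V t) x)) (at x)"
    and "continuous_on (I \<times> UNIV) (\<lambda>(t, x). V t x)"
    and "continuous_on (I \<times> UNIV) (\<lambda>(t, x). gradient (V t) x)"
proof -
  obtain D where D: "\<And>t z. t \<in> I \<Longrightarrow> (V t has_derivative (\<lambda>h. h \<bullet> D t z)) (at z)"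
    and cD: "continuous_on (I \<times> UNIV) (\<lambda>(t, z). D t z)" and cV: "continuous_on (I \<times> UNIV) (\<lambda>(t, z). V t z)"
    by (rule C1_on_two_variables[OF C1]) blast
  have g: "gradient (V t) x = D t x" if "t \<in> I" for t x by (rule gradient_eqI[OF D[OF that]])
  show "t \<in> I \<Longrightarrow> (V t has_derivative (\<lambda>a. a \<bullet> gradient (V t) x)) (at x)" using D g by simp
  show "continuous_on (I \<times> UNIV) (\<lambda>(t, x). V t x)" by (rule cV)
  show "continuous_on (I \<times> UNIV) (\<lambda>(t, x). gradient (V t) x)"
    using cD by (rule continuous_on_eq) (auto simp: g)
qed

lemma sample_below_average:
  fixes f :: "real \<Rightarrow> real"
  assumes f: "f integrable_on {a..b}" and "a < b" "\<delta> > 0"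
  shows "\<exists>s\<in>{a..b}. (b - a) * f s \<le> integral {a..b} f + (b - a) * \<delta>"
proof (rule ccontr)
  assume no: "\<not> ?thesis"
  let ?c = "integral {a..b} f / (b - a) + \<delta>"
  have "?c \<le> f s" if "s \<in> {a..b}" for s
  proof -
    have "integral {a..b} f + (b - a) * \<delta> < (b - a) * f s" using no that by (simp add: not_le)
    then show ?thesis using \<open>a < b\<close> by (simp add: field_simps)
  qed
  then have "integral {a..b} (\<lambda>_. ?c) \<le> integral {a..b} f"
    using f by (intro integral_le) auto
  moreover have "integral {a..b} (\<lambda>_. ?c) = (b - a) * ?c" using \<open>a < b\<close> by simp
  moreover have "(b - a) * ?c = integral {a..b} f + (b - a) * \<delta>" using \<open>a < b\<close> by (simp add: field_simps)
  ultimately show False using assms by (simp add: mult_le_0_iff)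
qed

text \<open>
  Every cell contains a point where the function is at most its mean over the cell, up to \<open>\<delta>\<close>. Riemann sums with
  arbitrary sample points need not be controlled by the integral, as the function is merely integrable.
\<close>

lemma sample_points:
  fixes f :: "real \<Rightarrow> real"
  assumes f: "f integrable_on {-T..T}" and T: "T > 0" and "\<delta> > 0" and n: "n > 0"
  defines "h \<equiv> 2 * T / real n"
  shows "\<exists>\<tau>. (\<forall>i<n. real i * h - T \<le> \<tau> i \<and> \<tau> i \<le> real (Suc i) * h - T) \<and>
    (\<Sum>i<n. h * f (\<tau> i)) \<le> integral {-T..T} f + 2 * T * \<delta>"
proof -
  have h: "h > 0" "real n * h = 2 * T" using T n by (auto simp: h_def)
  let ?t = "\<lambda>i::nat. real i * h - T"
  have sub: "?t (Suc i) \<le> T" "- T \<le> ?t i" if "i < n" for i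
  proof -
    have "real (Suc i) * h \<le> real n * h" using that h by (intro mult_right_mono) auto
    then show "?t (Suc i) \<le> T" using h by simp
    show "- T \<le> ?t i" using h by simp
  qed
  have t_Suc: "?t (Suc i) = ?t i + h" for i by (simp add: algebra_simps)
  have fi: "f integrable_on {?t i..?t (Suc i)}" if "i < n" for i
    using integrable_on_subinterval[OF f] sub[OF that] by auto
  have "\<forall>i\<in>{..<n}. \<exists>s. s \<in> {?t i..?t (Suc i)} \<and> h * f s \<le> integral {?t i..?t (Suc i)} f + h * \<delta>"
  proof
    fix i assume "i \<in> {..<n}"
    then show "\<exists>s. s \<in> {?t i..?t (Suc i)} \<and> h * f s \<le> integral {?t i..?t (Suc i)} f + h * \<delta>"
      using sample_below_average[OF fi[of i] _ \<open>\<delta> > 0\<close>] h t_Suc[of i] by auto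
  qed
  from bchoice[OF this] obtain \<tau> where \<tau>: "\<And>i. i < n \<Longrightarrow> \<tau> i \<in> {?t i..?t (Suc i)}"
    "\<And>i. i < n \<Longrightarrow> h * f (\<tau> i) \<le> integral {?t i..?t (Suc i)} f + h * \<delta>" by auto
  have "m \<le> n \<Longrightarrow> (\<Sum>i<m. integral {?t i..?t (Suc i)} f) = integral {-T..?t m} f" for m
  proof (induction m)
    case (Suc m)
    have "f integrable_on {-T..?t (Suc m)}"
      using integrable_on_subinterval[OF f] sub(1)[of m] Suc by auto
    moreover have "- T \<le> ?t m" "?t m \<le> ?t (Suc m)" using h t_Suc[of m] by auto
    ultimately show ?case using Henstock_Kurzweil_Integration.integral_combine[of "-T" "?t m" "?t (Suc m)" f] Suc by simp
  qed simp
  from this[of n] have "(\<Sum>i<n. integral {?t i..?t (Suc i)} f) = integral {-T..T} f" using h by simp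
  moreover have "(\<Sum>i<n. h * f (\<tau> i)) \<le> (\<Sum>i<n. integral {?t i..?t (Suc i)} f + h * \<delta>)"
    using \<tau>(2) by (intro sum_mono) auto
  moreover have "(\<Sum>i<n. h * \<delta>) = 2 * T * \<delta>" by (simp add: h(2)[symmetric])
  ultimately have "(\<Sum>i<n. h * f (\<tau> i)) \<le> integral {-T..T} f + 2 * T * \<delta>" unfolding sum.distrib by linarith
  then show ?thesis using \<tau>(1) by (intro exI[of _ \<tau>]) auto
qed

section \<open>Comparison of discretized actions and the limit equation\<close>

context discretization
begin

text \<open>
  In each cell the subgradient inequality at \<open>velocity x i\<close> bounds \<open>F\<close> at \<open>velocity y i\<close> from below, with an error from
  replacing \<open>y i\<close> by \<open>x i\<close>. Summation by parts moves the difference quotient in the linear term from \<open>y - x\<close>, which is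
  small, to the momentum, whose increments are at most \<open>mesh * L\<close>.
\<close>

lemma action_difference_lower_bound:
  assumes x: "x \<in> periodic_seqs n" and y: "y \<in> periodic_seqs n"
    and X: "\<And>i. norm (x i) \<le> X" "\<And>i. norm (y i) \<le> X"
    and R: "\<And>i. norm (velocity x i) \<le> R" "\<And>i. norm (velocity y i) \<le> R"
    and L: "\<And>i. norm (momentum x (Suc i) - momentum x i) \<le> mesh * L"
    and close: "\<And>i. norm (y i - x i) \<le> d"
    and unif: "common_modulus X R e d'"
    and d: "d < d'" and e: "e > 0"
  shows "action y \<ge> action x - 2 * T * (2 * e + 2 * R * e + L * d)"
proof -
  have d0: "d \<ge> 0" using order_trans[OF norm_ge_zero close[of 0]] .
  have diffP: "(\<lambda>i. y i - x i) \<in> periodic_seqs n" using x y by (simp add: periodic_seqs_def)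
  have vdiff: "velocity (\<lambda>i. y i - x i) i = velocity y i - velocity x i" for i
    by (simp add: velocity_def algebra_simps)
  have "- (\<Sum>i<n. mesh * (L * d)) \<le> (\<Sum>i<n. mesh * (momentum x i \<bullet> velocity (\<lambda>i. y i - x i) i))"
  proof -
    have "(momentum x i - momentum x (i + n - 1)) \<bullet> (y i - x i) \<le> mesh * (L * d)" for i
    proof -
      have "Suc (i + n - 1) = i + n" using n_pos by simp
      then have "norm (momentum x i - momentum x (i + n - 1)) \<le> mesh * L"
        using L[of "i + n - 1"] periodic_shift[OF momentum_periodic[OF x], of i] by simp
      then have "norm (momentum x i - momentum x (i + n - 1)) * norm (y i - x i) \<le> mesh * L * d"
        using close[of i] d0 by (intro mult_mono) (auto intro: order_trans[OF norm_ge_zero])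
      then show ?thesis using norm_cauchy_schwarz[of "momentum x i - momentum x (i + n - 1)" "y i - x i"] by simp
    qed
    then have "(\<Sum>i<n. (momentum x i - momentum x (i + n - 1)) \<bullet> (y i - x i)) \<le> (\<Sum>i<n. mesh * (L * d))"
      by (intro sum_mono)
    then show ?thesis unfolding sum_velocity_by_parts[OF momentum_periodic[OF x] diffP] by linarith
  qed
  moreover have "(\<Sum>i<n. mesh * (momentum x i \<bullet> velocity (\<lambda>i. y i - x i) i - 2 * e - 2 * R * e)) \<le> action y - action x"
    unfolding action_def sum_subtractf[symmetric] right_diff_distrib[symmetric]
  proof (intro sum_mono mult_left_mono)
    fix i
    let ?t = "\<tau> i" and ?v = "velocity x i" and ?w = "velocity y i"
    have U: "\<bar>F ?t (y i) ?v - F ?t (x i) ?v\<bar> \<le> e" "norm (Fv ?t (y i) ?v - Fv ?t (x i) ?v) \<le> e"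
      "\<bar>V ?t (y i) - V ?t (x i)\<bar> \<le> e"
      using common_modulusD[OF unif \<tau>_time \<tau>_time _ X(2) X(1) _ R(1), of i i i i i] close[of i] d d0 by auto
    have "F ?t (y i) ?w \<ge> F ?t (y i) ?v + Fv ?t (y i) ?v \<bullet> (?w - ?v)" by (rule F_subgradient[OF \<tau>_time])
    moreover have "(momentum x i - Fv ?t (y i) ?v) \<bullet> (?w - ?v) \<le> 2 * R * e"
    proof -
      have "norm (?w - ?v) \<le> 2 * R" using norm_triangle_ineq4[of ?w ?v] R(1)[of i] R(2)[of i] by linarith
      moreover have "norm (momentum x i - Fv ?t (y i) ?v) \<le> e"
        using U(2) unfolding momentum_def by (simp add: norm_minus_commute)
      ultimately have "norm (momentum x i - Fv ?t (y i) ?v) * norm (?w - ?v) \<le> e * (2 * R)"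
        using e by (intro mult_mono) auto
      then show ?thesis
        using norm_cauchy_schwarz[of "momentum x i - Fv ?t (y i) ?v" "?w - ?v"] by (simp add: mult.commute)
    qed
    ultimately show "momentum x i \<bullet> velocity (\<lambda>i. y i - x i) i - 2 * e - 2 * R * e
        \<le> F ?t (y i) ?w + V ?t (y i) - (F ?t (x i) ?v + V ?t (x i))"
      using U unfolding vdiff inner_diff_left by linarith
  qed (use mesh_pos in auto)
  moreover have "(\<Sum>i<n. mesh * (momentum x i \<bullet> velocity (\<lambda>i. y i - x i) i - 2 * e - 2 * R * e))
      = (\<Sum>i<n. mesh * (momentum x i \<bullet> velocity (\<lambda>i. y i - x i) i)) - (\<Sum>i<n. mesh * (2 * e + 2 * R * e))"
    unfolding sum_subtractf[symmetric] by (intro sum.cong refl) (simp add: algebra_simps)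
  moreover have m: "(\<Sum>i<n. mesh * c) = 2 * T * c" for c using n_mesh by (simp add: mult.assoc[symmetric])
  moreover have "2 * T * (2 * e + 2 * R * e + L * d) = 2 * T * (2 * e + 2 * R * e) + 2 * T * (L * d)"
    by (simp add: distrib_left)
  ultimately show ?thesis unfolding m by linarith
qed

end

context lagrangian
begin

lemma discretizationI:
  assumes "n > 0" "\<And>i. \<tau> i \<in> time" "\<tau> \<in> periodic_seqs n"
  shows "discretization T F Fx Fv V Vx n \<tau>"
  using assms by unfold_locales auto

lemma action_lower_semicontinuity:
  assumes "e > 0"
  obtains d where "d > 0" "\<And>n \<tau> x y. n > 0 \<Longrightarrow> (\<And>i. \<tau> i \<in> time) \<Longrightarrow> \<tau> \<in> periodic_seqs n \<Longrightarrow>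
    x \<in> periodic_seqs n \<Longrightarrow> y \<in> periodic_seqs n \<Longrightarrow> (\<And>i. norm (x i) \<le> X) \<Longrightarrow> (\<And>i. norm (y i) \<le> X) \<Longrightarrow>
    (\<And>i. norm (discretization.velocity T n x i) \<le> R) \<Longrightarrow> (\<And>i. norm (discretization.velocity T n y i) \<le> R) \<Longrightarrow>
    (\<And>i. norm (discretization.momentum T Fv n \<tau> x (Suc i) - discretization.momentum T Fv n \<tau> x i)
        \<le> discretization.mesh T n * L) \<Longrightarrow>
    (\<And>i. norm (y i - x i) \<le> d) \<Longrightarrow>
    discretization.action T F V n \<tau> y \<ge> discretization.action T F V n \<tau> x - e"
proof -
  obtain e' where e': "e' > 0" "2 * T * (2 + 2 * \<bar>R\<bar>) * e' = e / 2"
  proof -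
    have split: "\<exists>e'>0. A * e' = e / 2" if "A > 0" for A :: real
      using that assms by (intro exI[of _ "e / (2 * A)"]) auto
    have "2 * T * (2 + 2 * \<bar>R\<bar>) > 0" using T_pos by (intro mult_pos_pos) auto
    then show thesis using split that by blast
  qed
  obtain d' where d': "d' > 0" and unif: "common_modulus X R e' d'"
    by (rule uniformly_close[OF e'(1)])
  define d where "d = min (d' / 2) (e / (4 * T * (\<bar>L\<bar> + 1)))"
  have LT: "4 * T * (\<bar>L\<bar> + 1) > 0" using T_pos by simp
  have d: "d > 0" "d < d'" using d' LT assms by (auto simp: d_def)
  have "2 * T * (\<bar>L\<bar> + 1) * d \<le> 2 * T * (\<bar>L\<bar> + 1) * (e / (4 * T * (\<bar>L\<bar> + 1)))"
    using T_pos by (intro mult_left_mono) (auto simp: d_def)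
  also have "\<dots> = e / 2" using T_pos LT by (simp add: field_simps)
  finally have Ld: "2 * T * (\<bar>L\<bar> + 1) * d \<le> e / 2" .
  show thesis
  proof (rule that[OF d(1)])
    fix n \<tau> and x y :: "nat \<Rightarrow> 'b"
    assume n: "n > 0" "\<And>i. \<tau> i \<in> time" "\<tau> \<in> periodic_seqs n" and P: "x \<in> periodic_seqs n" "y \<in> periodic_seqs n"
      and b: "\<And>i. norm (x i) \<le> X" "\<And>i. norm (y i) \<le> X"
      "\<And>i. norm (discretization.velocity T n x i) \<le> R" "\<And>i. norm (discretization.velocity T n y i) \<le> R"
      "\<And>i. norm (discretization.momentum T Fv n \<tau> x (Suc i) - discretization.momentum T Fv n \<tau> x i)
        \<le> discretization.mesh T n * L" "\<And>i. norm (y i - x i) \<le> d"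
    interpret D: discretization T F Fx Fv V Vx n \<tau> by (rule discretizationI[OF n])
    have "D.action y \<ge> D.action x - 2 * T * (2 * e' + 2 * R * e' + L * d)"
      by (rule D.action_difference_lower_bound[OF P b unif d(2) e'(1)])
    moreover have "2 * T * (2 * e' + 2 * R * e' + L * d) \<le> e"
    proof -
      have "2 * e' + 2 * R * e' \<le> (2 + 2 * \<bar>R\<bar>) * e'" unfolding distrib_right using e' by (intro add_left_mono mult_right_mono) auto
      moreover have "L * d \<le> (\<bar>L\<bar> + 1) * d" using d by (intro mult_right_mono) auto
      ultimately have "2 * T * (2 * e' + 2 * R * e' + L * d) \<le> 2 * T * ((2 + 2 * \<bar>R\<bar>) * e' + (\<bar>L\<bar> + 1) * d)"
        using T_pos by (intro mult_left_mono) auto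
      also have "\<dots> = 2 * T * (2 + 2 * \<bar>R\<bar>) * e' + 2 * T * (\<bar>L\<bar> + 1) * d" by (simp add: algebra_simps)
      finally show ?thesis using e'(2) Ld by linarith
    qed
    ultimately show "D.action x - e \<le> D.action y" by linarith
  qed
qed

lemma limit_is_periodic_solution:
  assumes lip: "\<forall>s t. norm (u t - u s) \<le> L * \<bar>t - s\<bar>" "\<forall>s t. norm (p t - p s) \<le> L * \<bar>t - s\<bar>"
    and per: "u (-T) = u T" and G: "continuous_on UNIV G"
    and EL: "\<forall>t u' p'. -T < t \<and> t < T \<and> (u has_vector_derivative u') (at t) \<and> (p has_vector_derivative p') (at t) \<longrightarrow>
       p t = Fv t (u t) u' \<and> p' = Fx t (u t) u' + Vx t (u t)"
  shows "periodic_solution T G (\<lambda>t x v. F t x v + V t x) u"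
proof -
  note lip = lip[rule_format]
  define N where "N = {t. \<not> u differentiable (at t)} \<union> {t. \<not> p differentiable (at t)} \<union> {-T, T}"
  have N: "negligible N" unfolding N_def
    by (intro negligible_Un Lipschitz_differentiable_ae[OF lip(1)] Lipschitz_differentiable_ae[OF lip(2)]
        negligible_finite) auto
  have *: "p t = Fv t (u t) (deriv_on time u t) \<and>
      (p has_vector_derivative (Fx t (u t) (deriv_on time u t) + Vx t (u t))) (at t within time)"
    if t: "t \<in> time" "t \<notin> N" for t
  proof -
    have du: "(u has_vector_derivative vector_derivative u (at t)) (at t)"
      and dp: "(p has_vector_derivative vector_derivative p (at t)) (at t)"
      using t by (auto simp: N_def vector_derivative_works)
    have tt: "-T < t" "t < T" using t by (auto simp: N_def)
    have "deriv_on time u t = vector_derivative u (at t)"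
      unfolding deriv_on_def using tt by (intro vector_derivative_at_within_ivl du) auto
    then show ?thesis using EL[rule_format, OF conjI[OF tt(1) conjI[OF tt(2) conjI[OF du dp]]]]
        has_vector_derivative_at_within[OF dp] by simp
  qed
  have gv: "gradient (\<lambda>v. F t x v + V t x) w = Fv t x w" if "t \<in> time" for t x w
    by (rule gradient_eqI) (use F_derivative_v[OF that] in \<open>auto intro!: derivative_eq_intros\<close>)
  have gx: "gradient (\<lambda>x. F t x w + V t x) x = Fx t x w + Vx t x" if "t \<in> time" for t x w
  proof (rule gradient_eqI)
    from has_derivative_add[OF F_derivative_x[OF that] V_derivative[OF that]]
    show "((\<lambda>x. F t x w + V t x) has_derivative (\<lambda>h. h \<bullet> (Fx t x w + Vx t x))) (at x)"
      by (simp add: inner_add_right)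
  qed
  show ?thesis
    unfolding periodic_solution_def
  proof (intro conjI exI[of _ p])
    show "u \<in> Orlicz_Sobolev_periodic T G"
      by (rule Lipschitz_in_Orlicz_Sobolev_periodic[OF T_pos lip(1) per G])
    show "abs_continuous_on time p" by (rule Lipschitz_imp_abs_continuous_on[OF lip(2)])
    show "AE t in lebesgue_on time. p t = gradient (\<lambda>v. F t (u t) v + V t (u t)) (deriv_on time u t)"
      by (rule AE_interval_negligible[OF N]) (simp add: gv *)
    show "AE t in lebesgue_on time. (p has_vector_derivative
       gradient (\<lambda>x. F t x (deriv_on time u t) + V t x) (u t)) (at t within time)"
      by (rule AE_interval_negligible[OF N], subst gx) (use * in blast)+
  qed
qed

end

section \<open>Two solutions from two families of discrete critical points\<close>

context mountain_pass_lagrangian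
begin

text \<open>
  The sample times are chosen for \<open>g + c \<beta>\<close> with a small \<open>c > 0\<close>: as both functions are nonnegative, the Riemann sums
  of \<open>g\<close> then exceed the integral of \<open>g\<close> only slightly, and those of \<open>\<beta>\<close> are bounded, by a multiple of \<open>1/c\<close>.
\<close>

theorem two_periodic_solutions:
  assumes \<beta>: "integrable (lebesgue_on time) \<beta>" and g: "integrable (lebesgue_on time) g" "\<And>t. t \<in> time \<Longrightarrow> g t \<ge> 0"
    and small: "(LINT t|lebesgue_on time. g t) < min \<Lambda> b * \<rho>"
  shows "\<exists>u\<^sub>1 u\<^sub>2. periodic_solution T G (\<lambda>t x v. F t x v + V t x) u\<^sub>1 \<and>
    periodic_solution T G (\<lambda>t x v. F t x v + V t x) u\<^sub>2 \<and>
    (\<exists>t\<in>time. u\<^sub>1 t \<noteq> 0) \<and> (\<exists>t\<in>time. u\<^sub>2 t \<noteq> 0) \<and> (\<exists>t\<in>time. u\<^sub>1 t \<noteq> u\<^sub>2 t)"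
proof -
  define Ig where "Ig = integral time g"
  define I\<beta> where "I\<beta> = integral time \<beta>"
  have gi: "g integrable_on time" and \<beta>i: "\<beta> integrable_on time"
    using integrable_on_lebesgue_on[OF g(1)] integrable_on_lebesgue_on[OF \<beta>] by auto
  have Ig: "Ig < min \<Lambda> b * \<rho>" using small lebesgue_integral_eq_integral[OF g(1)] by (simp add: Ig_def)
  have I\<beta>0: "I\<beta> \<ge> 0" unfolding I\<beta>_def using \<beta>_nonneg by (intro integral_nonneg \<beta>i) auto
  define gap where "gap = min \<Lambda> b * \<rho> - Ig"
  have gap: "gap > 0" using Ig by (simp add: gap_def)
  define c where "c = gap / (4 * (I\<beta> + 1))"
  define \<delta> where "\<delta> = gap / (8 * T)"
  have c: "c > 0" "c * I\<beta> \<le> gap / 4"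
  proof -
    show "c > 0" using gap I\<beta>0 by (simp add: c_def)
    have "c * I\<beta> \<le> c * (I\<beta> + 1)" using \<open>c > 0\<close> by simp
    also have "\<dots> = gap / 4"
      unfolding c_def times_divide_eq_left using I\<beta>0 by (subst mult_divide_mult_cancel_right) auto
    finally show "c * I\<beta> \<le> gap / 4" .
  qed
  have \<delta>: "\<delta> > 0" "2 * T * \<delta> = gap / 4" using gap T_pos by (auto simp: \<delta>_def)
  define \<kappa> where "\<kappa> = Ig + gap / 2"
  have \<kappa>: "\<kappa> < min \<Lambda> b * \<rho>" using gap_def gap unfolding \<kappa>_def by linarith
  define B\<beta> where "B\<beta> = \<kappa> / c"
  have c\<beta>i: "(\<lambda>t. c * \<beta> t) integrable_on time" using integrable_on_cmult_left[OF \<beta>i, of c] by simp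
  have ci: "(\<lambda>t. g t + c * \<beta> t) integrable_on time"
    by (rule integrable_add[OF gi c\<beta>i])
  have Ici: "integral time (\<lambda>t. g t + c * \<beta> t) = Ig + c * I\<beta>"
    unfolding Ig_def I\<beta>_def using integral_add[OF gi c\<beta>i] by simp
  obtain z where z: "norm z > M" "2 * T * G z > \<rho>"
  proof -
    obtain K where K: "\<And>w. G w \<ge> 1 * norm w - K" using G_linear_minorant[of 1] by blast
    obtain z :: 'b where nz: "norm z = \<bar>M\<bar> + \<bar>K\<bar> + \<rho> + 1"
      using vector_choose_size[of "\<bar>M\<bar> + \<bar>K\<bar> + \<rho> + 1"] \<rho> by auto
    have "G z > \<rho>" using K[of z] nz by linarith
    moreover have "1 * G z \<le> 2 * T * G z" using period G_nonneg by (intro mult_right_mono)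
    ultimately show thesis using that[of z] nz \<rho> by linarith
  qed
  obtain C where C: "C \<ge> 0" "\<And>t s. t \<in> time \<Longrightarrow> s \<in> {0..1} \<Longrightarrow> V t (s *\<^sub>R z) \<le> C"
  proof -
    obtain B where B: "B \<ge> 0" "common_bound (norm z) 0 B" by (rule bounded_on_compact)
    have "V t (s *\<^sub>R z) \<le> B" if "t \<in> time" "s \<in> {0..1}" for t s
    proof -
      have "norm (s *\<^sub>R z) \<le> norm z" using that(2) by (simp add: mult_left_le_one_le)
      then have "\<bar>V t (s *\<^sub>R z)\<bar> \<le> B" using common_boundD[OF B(2) that(1), of _ 0] by simp
      then show ?thesis by linarith
    qed
    then show thesis using that B(1) by blast
  qed
  have TC: "2 * T * C \<ge> 0" using C(1) T_pos by simp
  have T\<eta>: "2 * T * \<eta> > 0" using T_pos \<eta> by simp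
  obtain X R where XR: "\<And>n \<tau> x. n > 0 \<Longrightarrow> (\<And>i. \<tau> i \<in> time) \<Longrightarrow> \<tau> \<in> periodic_seqs n \<Longrightarrow>
      (\<Sum>i<n. discretization.mesh T n * \<beta> (\<tau> i)) \<le> B\<beta> \<Longrightarrow> x \<in> periodic_seqs n \<Longrightarrow>
      discretization.action_grad T Fx Fv Vx n \<tau> x = (\<lambda>_. 0) \<Longrightarrow> discretization.action T F V n \<tau> x \<le> 2 * T * C \<Longrightarrow>
      (\<forall>i. norm (x i) \<le> X \<and> norm (discretization.velocity T n x i) \<le> R)"
    by (rule critical_points_uniformly_bounded[of B\<beta> "2 * T * C"]) blast
  define crit where "crit n \<tau> x \<longleftrightarrow> x \<in> periodic_seqs n \<and> discretization.action_grad T Fx Fv Vx n \<tau> x = (\<lambda>_. 0) \<and>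
      (\<forall>i. norm (x i) \<le> X \<and> norm (discretization.velocity T n x i) \<le> R)" for n \<tau> and x :: "nat \<Rightarrow> 'b"
  define grid where "grid n \<tau> \<longleftrightarrow> (\<forall>i. \<tau> i \<in> time) \<and> \<tau> \<in> periodic_seqs n \<and>
      (\<forall>i<n. real i * (2 * T / real n) - T \<le> \<tau> i \<and> \<tau> i \<le> real (Suc i) * (2 * T / real n) - T)" for n and \<tau> :: "nat \<Rightarrow> real"
  have "\<exists>\<tau> x y. grid n \<tau> \<and> crit n \<tau> x \<and> discretization.action T F V n \<tau> x \<le> - (2 * T * \<eta>) \<and>
      crit n \<tau> y \<and> (min \<Lambda> b * \<rho> - \<kappa>) / 2 \<le> discretization.action T F V n \<tau> y" if n: "n > 0" for n
  proof -
    define h where "h = 2 * T / real n"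
    have h: "h > 0" "real n * h = 2 * T" using n T_pos by (auto simp: h_def)
    obtain \<tau>0 where \<tau>0: "\<forall>i<n. real i * h - T \<le> \<tau>0 i \<and> \<tau>0 i \<le> real (Suc i) * h - T"
      "(\<Sum>i<n. h * (g (\<tau>0 i) + c * \<beta> (\<tau>0 i))) \<le> Ig + c * I\<beta> + 2 * T * \<delta>"
      using sample_points[OF ci T_pos \<delta>(1) n] unfolding h_def[symmetric] Ici by blast
    have \<tau>0I: "\<tau>0 i \<in> time" if "i < n" for i
    proof -
      have "real (Suc i) * h \<le> real n * h" using that h(1) by (intro mult_right_mono) auto
      moreover have "0 \<le> real i * h" using h(1) by simp
      ultimately show ?thesis using \<tau>0(1) that h(2) by force
    qed
    define \<tau> where "\<tau> i = \<tau>0 (i mod n)" for i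
    have \<tau>n: "\<tau> i = \<tau>0 i" if "i < n" for i using that by (simp add: \<tau>_def)
    have \<tau>: "\<tau> i \<in> time" "\<tau> \<in> periodic_seqs n" for i
      using \<tau>0I[of "i mod n"] n by (auto simp: \<tau>_def periodic_seqs_def)
    have grid: "grid n \<tau>" unfolding grid_def using \<tau> \<tau>0(1) \<tau>n by (simp add: h_def)
    interpret D: mountain_pass_discretization T F Fx Fv V Vx G a \<beta> g \<theta>F \<Lambda> M \<epsilon> \<theta>V p \<rho> b \<eta> e0 n \<tau>
      by (rule mountain_pass_discretizationI[OF n \<tau>])
    have mesh: "D.mesh = h" by (simp add: D.mesh_def h_def)
    have tot: "(\<Sum>i<n. h * g (\<tau> i)) + c * (\<Sum>i<n. h * \<beta> (\<tau> i)) \<le> \<kappa>"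
    proof -
      have "(\<Sum>i<n. h * g (\<tau> i)) + c * (\<Sum>i<n. h * \<beta> (\<tau> i)) = (\<Sum>i<n. h * (g (\<tau>0 i) + c * \<beta> (\<tau>0 i)))"
        unfolding sum_distrib_left sum.distrib[symmetric] by (intro sum.cong refl) (simp add: \<tau>n algebra_simps)
      then show ?thesis using \<tau>0(2) c(2) \<delta>(2) unfolding \<kappa>_def by linarith
    qed
    have "(\<Sum>i<n. h * g (\<tau> i)) \<ge> 0" using h(1) g(2)[OF \<tau>(1)] by (intro sum_nonneg) auto
    moreover have "(\<Sum>i<n. h * \<beta> (\<tau> i)) \<ge> 0" using h(1) \<beta>_nonneg[OF \<tau>(1)] by (intro sum_nonneg) auto
    then have "c * (\<Sum>i<n. h * \<beta> (\<tau> i)) \<ge> 0" using c(1) by simp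
    ultimately have sg: "(\<Sum>i<n. D.mesh * g (\<tau> i)) \<le> \<kappa>" and "c * (\<Sum>i<n. h * \<beta> (\<tau> i)) \<le> \<kappa>"
      using tot unfolding mesh by linarith+
    then have s\<beta>: "(\<Sum>i<n. D.mesh * \<beta> (\<tau> i)) \<le> B\<beta>"
      unfolding B\<beta>_def mesh using c(1) by (simp add: pos_le_divide_eq mult.commute)
    obtain x where x: "x \<in> periodic_seqs n" "D.action_grad x = (\<lambda>_. 0)" "D.action x \<le> - (2 * T * \<eta>)"
      using D.two_critical_points(1)[OF sg \<kappa> z C(2)] by blast
    obtain y where y: "y \<in> periodic_seqs n" "D.action_grad y = (\<lambda>_. 0)"
      "(min \<Lambda> b * \<rho> - \<kappa>) / 2 \<le> D.action y" "D.action y \<le> 2 * T * C"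
      using D.two_critical_points(2)[OF sg \<kappa> z C(2)] by blast
    have "D.action x \<le> 2 * T * C" using x(3) T\<eta> TC by linarith
    then have "crit n \<tau> x" unfolding crit_def using x XR[OF n \<tau> s\<beta> x(1,2)] by blast
    moreover have "crit n \<tau> y" unfolding crit_def using y XR[OF n \<tau> s\<beta> y(1,2,4)] by blast
    ultimately show ?thesis using grid x(3) y(3) by blast
  qed
  then have "\<exists>\<tau> x y. grid (Suc k) \<tau> \<and> crit (Suc k) \<tau> x \<and> discretization.action T F V (Suc k) \<tau> x \<le> - (2 * T * \<eta>) \<and>
      crit (Suc k) \<tau> y \<and> (min \<Lambda> b * \<rho> - \<kappa>) / 2 \<le> discretization.action T F V (Suc k) \<tau> y" for k by blast
  then obtain \<tau> x y where grid: "\<And>k. grid (Suc k) (\<tau> k)" and crx: "\<And>k. crit (Suc k) (\<tau> k) (x k)"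
    and Jx: "\<And>k. discretization.action T F V (Suc k) (\<tau> k) (x k) \<le> - (2 * T * \<eta>)"
    and cry: "\<And>k. crit (Suc k) (\<tau> k) (y k)"
    and Jy: "\<And>k. (min \<Lambda> b * \<rho> - \<kappa>) / 2 \<le> discretization.action T F V (Suc k) (\<tau> k) (y k)" by metis
  obtain B where B: "B \<ge> 0" "common_bound X R B" by (rule bounded_on_compact)
  define L where "L = 2 * B"
  have L0: "L \<ge> 0" using B(1) by (simp add: L_def)
  have force_bound: "norm (Fx t x v + Vx t x) \<le> L" if "t \<in> time" "norm x \<le> X" "norm v \<le> R" for t x v
    using common_boundD[OF B(2) that] norm_triangle_ineq[of "Fx t x v" "Vx t x"] unfolding L_def by linarith
  have X0: "X \<ge> 0" and R0: "R \<ge> 0"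
    using crx[of 0] unfolding crit_def by (meson norm_ge_zero order_trans)+
  have discr: "discretization T F Fx Fv V Vx (Suc k) (\<tau> k)" for k
    by (rule discretizationI) (use grid[of k] in \<open>auto simp: grid_def\<close>)
  have limit: "\<exists>r u p L. strict_mono (r :: nat \<Rightarrow> nat) \<and> u (-T) = u T \<and>
      (\<forall>s t. norm (u t - u s) \<le> L * \<bar>t - s\<bar>) \<and> (\<forall>s t. norm (p t - p s) \<le> L * \<bar>t - s\<bar>) \<and>
      (\<forall>e>0. \<exists>K. \<forall>k\<ge>K. \<forall>i\<le>Suc (q (r k)). norm (w (q (r k)) i - u (real i * (2 * T / real (Suc (q (r k)))) - T)) < e) \<and>
      (\<forall>t u' p'. -T < t \<and> t < T \<and> (u has_vector_derivative u') (at t) \<and> (p has_vector_derivative p') (at t) \<longrightarrow>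
         p t = Fv t (u t) u' \<and> p' = Fx t (u t) u' + Vx t (u t))"
    if w: "\<And>k. crit (Suc k) (\<tau> k) (w k)" and q: "strict_mono q" for w and q :: "nat \<Rightarrow> nat"
  proof (rule limit_of_discrete_extremals[where N="\<lambda>k. Suc (q k)" and \<tau>="\<lambda>k. \<tau> (q k)" and x="\<lambda>k. w (q k)"
      and v="\<lambda>k. discretization.velocity T (Suc (q k)) (w (q k))"
      and P="\<lambda>k i. discretization.momentum T Fv (Suc (q k)) (\<tau> (q k)) (w (q k)) (i + q k)" and X=X and R=R])
    \<comment> \<open>modulo the period \<open>Suc (q k)\<close> the index \<open>i + q k\<close> is the predecessor of \<open>i\<close>\<close>
    show "0 < Suc (q k)" for k by simp
    show "filterlim (\<lambda>k. Suc (q k)) at_top sequentially"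
      by (rule filterlim_compose[OF filterlim_Suc filterlim_subseq[OF q]])
    fix k i
    interpret D: discretization T F Fx Fv V Vx "Suc (q k)" "\<tau> (q k)" by (rule discr)
    note wk = w[of "q k", unfolded crit_def]
    have wP: "w (q k) \<in> periodic_seqs (Suc (q k))" using wk by blast
    show "w (q k) (Suc (q k)) = w (q k) 0" using D.periodic_shift[OF wP, of 0] by simp
    show "norm (w (q k) i) \<le> X" "norm (D.velocity (w (q k)) i) \<le> R" using wk by blast+
    show "w (q k) (Suc i) = w (q k) i + (2 * T / real (Suc (q k))) *\<^sub>R D.velocity (w (q k)) i"
      using D.step_velocity[of "w (q k)" i] by (simp only: D.mesh_def)
    have shift: "D.momentum (w (q k)) (Suc i + q k) = D.momentum (w (q k)) i"
      using D.periodic_shift[OF D.momentum_periodic[OF wP], of i] by simp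
    show "D.momentum (w (q k)) (Suc i + q k) = Fv (\<tau> (q k) i) (w (q k) i) (D.velocity (w (q k)) i)"
      unfolding shift by (rule D.momentum_def)
    have "D.momentum (w (q k)) i = D.momentum (w (q k)) (i + Suc (q k) - 1) + D.mesh *\<^sub>R D.force (w (q k)) i"
      using wk by (intro D.critical_momentum_step) blast
    then show "D.momentum (w (q k)) (Suc i + q k) = D.momentum (w (q k)) (i + q k) + (2 * T / real (Suc (q k))) *\<^sub>R
        (Fx (\<tau> (q k) i) (w (q k) i) (D.velocity (w (q k)) i) + Vx (\<tau> (q k) i) (w (q k) i))"
      unfolding shift D.force_def D.mesh_def by simp
    assume "i < Suc (q k)"
    then show "real i * (2 * T / real (Suc (q k))) - T \<le> \<tau> (q k) i \<and> \<tau> (q k) i \<le> real (Suc i) * (2 * T / real (Suc (q k))) - T"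
      using grid[of "q k"] unfolding grid_def by blast
  qed
  obtain r1 u1 p1 L1 where r1: "strict_mono (r1 :: nat \<Rightarrow> nat)" "u1 (-T) = u1 T"
      "\<forall>s t. norm (u1 t - u1 s) \<le> L1 * \<bar>t - s\<bar>" "\<forall>s t. norm (p1 t - p1 s) \<le> L1 * \<bar>t - s\<bar>"
    and near1: "\<forall>e>0. \<exists>K. \<forall>k\<ge>K. \<forall>i\<le>Suc (r1 k). norm (x (r1 k) i - u1 (real i * (2 * T / real (Suc (r1 k))) - T)) < e"
    and EL1: "\<forall>t u' p'. -T < t \<and> t < T \<and> (u1 has_vector_derivative u') (at t) \<and> (p1 has_vector_derivative p') (at t) \<longrightarrow>
         p1 t = Fv t (u1 t) u' \<and> p' = Fx t (u1 t) u' + Vx t (u1 t)"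
    using limit[OF crx, of "\<lambda>k. k"] by (auto simp: strict_mono_def)
  obtain r2 u2 p2 L2 where r2: "strict_mono (r2 :: nat \<Rightarrow> nat)" "u2 (-T) = u2 T"
      "\<forall>s t. norm (u2 t - u2 s) \<le> L2 * \<bar>t - s\<bar>" "\<forall>s t. norm (p2 t - p2 s) \<le> L2 * \<bar>t - s\<bar>"
    and near2: "\<forall>e>0. \<exists>K. \<forall>k\<ge>K. \<forall>i\<le>Suc (r1 (r2 k)). norm (y (r1 (r2 k)) i - u2 (real i * (2 * T / real (Suc (r1 (r2 k)))) - T)) < e"
    and EL2: "\<forall>t u' p'. -T < t \<and> t < T \<and> (u2 has_vector_derivative u') (at t) \<and> (p2 has_vector_derivative p') (at t) \<longrightarrow>
         p2 t = Fv t (u2 t) u' \<and> p' = Fx t (u2 t) u' + Vx t (u2 t)"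
    using limit[OF cry r1(1)] by blast
  have sol: "periodic_solution T G (\<lambda>t x v. F t x v + V t x) u1" "periodic_solution T G (\<lambda>t x v. F t x v + V t x) u2"
    by (rule limit_is_periodic_solution[OF r1(3,4,2) G_continuous EL1],
        rule limit_is_periodic_solution[OF r2(3,4,2) G_continuous EL2])
  define e where "e = min (2 * T * \<eta>) ((min \<Lambda> b * \<rho> - \<kappa>) / 2) / 2"
  have e: "e > 0" "2 * e \<le> 2 * T * \<eta>" "2 * e \<le> (min \<Lambda> b * \<rho> - \<kappa>) / 2"
  proof -
    have two_e: "2 * e = min (2 * T * \<eta>) ((min \<Lambda> b * \<rho> - \<kappa>) / 2)" by (simp add: e_def)
    show "2 * e \<le> 2 * T * \<eta>" "2 * e \<le> (min \<Lambda> b * \<rho> - \<kappa>) / 2"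
      unfolding two_e by (rule min.cobounded1, rule min.cobounded2)
    have "0 < min (2 * T * \<eta>) ((min \<Lambda> b * \<rho> - \<kappa>) / 2)" using T\<eta> \<kappa> by (intro min_less_iff_conj[THEN iffD2] conjI) auto
    then show "e > 0" unfolding e_def by (rule half_gt_zero)
  qed
  obtain d where d: "d > 0" and lsc: "\<And>n \<tau> x y. n > 0 \<Longrightarrow> (\<And>i. \<tau> i \<in> time) \<Longrightarrow> \<tau> \<in> periodic_seqs n \<Longrightarrow>
    x \<in> periodic_seqs n \<Longrightarrow> y \<in> periodic_seqs n \<Longrightarrow> (\<And>i. norm (x i) \<le> X) \<Longrightarrow> (\<And>i. norm (y i) \<le> X) \<Longrightarrow>
    (\<And>i. norm (discretization.velocity T n x i) \<le> R) \<Longrightarrow> (\<And>i. norm (discretization.velocity T n y i) \<le> R) \<Longrightarrow>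
    (\<And>i. norm (discretization.momentum T Fv n \<tau> x (Suc i) - discretization.momentum T Fv n \<tau> x i)
        \<le> discretization.mesh T n * L) \<Longrightarrow>
    (\<And>i. norm (y i - x i) \<le> d) \<Longrightarrow>
    discretization.action T F V n \<tau> y \<ge> discretization.action T F V n \<tau> x - e"
    by (rule action_lower_semicontinuity[OF e(1), of X R L]) blast
  obtain K1 where K1: "\<And>k i. k \<ge> K1 \<Longrightarrow> i \<le> Suc (r1 k) \<Longrightarrow>
      norm (x (r1 k) i - u1 (real i * (2 * T / real (Suc (r1 k))) - T)) < d / 2" using near1 half_gt_zero[OF d] by meson
  obtain K2 where K2: "\<And>k i. k \<ge> K2 \<Longrightarrow> i \<le> Suc (r1 (r2 k)) \<Longrightarrow>
      norm (y (r1 (r2 k)) i - u2 (real i * (2 * T / real (Suc (r1 (r2 k)))) - T)) < d / 2" using near2 half_gt_zero[OF d] by meson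
  \<comment> \<open>an index at which both families are \<open>d / 2\<close>-close to their limits on a common grid\<close>
  define k where "k = max K1 K2"
  define m where "m = r1 (r2 k)"
  define n where "n = Suc m"
  have n: "n > 0" by (simp add: n_def)
  have "r2 k \<ge> K1" using seq_suble[OF r2(1), of k] by (simp add: k_def)
  then have x_near: "norm (x m i - u1 (real i * (2 * T / real n) - T)) < d / 2" if "i < n" for i
    using K1[of "r2 k" i] that by (simp add: n_def m_def)
  have y_near: "norm (y m i - u2 (real i * (2 * T / real n) - T)) < d / 2" if "i < n" for i
    using K2[of k i] that by (simp add: n_def m_def k_def)
  have node: "real i * (2 * T / real n) - T \<in> time" if "i < n" for i
  proof -
    have "real i * (2 * T / real n) \<le> real n * (2 * T / real n)" using that T_pos by (intro mult_right_mono) auto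
    then show ?thesis using n T_pos by simp
  qed
  interpret D: discretization T F Fx Fv V Vx n "\<tau> m" unfolding n_def by (rule discr)
  have cx: "x m \<in> periodic_seqs n" "D.action_grad (x m) = (\<lambda>_. 0)" "\<And>i. norm (x m i) \<le> X" "\<And>i. norm (D.velocity (x m) i) \<le> R"
    using crx[of m] unfolding crit_def n_def by blast+
  have cy: "y m \<in> periodic_seqs n" "D.action_grad (y m) = (\<lambda>_. 0)" "\<And>i. norm (y m i) \<le> X" "\<And>i. norm (D.velocity (y m) i) \<le> R"
    using cry[of m] unfolding crit_def n_def by blast+
  have c0: "(\<lambda>_. 0::'b) \<in> periodic_seqs n" by (simp add: periodic_seqs_def)
  have v0: "D.velocity (\<lambda>_. 0::'b) i = 0" for i by (simp add: D.velocity_def)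
  have J0: "D.action (\<lambda>_. 0) = 0"
    unfolding D.action_def v0 using F_zero[OF D.\<tau>_time] V_zero[OF D.\<tau>_time] by simp
  have mom0: "D.momentum (\<lambda>_. 0) i = 0" for i unfolding D.momentum_def v0 by (rule Fv_zero[OF D.\<tau>_time])
  have mom_step: "norm (D.momentum w (Suc i) - D.momentum w i) \<le> D.mesh * L"
    if w: "w \<in> periodic_seqs n" "D.action_grad w = (\<lambda>_. 0)" "\<And>i. norm (w i) \<le> X" "\<And>i. norm (D.velocity w i) \<le> R" for w i
  proof -
    have "norm (D.momentum w (Suc i) - D.momentum w i) = D.mesh * norm (D.force w (Suc i))"
      using D.critical_momentum_Suc[OF w(2,1), of i] D.mesh_pos by simp
    also have "\<dots> \<le> D.mesh * L"
      unfolding D.force_def using D.mesh_pos force_bound[OF D.\<tau>_time w(3,4)] by (intro mult_left_mono) auto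
    finally show ?thesis .
  qed
  have all: "(\<And>i. norm (w i) \<le> d) " if "w \<in> periodic_seqs n" "\<And>i. i < n \<Longrightarrow> norm (w i) \<le> d" for w :: "nat \<Rightarrow> 'b"
    using that periodic_seqs_mod[OF that(1)] n by (metis mod_less_divisor)
  have Jxm: "D.action (x m) \<le> - (2 * T * \<eta>)" and Jym: "(min \<Lambda> b * \<rho> - \<kappa>) / 2 \<le> D.action (y m)"
    using Jx[of m] Jy[of m] by (simp_all add: n_def)
  note compare = lsc[OF n D.\<tau>_time D.\<tau>_periodic]
  have "\<exists>t\<in>time. u1 t \<noteq> 0"
  proof (rule ccontr)
    assume "\<not> ?thesis"
    then have "norm (x m i) \<le> d" if "i < n" for i using x_near[OF that] node[OF that] d by simp
    then have "norm (x m i) \<le> d" for i by (rule all[OF cx(1)])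
    then have "D.action (x m) \<ge> D.action (\<lambda>_. 0) - e"
      by (intro compare c0 cx) (use X0 R0 L0 D.mesh_pos in \<open>auto simp: v0 mom0\<close>)
    then show False using J0 Jxm e by linarith
  qed
  moreover have "\<exists>t\<in>time. u2 t \<noteq> 0"
  proof (rule ccontr)
    assume "\<not> ?thesis"
    then have "norm (y m i) \<le> d" if "i < n" for i using y_near[OF that] node[OF that] d by simp
    then have "norm (y m i) \<le> d" for i by (rule all[OF cy(1)])
    then have "D.action (\<lambda>_. 0) \<ge> D.action (y m) - e"
      by (intro compare c0 cy mom_step) (use X0 R0 in \<open>auto simp: v0\<close>)
    then show False using J0 Jym e by linarith
  qed
  moreover have "\<exists>t\<in>time. u1 t \<noteq> u2 t"
  proof (rule ccontr)
    assume eq: "\<not> ?thesis"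
    have "norm (x m i - y m i) \<le> d" if i: "i < n" for i
    proof -
      have "u1 (real i * (2 * T / real n) - T) = u2 (real i * (2 * T / real n) - T)" using eq node[OF i] by blast
      then show ?thesis
        using x_near[OF i] y_near[OF i] norm_triangle_ineq4[of "x m i - u1 (real i * (2 * T / real n) - T)" "y m i - u2 (real i * (2 * T / real n) - T)"]
        by simp
    qed
    moreover have "(\<lambda>i. x m i - y m i) \<in> periodic_seqs n" using cx(1) cy(1) by (simp add: periodic_seqs_def)
    ultimately have "norm (x m i - y m i) \<le> d" for i using all[of "\<lambda>i. x m i - y m i"] by blast
    then have "D.action (x m) \<ge> D.action (y m) - e" by (intro compare cx cy mom_step)
    then show False using Jxm Jym e T\<eta> by linarith
  qed
  ultimately show ?thesis using sol by blast
qed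

end

section \<open>Potentials near zero and the final theorem\<close>

lemma powr_tendsto_zero_right:
  fixes \<zeta> :: real
  assumes "\<zeta> > 0"
  shows "((\<lambda>l. l powr \<zeta>) \<longlongrightarrow> 0) (at_right 0)"
  by (rule tendsto_zero_powrI[OF tendsto_ident_at tendsto_const _ assms])
    (auto simp: eventually_at_filter)

text \<open>
  For \<open>l \<rightarrow> 0\<close> the scaling inequality at the origin gives \<open>V t 0 \<le> 0\<close>, and a continuous function that is nonpositive
  with zero integral vanishes.
\<close>

lemma potential_vanishes_at_zero:
  fixes V K W :: "real \<Rightarrow> 'b::real_normed_vector \<Rightarrow> real"
  assumes T: "T > 0" and V: "continuous_on ({-T..T} \<times> UNIV) (\<lambda>(t, x). V t x)"
    and int0: "(LINT t|lebesgue_on {-T..T}. V t 0) = 0"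
    and \<zeta>: "\<zeta>K > 0" "\<zeta>W > 0" "lV > 0"
    and scale: "\<And>l t. \<lbrakk>0 < l; l < lV; t \<in> {-T..T}\<rbrakk> \<Longrightarrow> V t 0 \<le> l powr \<zeta>K * K t 0 - l powr \<zeta>W * W t 0"
    and t: "t \<in> {-T..T}"
  shows "V t 0 = 0"
proof -
  have nonpos: "V t 0 \<le> 0" if t: "t \<in> {-T..T}" for t
  proof (rule tendsto_lowerbound)
    show "((\<lambda>l. l powr \<zeta>K * K t 0 - l powr \<zeta>W * W t 0) \<longlongrightarrow> 0) (at_right 0)"
      using tendsto_diff[OF tendsto_mult_right[OF powr_tendsto_zero_right[OF \<zeta>(1)]] tendsto_mult_right[OF powr_tendsto_zero_right[OF \<zeta>(2)]]]
      by force
    show "eventually (\<lambda>l. V t 0 \<le> l powr \<zeta>K * K t 0 - l powr \<zeta>W * W t 0) (at_right 0)"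
      unfolding eventually_at_right_field using \<zeta>(3) scale[OF _ _ t] by blast
  qed simp
  have c: "continuous_on {-T..T} (\<lambda>t. V t 0)"
  proof -
    have "continuous_on {-T..T} (\<lambda>t. (t, 0::'b))" by (intro continuous_intros)
    from continuous_on_compose2[OF V this] show ?thesis by auto
  qed
  have "integral {-T..T} (\<lambda>t. V t 0) = 0"
    using lebesgue_integral_eq_integral[OF continuous_imp_integrable_real[OF c]] int0 by simp
  moreover have "(\<lambda>t. V t 0) integrable_on {-T..T}" by (rule integrable_continuous_real[OF c])
  ultimately have "((\<lambda>t. - V t 0) has_integral - 0) {-T..T}" by (intro has_integral_neg) (simp add: has_integral_iff)
  then have "- V t 0 = 0"
    by (intro has_integral_0_cbox_imp_0[of "-T" T "\<lambda>t. - V t 0" t])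
      (use T t c nonpos in \<open>auto intro!: continuous_intros simp: cbox_interval\<close>)
  then show ?thesis by simp
qed

text \<open>
  At each time \<open>V t (l e) < 0\<close> for all small \<open>l\<close>, because \<open>\<zeta>W < \<zeta>K\<close> makes the \<open>W\<close> term dominate, but how small may
  depend on \<open>t\<close>, in an uncontrolled way as \<open>K\<close> and \<open>W\<close> need not be continuous. Along \<open>l = m ^ k\<close>, however, negativity
  passes from \<open>k\<close> to \<open>k + 1\<close>, so compactness of the time interval yields one \<open>k\<close> for all times.
\<close>

lemma negative_near_zero:
  fixes V K W :: "real \<Rightarrow> 'b::euclidean_space \<Rightarrow> real"
  assumes V: "continuous_on ({-T..T} \<times> UNIV) (\<lambda>(t, x). V t x)" and T: "T > 0"
    and V_KW: "\<And>t x. t \<in> {-T..T} \<Longrightarrow> V t x = K t x - W t x"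
    and \<zeta>: "\<zeta>W < \<zeta>K" "0 < lV" "lV < 1"
    and star: "\<And>x c. x \<in> D \<Longrightarrow> 0 \<le> c \<Longrightarrow> c \<le> 1 \<Longrightarrow> c *\<^sub>R x \<in> D"
    and W: "\<And>t x. \<lbrakk>t \<in> {-T..T}; x \<in> D; x \<noteq> 0\<rbrakk> \<Longrightarrow> W t x > 0"
    and scale: "\<And>l t x. \<lbrakk>0 < l; l < lV; t \<in> {-T..T}; x \<in> D\<rbrakk>
         \<Longrightarrow> V t (l *\<^sub>R x) \<le> l powr \<zeta>K * K t x - l powr \<zeta>W * W t x"
    and e: "e \<in> D" "e \<noteq> 0"
  obtains c \<eta> where "0 < c" "c \<le> 1" "\<eta> > 0" "\<And>t. t \<in> {-T..T} \<Longrightarrow> V t (c *\<^sub>R e) \<le> - \<eta>"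
proof -
  let ?I = "{-T..T}"
  define m where "m = lV / 2"
  have m: "0 < m" "m < lV" "m < 1" using \<zeta> by (auto simp: m_def)
  have mk: "0 < m ^ k" "m ^ k \<le> 1" "m ^ k *\<^sub>R e \<in> D" "m ^ k *\<^sub>R e \<noteq> 0" for k
    using m e star[of e "m ^ k"] by (auto simp: power_le_one)
  have cont: "continuous_on ?I (\<lambda>t. V t x)" for x
  proof -
    have "continuous_on ?I (\<lambda>t. (t, x))" by (intro continuous_intros)
    from continuous_on_compose2[OF V this] show ?thesis by auto
  qed
  have step: "V t (m ^ Suc k *\<^sub>R e) < 0" if t: "t \<in> ?I" and neg: "V t (m ^ k *\<^sub>R e) < 0" for t k
  proof -
    let ?x = "m ^ k *\<^sub>R e"
    have "V t (m *\<^sub>R ?x) \<le> m powr \<zeta>K * K t ?x - m powr \<zeta>W * W t ?x" by (rule scale[OF m(1,2) t mk(3)])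
    also have "\<dots> = m powr \<zeta>K * V t ?x + (m powr \<zeta>K - m powr \<zeta>W) * W t ?x"
      unfolding V_KW[OF t] by (simp add: algebra_simps)
    also have "\<dots> < 0"
    proof (rule add_neg_nonpos)
      show "m powr \<zeta>K * V t ?x < 0" using m neg by (intro mult_pos_neg) auto
      have "m powr \<zeta>K \<le> m powr \<zeta>W" using m \<zeta> by (intro powr_mono') auto
      then show "(m powr \<zeta>K - m powr \<zeta>W) * W t ?x \<le> 0"
        using W[OF t mk(3,4)] by (intro mult_nonpos_nonneg) (auto intro: less_imp_le)
    qed
    finally show ?thesis by simp
  qed
  have nonneg_down: "V t (m ^ j *\<^sub>R e) \<ge> 0" if t: "t \<in> ?I" and "j \<le> k" "V t (m ^ k *\<^sub>R e) \<ge> 0" for t j k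
    using that(2,3)
  proof (induction k rule: dec_induct)
    case (step k)
    then show ?case using \<open>\<And>t k. t \<in> ?I \<Longrightarrow> V t (m ^ k *\<^sub>R e) < 0 \<Longrightarrow> V t (m ^ Suc k *\<^sub>R e) < 0\<close>[OF t, of k] by (meson not_le)
  qed
  have pointwise: "\<exists>k. V t (m ^ k *\<^sub>R e) < 0" if t: "t \<in> ?I" for t
  proof -
    have We: "W t e > 0" by (rule W[OF t e])
    have "((\<lambda>l. l powr (\<zeta>K - \<zeta>W) * K t e) \<longlongrightarrow> 0 * K t e) (at_right 0)"
      using \<zeta> by (intro tendsto_mult_right powr_tendsto_zero_right) simp
    then have "eventually (\<lambda>l. l powr (\<zeta>K - \<zeta>W) * K t e < W t e) (at_right 0)"
      using We by (intro order_tendstoD(2)[of _ 0]) auto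
    then obtain r where r: "r > 0" "\<And>l. 0 < l \<Longrightarrow> l < r \<Longrightarrow> l powr (\<zeta>K - \<zeta>W) * K t e < W t e"
      unfolding eventually_at_right_field by auto
    obtain k where k: "m ^ k < min r lV" using real_arch_pow_inv[of "min r lV" m] r(1) \<zeta> m by auto
    let ?l = "m ^ k"
    have "V t (?l *\<^sub>R e) \<le> ?l powr \<zeta>K * K t e - ?l powr \<zeta>W * W t e"
      using k by (intro scale mk t e) auto
    also have "\<dots> = ?l powr \<zeta>W * (?l powr (\<zeta>K - \<zeta>W) * K t e - W t e)"
      using mk(1)[of k] by (simp add: right_diff_distrib powr_diff)
    also have "\<dots> < 0"
    proof (rule mult_pos_neg)
      show "?l powr \<zeta>W > 0" using m(1) by simp
      show "?l powr (\<zeta>K - \<zeta>W) * K t e - W t e < 0" using r(2)[OF mk(1)[of k]] k by simp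
    qed
    finally show ?thesis by blast
  qed
  have "\<exists>k. \<forall>t\<in>?I. V t (m ^ k *\<^sub>R e) < 0"
  proof (rule ccontr)
    assume "\<not> ?thesis"
    then have "\<forall>k. \<exists>t. t \<in> ?I \<and> V t (m ^ k *\<^sub>R e) \<ge> 0" by (meson not_le)
    from choice[OF this] obtain s where s: "\<And>k. s k \<in> ?I" "\<And>k. V (s k) (m ^ k *\<^sub>R e) \<ge> 0" by blast
    obtain t r where tr: "t \<in> ?I" "strict_mono (r :: nat \<Rightarrow> nat)" "(s \<circ> r) \<longlonglongrightarrow> t"
      using compact_Icc[of "-T" T] s(1) unfolding compact_def by blast
    obtain j where j: "V t (m ^ j *\<^sub>R e) < 0" using pointwise[OF tr(1)] by blast
    have "(\<lambda>k. V ((s \<circ> r) k) (m ^ j *\<^sub>R e)) \<longlonglongrightarrow> V t (m ^ j *\<^sub>R e)"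
      by (rule continuous_on_tendsto_compose[OF cont tr(3,1)]) (use s(1) in auto)
    moreover have "\<exists>N. \<forall>k\<ge>N. 0 \<le> V ((s \<circ> r) k) (m ^ j *\<^sub>R e)"
    proof (intro exI[of _ j] allI impI)
      fix k assume "j \<le> k"
      then have "j \<le> r k" using seq_suble[OF tr(2), of k] by linarith
      then show "0 \<le> V ((s \<circ> r) k) (m ^ j *\<^sub>R e)" using nonneg_down[OF s(1) _ s(2)] by simp
    qed
    ultimately have "0 \<le> V t (m ^ j *\<^sub>R e)" by (rule LIMSEQ_le_const)
    then show False using j by simp
  qed
  then obtain k where k: "\<And>t. t \<in> ?I \<Longrightarrow> V t (m ^ k *\<^sub>R e) < 0" by blast
  have "\<exists>t\<in>?I. \<forall>s\<in>?I. V s (m ^ k *\<^sub>R e) \<le> V t (m ^ k *\<^sub>R e)"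
    using T by (intro continuous_attains_sup cont) auto
  then obtain t where t: "t \<in> ?I" "\<And>s. s \<in> ?I \<Longrightarrow> V s (m ^ k *\<^sub>R e) \<le> V t (m ^ k *\<^sub>R e)" by blast
  show thesis
    by (rule that[of "m ^ k" "- V t (m ^ k *\<^sub>R e)"]) (use mk k t in auto)
qed

text \<open>
  The well hypothesis at the origin, where \<open>V\<close> vanishes, gives \<open>g \<ge> 0\<close>; outside the ball of radius \<open>M\<close>, eliminating \<open>K\<close> and
  \<open>W\<close> from the hypotheses on the potential leaves conditions on \<open>V\<close> alone; and a small multiple of a small vector is
  the constant at which the potential is negative at all times. These are the conditions for \<open>two_periodic_solutions\<close>.
\<close>

theorem theorem4p4:
  fixes T :: real
    and G :: "real ^ 'n \<Rightarrow> real"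
    and F :: "real \<Rightarrow> real ^ 'n \<Rightarrow> real ^ 'n \<Rightarrow> real"
    and V K W :: "real \<Rightarrow> real ^ 'n \<Rightarrow> real"
    and a \<beta> g :: "real \<Rightarrow> real"
    and \<theta>\<^sub>F \<Lambda> \<zeta>\<^sub>F l\<^sub>F M \<epsilon>\<^sub>V \<theta>\<^sub>V p\<^sub>K \<rho> b \<zeta>\<^sub>K \<zeta>\<^sub>W l\<^sub>V :: real
  defines "I \<equiv> {-T..T}"
  assumes T: "T > 0" "2 * T \<ge> 1"
    and G: "G_function G" "C1_on UNIV G" "Delta2_at_infinity G" "Nabla2_at_infinity G"
    and F_C1: "C1_on (I \<times> UNIV \<times> UNIV) (\<lambda>(t, x, v). F t x v)"
    and V_C1: "C1_on (I \<times> UNIV) (\<lambda>(t, x). V t x)"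
    and F1: "\<And>t x. t \<in> I \<Longrightarrow> convex_on UNIV (F t x)"
    and F2_a: "continuous_on {0..} a" "\<And>r. r \<ge> 0 \<Longrightarrow> a r \<ge> 0"
    and F2_\<beta>: "integrable (lebesgue_on I) \<beta>" "\<And>t. t \<in> I \<Longrightarrow> \<beta> t \<ge> 0"
    and F2:
      "\<And>t x v. t \<in> I \<Longrightarrow> \<bar>F t x v\<bar> \<le> a (norm x) * (\<beta> t + G v)"
      "\<And>t x v. t \<in> I \<Longrightarrow> norm (gradient (\<lambda>y. F t y v) x) \<le> a (norm x) * (\<beta> t + G v)"
      "\<And>t x v. t \<in> I \<Longrightarrow> fenchel_conjugate G (gradient (\<lambda>w. F t x w) v)
          \<le> a (norm x) * (\<beta> t + fenchel_conjugate G (gradient G v))"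
    and F3: "\<theta>\<^sub>F > 0"
      "\<And>t x v. t \<in> I \<Longrightarrow>
         inner (gradient (\<lambda>y. F t y v) x) x + inner (gradient (\<lambda>w. F t x w) v) v
           \<le> \<theta>\<^sub>F * F t x v"
    and F4: "\<Lambda> > 0" "\<And>t x v. t \<in> I \<Longrightarrow> F t x v \<ge> \<Lambda> * G v"
    and F5: "\<And>t x. t \<in> I \<Longrightarrow> F t x 0 = 0"
      "\<And>t x. t \<in> I \<Longrightarrow> gradient (\<lambda>w. F t x w) 0 = 0"
    and F6: "\<zeta>\<^sub>F > 1" "0 < l\<^sub>F" "l\<^sub>F < 1"
      "\<And>l t x v. \<lbrakk>0 < l; l < l\<^sub>F; t \<in> I; G (x /\<^sub>R (2 * (2 * T))) \<le> \<rho> / 2\<rbrakk>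
         \<Longrightarrow> F t (l *\<^sub>R x) (l *\<^sub>R v) \<le> l powr \<zeta>\<^sub>F * F t x v"
    and V1: "\<And>t x. t \<in> I \<Longrightarrow> V t x = K t x - W t x"
    and V2: "M > 0" "\<epsilon>\<^sub>V > 0" "\<theta>\<^sub>V > \<theta>\<^sub>F" "1 < p\<^sub>K" "p\<^sub>K \<le> \<theta>\<^sub>V - \<epsilon>\<^sub>V"
      "\<And>t x. \<lbrakk>t \<in> I; norm x > M\<rbrakk>
         \<Longrightarrow> inner (gradient (V t) x) x \<le> (\<theta>\<^sub>V - \<epsilon>\<^sub>V) * K t x - \<theta>\<^sub>V * W t x"
      "\<And>t x. \<lbrakk>t \<in> I; norm x > M\<rbrakk> \<Longrightarrow> W t x > K t x \<and> K t x > norm x powr p\<^sub>K"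
    and V3: "\<rho> > 0" "b > 1" "integrable (lebesgue_on I) g"
      "\<And>t x. \<lbrakk>t \<in> I; G (x /\<^sub>R (2 * (2 * T))) \<le> \<rho> / 2\<rbrakk> \<Longrightarrow> V t x \<ge> b * G x - g t"
    and V4: "(LINT t|lebesgue_on I. V t 0) = 0"
    and V5: "\<zeta>\<^sub>K > 1" "\<zeta>\<^sub>W > 1" "\<zeta>\<^sub>W < min \<zeta>\<^sub>F \<zeta>\<^sub>K" "0 < l\<^sub>V" "l\<^sub>V < 1"
      "\<And>t x. \<lbrakk>t \<in> I; G (x /\<^sub>R (2 * (2 * T))) \<le> \<rho> / 2; x \<noteq> 0\<rbrakk> \<Longrightarrow> W t x > 0"
      "\<And>l t x. \<lbrakk>0 < l; l < l\<^sub>V; t \<in> I; G (x /\<^sub>R (2 * (2 * T))) \<le> \<rho> / 2\<rbrakk>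
         \<Longrightarrow> V t (l *\<^sub>R x) \<le> l powr \<zeta>\<^sub>K * K t x - l powr \<zeta>\<^sub>W * W t x"
    and f: "(LINT t|lebesgue_on I. g t) < min \<Lambda> (b - 1) * \<rho>"
  shows "\<exists>u\<^sub>1 u\<^sub>2. periodic_solution T G (\<lambda>t x v. F t x v + V t x) u\<^sub>1 \<and>
    periodic_solution T G (\<lambda>t x v. F t x v + V t x) u\<^sub>2 \<and>
    (\<exists>t\<in>I. u\<^sub>1 t \<noteq> 0) \<and> (\<exists>t\<in>I. u\<^sub>2 t \<noteq> 0) \<and> (\<exists>t\<in>I. u\<^sub>1 t \<noteq> u\<^sub>2 t)"
proof -
  have G_nonneg: "G x \<ge> 0" and G_convex: "convex_on UNIV G" and G_even: "G (- x) = G x" and G0: "G 0 = 0"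
    and G_super: "filterlim (\<lambda>x. G x / norm x) at_top at_infinity" for x
    using G(1) unfolding G_function_def by auto
  have G_scale: "G (c *\<^sub>R x) \<le> c * G x" if "0 \<le> c" "c \<le> 1" for c x
    using convex_onD[OF G_convex, of c 0 x] that G0 by simp
  have G_shrink: "G (c *\<^sub>R x) \<le> G x" if "0 \<le> c" "c \<le> 1" for c x
    using order_trans[OF G_scale[OF that] mult_right_mono[OF that(2) G_nonneg]] by simp
  \<comment> \<open>the region around the origin in which the potential well and the scaling hypotheses hold\<close>
  define D where "D = {x. G (x /\<^sub>R (2 * (2 * T))) \<le> \<rho> / 2}"
  have star: "c *\<^sub>R x \<in> D" if "x \<in> D" "0 \<le> c" "c \<le> 1" for x c
  proof -
    have eq: "(c *\<^sub>R x) /\<^sub>R (2 * (2 * T)) = c *\<^sub>R (x /\<^sub>R (2 * (2 * T)))" by (rule scaleR_left_commute)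
    then show ?thesis using that(1) G_shrink[OF that(2,3), of "x /\<^sub>R (2 * (2 * T))"] unfolding D_def mem_Collect_eq eq
      by linarith
  qed
  note F' = C1_on_three_variables[OF F_C1]
  note V' = C1_on_two_variables_gradient[OF V_C1]
  have VI: "continuous_on ({-T..T} \<times> UNIV) (\<lambda>(t, x). V t x)" using V'(2) by (simp add: I_def)
  \<comment> \<open>the norm of \<open>e\<close> is \<open>s\<close>, small enough for \<open>(4 * T + 4) * G e \<le> \<rho>\<close>, which covers both conditions\<close>
  obtain e where e: "e \<noteq> 0" "e \<in> D" "2 * T * G e < \<rho>"
  proof -
    obtain v :: "real ^ 'n" where v: "norm v = 1" using vector_choose_size[of 1] by auto
    define s where "s = min 1 (\<rho> / (2 * (2 * T + 2) * (G v + 1)))"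
    have den: "2 * (2 * T + 2) * (G v + 1) > 0" using T G_nonneg[of v] by (intro mult_pos_pos) auto
    have s: "0 < s" "s \<le> 1" using V3(1) den by (auto simp: s_def)
    have "s * (2 * (2 * T + 2) * (G v + 1)) \<le> \<rho>"
      using den by (simp add: s_def min_le_iff_disj flip: pos_le_divide_eq)
    moreover have "s * (2 * (2 * T + 2) * G v) \<le> s * (2 * (2 * T + 2) * (G v + 1))"
      using s T by (intro mult_left_mono) auto
    moreover have "2 * (2 * T + 2) * G (s *\<^sub>R v) \<le> 2 * (2 * T + 2) * (s * G v)"
      using s T by (intro mult_left_mono G_scale) auto
    ultimately have b: "2 * (2 * T + 2) * G (s *\<^sub>R v) \<le> \<rho>" by (simp add: mult.left_commute)
    have TG: "T * G (s *\<^sub>R v) \<ge> 0" using T G_nonneg by simp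
    have b': "4 * (T * G (s *\<^sub>R v)) + 4 * G (s *\<^sub>R v) \<le> \<rho>" using b by (simp add: algebra_simps)
    have "inverse (2 * (2 * T)) \<le> 1" using T by (simp add: inverse_eq_divide divide_le_eq)
    then have "G (s *\<^sub>R v /\<^sub>R (2 * (2 * T))) \<le> G (s *\<^sub>R v)" using T by (intro G_shrink) auto
    then have "s *\<^sub>R v \<in> D" unfolding D_def mem_Collect_eq using b' TG G_nonneg[of "s *\<^sub>R v"] V3(1) by linarith
    moreover have "2 * T * G (s *\<^sub>R v) < \<rho>" unfolding mult.assoc using b' TG G_nonneg[of "s *\<^sub>R v"] V3(1) by linarith
    moreover have "s *\<^sub>R v \<noteq> 0" using s v by auto
    ultimately show thesis using that by blast
  qed
  obtain c \<eta> where c: "0 < c" "c \<le> 1" and \<eta>: "\<eta> > 0" "\<And>t. t \<in> {-T..T} \<Longrightarrow> V t (c *\<^sub>R e) \<le> - \<eta>"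
    by (rule negative_near_zero[OF VI T(1) V1[unfolded I_def] _ V5(4,5) star V5(6)[unfolded I_def]
          V5(7)[unfolded I_def] e(2,1)]) (use V5(3) in \<open>auto simp: D_def\<close>)
  have V0: "V t 0 = 0" if "t \<in> I" for t
  proof (rule potential_vanishes_at_zero[OF T(1) VI, where \<zeta>K=\<zeta>\<^sub>K and \<zeta>W=\<zeta>\<^sub>W and lV=l\<^sub>V and K=K and W=W])
    show "V t 0 \<le> l powr \<zeta>\<^sub>K * K t 0 - l powr \<zeta>\<^sub>W * W t 0" if "0 < l" "l < l\<^sub>V" "t \<in> {-T..T}" for l t
      using V5(7)[of l t 0] that G0 V3(1) by (simp add: I_def)
  qed (use V4 V5 that in \<open>auto simp: I_def\<close>)
  have g0: "g t \<ge> 0" if "t \<in> I" for t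
    using V3(4)[OF that, of 0] V0[OF that] G0 V3(1) by simp
  interpret mountain_pass_lagrangian T F "\<lambda>t x v. gradient (\<lambda>y. F t y v) x" "\<lambda>t x v. gradient (F t x) v" V "\<lambda>t. gradient (V t)"
    G a \<beta> g \<theta>\<^sub>F \<Lambda> M \<epsilon>\<^sub>V \<theta>\<^sub>V p\<^sub>K \<rho> b \<eta> "c *\<^sub>R e"
  proof (unfold_locales, goal_cases)
    case 1 show ?case by (rule T(1))
  next
    case (2 t x v) then show ?case using F'(1)[of t v x] by (simp add: I_def)
  next
    case (3 t x) then show ?case using V'(1)[of t x] by (simp add: I_def)
  next
    case 4 show ?case using F'(2) by (simp add: I_def)
  next
    case 5 show ?case using F'(3) by (simp add: I_def)
  next
    case 6 show ?case using F'(4) by (simp add: I_def)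
  next
    case 7 show ?case by (rule VI)
  next
    case 8 show ?case using V'(3) by (simp add: I_def)
  next
    case (9 t x) then show ?case using F1 by (simp add: I_def)
  next
    case 10 show ?case by (rule T(2))
  next
    case (11 x) show ?case by (rule G_nonneg)
  next
    case 12 show ?case by (rule G_convex)
  next
    case (13 x) show ?case by (rule G_even)
  next
    case 14 show ?case by (rule G0)
  next
    case 15 show ?case by (rule G_super)
  next
    case 16 show ?case by (rule F2_a(1))
  next
    case (17 t) then show ?case using F2_\<beta>(2) by (simp add: I_def)
  next
    case (18 t x v) then show ?case using F2(2) by (simp add: I_def)
  next
    case (19 t x v) then show ?case using F3(2) by (simp add: I_def)
  next
    case 20 show ?case by (rule F3(1))
  next
    case 21 show ?case by (rule V2(3))
  next
    case 22 show ?case by (rule F4(1))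
  next
    case (23 t v x) then show ?case using F4(2) by (simp add: I_def)
  next
    case (24 t x) then show ?case using F5(1) by (simp add: I_def)
  next
    case (25 t x) then show ?case using F5(2) by (simp add: I_def)
  next
    case 26 show ?case by (rule V2(2))
  next
    case 27 show ?case by (rule V2(4))
  next
    case (28 t x)
    then have t: "t \<in> I" by (simp add: I_def)
    have "\<epsilon>\<^sub>V * norm x powr p\<^sub>K \<le> \<epsilon>\<^sub>V * K t x" using V2(2) V2(7)[OF t 28(2)] by (intro mult_left_mono) auto
    moreover have "\<theta>\<^sub>V * V t x = (\<theta>\<^sub>V - \<epsilon>\<^sub>V) * K t x - \<theta>\<^sub>V * W t x + \<epsilon>\<^sub>V * K t x"
      unfolding V1[OF t] by (simp add: algebra_simps)
    ultimately show ?case using V2(6)[OF t 28(2)] by linarith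
  next
    case (29 t x)
    then show ?case using V2(7)[of t x] V1[of t x] by (simp add: I_def)
  next
    case 30 show ?case by (rule V3(1))
  next
    case 31 show ?case using V3(2) by simp
  next
    case (32 t x) then show ?case using V3(4) by (simp add: I_def)
  next
    case (33 t) then show ?case using V0 by (simp add: I_def)
  next
    case 34 show ?case by (rule \<eta>(1))
  next
    case 35
    have "2 * T * G (c *\<^sub>R e) \<le> 2 * T * G e" using c T by (intro mult_left_mono G_shrink) auto
    then show ?case using e(3) by linarith
  next
    case (36 t) then show ?case by (rule \<eta>(2))
  qed
  have "min \<Lambda> (b - 1) * \<rho> \<le> min \<Lambda> b * \<rho>" using V3(1) by (intro mult_right_mono) auto
  then have "(LINT t|lebesgue_on {-T..T}. g t) < min \<Lambda> b * \<rho>" using f by (simp add: I_def)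
  then show ?thesis
    using two_periodic_solutions F2_\<beta>(1) V3(3) g0 unfolding I_def by blast
qed

end
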